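(* Let $G$ be a semi-Hamiltonian graph. Then for every positive integer $s$ with $s\leq \mathrm{match}(G)$, we have $$\mathrm{reg}\big(I(G)^{[s]}\big)\leq \mathrm{match}(G)+s.$$
   Context: Let $\mathbb{K}$ be a field and $S=\mathbb{K}[x_1,\ldots,x_n]$ the standard graded polynomial ring. Graphs are finite and simple. For a graph $G$ with vertex set $V(G)=\{x_1,\ldots,x_n\}$ (vertices are identified with variables of $S$), the edge ideal is $I(G)=(x_ix_j : x_ix_j\in E(G))\subseteq S$. A matching is a set of pairwise disjoint edges, and $\mathrm{match}(G)$ is the maximum size of a matching of $G$. For a squarefree monomial ideal $I$, the $s$-th squarefree power $I^{[s]}$ is the ideal generated by the squarefree monomials belonging to $I^s$; thus $I(G)^{[s]}$ is generated by the products $e_1\cdots e_s$ with $\{e_1,\ldots,e_s\}$ a matching of $G$. For a finitely generated graded $S$-module $M$ with graded Betti numbers $\beta_{i,j}(M)$, the Castelnuovo--Mumford regularity is $\mathrm{reg}(M)=\max\{j-i : \beta_{i,j}(M)\neq 0\}$. A graph is semi-Hamiltonian if it has a Hamiltonian path, i.e. a path (with no repeated vertices) which visits every vertex of the graph. *)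

theory Defs
  imports
    "HOL-Library.Poly_Mapping"
    "HOL-Library.Disjoint_Sets"
    "Jordan_Normal_Form.Matrix_Kernel"
begin

section \<open>The polynomial ring on a finite set of variables\<close>

text \<open>The vertices of the graph are the elements of a finite type \<open>'v\<close>, and
  \<open>('v, 'k) mpoly\<close> is the polynomial ring over \<open>'k\<close> with one variable for each vertex.\<close>

type_synonym ('v, 'k) mpoly = "('v \<Rightarrow>\<^sub>0 nat) \<Rightarrow>\<^sub>0 'k"

definition Var :: "'v \<Rightarrow> ('v, 'k::field) mpoly" where
  "Var v = Poly_Mapping.single (Poly_Mapping.single v 1) 1"

definition mon_deg :: "('v::finite \<Rightarrow>\<^sub>0 nat) \<Rightarrow> nat" where
  "mon_deg m = (\<Sum>v\<in>UNIV. Poly_Mapping.lookup m v)"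

text \<open>The zero polynomial is homogeneous of every degree, and it is the only homogeneous
  polynomial of negative degree.\<close>

definition homogeneous :: "int \<Rightarrow> ('v::finite, 'k::field) mpoly \<Rightarrow> bool" where
  "homogeneous d p \<longleftrightarrow> (\<forall>m\<in>Poly_Mapping.keys p. int (mon_deg m) = d)"

definition squarefree_monomial :: "('v, 'k::field) mpoly \<Rightarrow> bool" where
  "squarefree_monomial p \<longleftrightarrow>
     (\<exists>m. p = Poly_Mapping.single m 1 \<and> (\<forall>v. Poly_Mapping.lookup m v \<le> 1))"

definition ideal_gen :: "'a::comm_ring_1 set \<Rightarrow> 'a set" where
  "ideal_gen A = Modules.module.span (*) A"

definition ideal_power :: "'a::comm_ring_1 set \<Rightarrow> nat \<Rightarrow> 'a set" where
  "ideal_power I s = ideal_gen {prod_list fs | fs. length fs = s \<and> set fs \<subseteq> I}"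

definition squarefree_power :: "('v, 'k::field) mpoly set \<Rightarrow> nat \<Rightarrow> ('v, 'k) mpoly set" where
  "squarefree_power I s = ideal_gen {p \<in> ideal_power I s. squarefree_monomial p}"

definition irrelevant_ideal :: "('v, 'k::field) mpoly set" where
  "irrelevant_ideal = ideal_gen (range Var)"


section \<open>Graded Betti numbers and regularity\<close>

text \<open>A graded module over the polynomial ring is given by its scalar multiplication
  \<open>scale\<close> and its homogeneous components \<open>D j\<close> for \<open>j :: int\<close>; its underlying module is
  the span of the union of the components.

  A graded free resolution
  \<open>\<dots> \<rightarrow> F 2 \<rightarrow> F 1 \<rightarrow> F 0 \<rightarrow> M \<rightarrow> 0\<close>
  with free modules of finite rank is given by
  \<^item> the degrees \<open>degs i\<close> of the elements of a homogeneous basis of \<open>F i\<close>, so that \<open>F i\<close> is the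
    direct sum of the modules \<open>S(-d)\<close> with \<open>d\<close> ranging over the list \<open>degs i\<close>,
  \<^item> the images \<open>gens\<close> in \<open>M\<close> of the basis elements of \<open>F 0\<close>,
  \<^item> the matrices \<open>diff i\<close> of the maps \<open>F (Suc i) \<rightarrow> F i\<close>.

  The resolution may be infinite; it is finite if \<open>degs i\<close> is eventually empty. The
  homogeneity conditions say that all maps preserve degrees.\<close>

definition graded_free_resolution ::
  "(('v::finite, 'k::field) mpoly \<Rightarrow> 'm::ab_group_add \<Rightarrow> 'm) \<Rightarrow> (int \<Rightarrow> 'm set) \<Rightarrow>
   (nat \<Rightarrow> int list) \<Rightarrow> 'm list \<Rightarrow> (nat \<Rightarrow> ('v, 'k) mpoly mat) \<Rightarrow> bool" where
  "graded_free_resolution scale D degs gens diff \<longleftrightarrow>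
     length gens = length (degs 0) \<and>
     (\<forall>k<length gens. gens ! k \<in> D (degs 0 ! k)) \<and>
     (\<forall>i. diff i \<in> carrier_mat (length (degs i)) (length (degs (Suc i)))) \<and>
     (\<forall>i. \<forall>l<length (degs i). \<forall>k<length (degs (Suc i)).
        homogeneous (degs (Suc i) ! k - degs i ! l) (diff i $$ (l, k))) \<and>
     \<comment> \<open>exactness at \<open>M\<close>, at \<open>F 0\<close>, and at \<open>F (Suc i)\<close>\<close>
     Modules.module.span scale (set gens) = Modules.module.span scale (\<Union>j. D j) \<and>
     {a \<in> carrier_vec (length gens). (\<Sum>k<length gens. scale (a $ k) (gens ! k)) = 0}
       = (\<lambda>b. diff 0 *\<^sub>v b) ` carrier_vec (length (degs 1)) \<and>
     (\<forall>i. mat_kernel (diff i)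
       = (\<lambda>b. diff (Suc i) *\<^sub>v b) ` carrier_vec (length (degs (Suc (Suc i)))))"

definition minimal_graded_free_resolution ::
  "(('v::finite, 'k::field) mpoly \<Rightarrow> 'm::ab_group_add \<Rightarrow> 'm) \<Rightarrow> (int \<Rightarrow> 'm set) \<Rightarrow>
   (nat \<Rightarrow> int list) \<Rightarrow> 'm list \<Rightarrow> (nat \<Rightarrow> ('v, 'k) mpoly mat) \<Rightarrow> bool" where
  "minimal_graded_free_resolution scale D degs gens diff \<longleftrightarrow>
     graded_free_resolution scale D degs gens diff \<and>
     (\<forall>i. elements_mat (diff i) \<subseteq> irrelevant_ideal)"

text \<open>A finitely generated graded module has a minimal graded free resolution, unique up to
  isomorphism. So the numbers \<open>graded_betti scale D i j\<close> do not depend on the choice made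
  here.\<close>

definition minimal_degrees ::
  "(('v::finite, 'k::field) mpoly \<Rightarrow> 'm::ab_group_add \<Rightarrow> 'm) \<Rightarrow> (int \<Rightarrow> 'm set) \<Rightarrow> nat \<Rightarrow> int list"
  where
  "minimal_degrees scale D =
     (SOME degs. \<exists>gens diff. minimal_graded_free_resolution scale D degs gens diff)"

definition graded_betti ::
  "(('v::finite, 'k::field) mpoly \<Rightarrow> 'm::ab_group_add \<Rightarrow> 'm) \<Rightarrow> (int \<Rightarrow> 'm set) \<Rightarrow> nat \<Rightarrow> int \<Rightarrow> nat"
  where
  "graded_betti scale D i j = count_list (minimal_degrees scale D i) j"

definition regularity ::
  "(('v::finite, 'k::field) mpoly \<Rightarrow> 'm::ab_group_add \<Rightarrow> 'm) \<Rightarrow> (int \<Rightarrow> 'm set) \<Rightarrow> int" where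
  "regularity scale D = Max {j - int i | i j. graded_betti scale D i j \<noteq> 0}"

text \<open>The regularity of a homogeneous ideal, graded by its homogeneous elements. For the zero
  ideal the value is unspecified.\<close>

definition reg_ideal :: "('v::finite, 'k::field) mpoly set \<Rightarrow> int" where
  "reg_ideal I = regularity (*) (\<lambda>j. {f \<in> I. homogeneous j f})"


section \<open>Graphs\<close>

text \<open>A graph is given by its edge set; its vertex set is the whole type \<open>'v\<close>.\<close>

definition simple_graph :: "'v set set \<Rightarrow> bool" where
  "simple_graph E \<longleftrightarrow> (\<forall>e\<in>E. card e = 2)"

definition matching :: "'v set set \<Rightarrow> 'v set set \<Rightarrow> bool" where
  "matching E M \<longleftrightarrow> M \<subseteq> E \<and> disjoint M"

definition matching_number :: "'v::finite set set \<Rightarrow> nat" where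
  "matching_number E = Max {card M | M. matching E M}"

definition hamiltonian_path :: "'v set set \<Rightarrow> 'v list \<Rightarrow> bool" where
  "hamiltonian_path E p \<longleftrightarrow>
     distinct p \<and> set p = UNIV \<and> successively (\<lambda>u v. {u, v} \<in> E) p"

definition semi_hamiltonian :: "'v set set \<Rightarrow> bool" where
  "semi_hamiltonian E \<longleftrightarrow> (\<exists>p. hamiltonian_path E p)"

definition edge_ideal :: "'v set set \<Rightarrow> ('v, 'k::field) mpoly set" where
  "edge_ideal E = ideal_gen {Var u * Var v | u v. {u, v} \<in> E}"

end

theory Submission
  imports Defs "HOL-Library.Nat_Bijection"
begin

text \<open>Let \<open>n\<close> be the number of vertices. A Hamiltonian path contains a matching with \<open>n div 2\<close>
  edges, so it suffices that the \<open>s\<close>-th squarefree power has regularity at most \<open>n div 2 + s\<close>,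
  and this holds for every graph.

  The regularity is read off Koszul homology: if the Koszul homology \<open>H i\<close> of a graded module
  vanishes in the degrees above \<open>B + i\<close>, then the minimal generators have degree at most \<open>B\<close>, and
  by dimension shifting the syzygy module satisfies the same condition with \<open>B + 1\<close>. This gives
  finite generation of all syzygy modules, hence a minimal resolution, and bounds the degrees in
  every minimal resolution.

  The Koszul complex of the squarefree power splits by multidegree. It is exact in the
  non-squarefree multidegrees, and in the multidegree of a vertex set \<open>W\<close> it is the chain complex
  of the sets \<open>T\<close> such that \<open>W - T\<close> contains a matching of size \<open>s\<close>. This complex has no homology
  at sets of size \<open>i\<close> if \<open>2 * (i + s) < card W\<close>, by induction on \<open>s\<close>: the sets \<open>T\<close> for which
  \<open>W - T\<close> has matching number exactly \<open>s\<close> are sorted by the vertex set \<open>B\<close> of the matching of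
  maximal weight in \<open>W - T\<close>, and by the exchange property of matchings the sets with a given \<open>B\<close>
  correspond to the independent sets of a graph on at most \<open>card W - 2 * s\<close> vertices.\<close>

section \<open>Chain complexes of families of finite sets\<close>

text \<open>The factor 2 in \<open>2 * (i + s) < card W\<close> stems from independence complexes:
  on \<open>m\<close> vertices they have no reduced cohomology at sets of more than
  \<open>m / 2\<close> vertices, and a small \<open>T\<close> with given \<open>B\<close> leaves a
  large independent set. Passing from \<open>s\<close> to \<open>s + 1\<close> moves the layer of
  matching number exactly \<open>s\<close> to position \<open>i + 1\<close>, and
  \<open>2 * ((i + 1) + s) = 2 * (i + (s + 1))\<close> pays for this. The constant
  \<open>n div 2\<close> enters only afterwards: if \<open>card W > n div 2 + s + i\<close>, then
  \<open>card W <= n\<close> gives \<open>2 * (i + s) < 2 * card W - n <= card W\<close>.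

  Maximal weight keeps the sorting by \<open>B\<close> manageable. As for bases of a matroid,
  \<open>B\<close> is the heaviest choice as soon as no single exchange improves it, so the
  condition on \<open>T\<close> only asks certain vertices to lie in \<open>T\<close>, and at least
  one vertex of certain pairs.

  Regularity is a \<open>Max\<close> over a possibly infinite resolution picked by
  \<open>SOME\<close>. Besides the upper bound this calls for the existence of a minimal resolution,
  for a lower bound on \<open>j - i\<close>, which holds since degrees rise strictly along minimal
  syzygies, and for a nonzero ideal.\<close>

definition vidx :: "'v::finite \<Rightarrow> nat" where "vidx = (SOME f. inj f)"

lemma inj_vidx: "inj (vidx :: 'v::finite \<Rightarrow> nat)"
proof -
  obtain f :: "'v \<Rightarrow> nat" where "inj f"
    using finite_imp_inj_to_nat_seg[OF finite_UNIV[where 'a='v]] by auto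
  then show ?thesis unfolding vidx_def by (rule someI[of inj])
qed

text \<open>The sign of \<open>v\<close> wedged in front of the exterior monomial of
  \<open>T\<close>. The vertex type carries no order, so the arbitrary numbering \<open>vidx\<close>
  provides one.\<close>

definition ksign :: "'v::finite \<Rightarrow> 'v set \<Rightarrow> 'a::comm_ring_1" where
  "ksign v T = (-1) ^ card {u\<in>T. vidx u < vidx v}"

lemma ksign_sq: "ksign v T * ksign v T = 1"
  unfolding ksign_def by (simp add: power_mult_distrib[symmetric])

lemma ksign_sq_left: "ksign v T * (ksign v T * x) = x"
  by (simp add: mult.assoc[symmetric] ksign_sq)

lemma ksign_swap:
  fixes u v :: "'v::finite"
  assumes "u \<noteq> v" "u \<notin> T" "v \<notin> T"
  shows "ksign u (insert v T) * ksign v T = - (ksign v (insert u T) * ksign u T :: 'a::comm_ring_1)"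
proof -
  have *: "ksign u (insert v T) * ksign v T = - (ksign v (insert u T) * ksign u T :: 'a)"
    if "vidx u < vidx v" "u \<notin> T" for u v :: 'v
  proof -
    have "{x\<in>insert v T. vidx x < vidx u} = {x\<in>T. vidx x < vidx u}"
      using that by auto
    moreover have "{x\<in>insert u T. vidx x < vidx v} = insert u {x\<in>T. vidx x < vidx v}"
      using that by auto
    ultimately show ?thesis using that by (simp add: ksign_def)
  qed
  have "vidx u \<noteq> vidx v" using inj_vidx assms(1) by (metis injD)
  then show ?thesis using *[of u v] *[of v u] assms by (metis linorder_neqE_nat minus_minus)
qed

text \<open>The Koszul differential in coordinates: a chain is its coefficient function, and the
  value at \<open>T\<close> collects what all sets with one more element send to \<open>T\<close>.
  Weights \<open>Var\<close> give the Koszul complex, weights 1 the simplicial boundary, so both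
  share the same lemmas.\<close>

definition wbd :: "('v::finite \<Rightarrow> 'a::comm_ring_1) \<Rightarrow> ('v set \<Rightarrow> 'a) \<Rightarrow> 'v set \<Rightarrow> 'a" where
  "wbd w c T = (\<Sum>v\<in>-T. ksign v T * (w v * c (insert v T)))"

text \<open>Two elements can be added to \<open>T\<close> in two orders, which carry opposite signs
  by \<open>ksign_swap\<close>. Splitting the pairs into \<open>P\<close> and its mirror image keeps
  this valid in characteristic 2, where a sum equal to its own negative need not vanish.\<close>

lemma wbd_wbd:
  fixes w :: "'v::finite \<Rightarrow> 'a::comm_ring_1"
  shows "wbd w (wbd w c) T = 0"
proof -
  define g where "g v u = ksign v T * (w v * (ksign u (insert v T) * (w u * c (insert u (insert v T)))))" for u v
  define P where "P = {(v,u). v \<notin> T \<and> u \<notin> T \<and> vidx v < vidx u}"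
  have anti: "g v u = - g u v" if "v \<notin> T" "u \<notin> T" "u \<noteq> v" for u v
  proof -
    have "g v u = (ksign u (insert v T) * ksign v T) * (w v * w u * c (insert u (insert v T)))"
      by (simp add: g_def mult_ac)
    also have "\<dots> = - (ksign v (insert u T) * ksign u T) * (w v * w u * c (insert u (insert v T)))"
      using that by (subst ksign_swap) auto
    also have "\<dots> = - g u v" by (simp add: g_def mult_ac insert_commute)
    finally show ?thesis .
  qed
  have "wbd w (wbd w c) T = (\<Sum>v\<in>-T. \<Sum>u\<in>-insert v T. g v u)"
    by (simp add: wbd_def g_def sum_distrib_left)
  also have "\<dots> = (\<Sum>(v,u)\<in>Sigma (-T) (\<lambda>v. - insert v T). g v u)"
    by (subst sum.Sigma) auto
  also have "Sigma (-T) (\<lambda>v. - insert v T) = P \<union> prod.swap ` P"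
  proof (intro equalityI subsetI)
    fix p assume "p \<in> Sigma (-T) (\<lambda>v. - insert v T)"
    then obtain v u where p: "p = (v, u)" "v \<notin> T" "u \<notin> T" "u \<noteq> v" by auto
    then have "vidx v < vidx u \<or> vidx u < vidx v"
      using injD[OF inj_vidx, of v u] by (metis linorder_neqE_nat)
    then show "p \<in> P \<union> prod.swap ` P"
      using p by (auto simp: P_def image_iff)
  qed (auto simp: P_def)
  also have "(\<Sum>(v,u)\<in>P \<union> prod.swap ` P. g v u) = (\<Sum>(v,u)\<in>P. g v u) + (\<Sum>(v,u)\<in>prod.swap ` P. g v u)"
    by (rule sum.union_disjoint) (auto simp: P_def)
  also have "(\<Sum>(v,u)\<in>prod.swap ` P. g v u) = (\<Sum>(v,u)\<in>P. g u v)"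
    by (subst sum.reindex) (auto simp: case_prod_unfold)
  also have "\<dots> = (\<Sum>(v,u)\<in>P. - g v u)"
  proof (rule sum.cong)
    fix p assume "p \<in> P"
    then obtain v u where p: "p = (v, u)" "v \<notin> T" "u \<notin> T" "u \<noteq> v" by (auto simp: P_def)
    then show "(case p of (v, u) \<Rightarrow> g u v) = (case p of (v, u) \<Rightarrow> - g v u)"
      using anti[of u v] by simp
  qed simp
  finally show ?thesis by (simp add: case_prod_unfold sum_negf)
qed

lemma wbd_add: "wbd w (\<lambda>T. c T + d T) T = wbd w c T + wbd w d T"
  by (simp add: wbd_def distrib_left sum.distrib)

lemma wbd_diff: "wbd w (\<lambda>T. c T - d T) T = wbd w c T - wbd w d T"
  by (simp add: wbd_def right_diff_distrib sum_subtractf)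

lemma wbd_cong:
  "(\<And>v. v \<notin> T \<Longrightarrow> c (insert v T) = d (insert v T)) \<Longrightarrow> wbd w c T = wbd w d T"
  by (auto simp: wbd_def intro!: sum.cong)

abbreviation bd :: "('v::finite set \<Rightarrow> 'a::comm_ring_1) \<Rightarrow> 'v set \<Rightarrow> 'a" where
  "bd \<equiv> wbd (\<lambda>_. 1)"

definition chain :: "'v set set \<Rightarrow> nat \<Rightarrow> ('v set \<Rightarrow> 'a::zero) \<Rightarrow> bool" where
  "chain A i c \<longleftrightarrow> (\<forall>T. c T \<noteq> 0 \<longrightarrow> T \<in> A \<and> card T = i)"

text \<open>Position \<open>i\<close> counts vertices, so it is simplicial dimension
  \<open>i - 1\<close>, and the empty set counts as a cell (reduced homology). Boundaries are
  compared only at members of \<open>A\<close>; thus for a difference of two complexes this is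
  relative homology.\<close>

definition acyclic_at :: "'k::field itself \<Rightarrow> 'v::finite set set \<Rightarrow> nat \<Rightarrow> bool" where
  "acyclic_at _ A i \<longleftrightarrow> (\<forall>c :: 'v set \<Rightarrow> 'k. chain A i c \<longrightarrow> (\<forall>T\<in>A. bd c T = 0) \<longrightarrow>
     (\<exists>c'. chain A (Suc i) c' \<and> (\<forall>T\<in>A. bd c' T = c T)))"

text \<open>These families are the differences of two simplicial complexes. For them the boundary
  truncated to \<open>A\<close> still squares to zero.\<close>

definition order_convex :: "'v set set \<Rightarrow> bool" where
  "order_convex A \<longleftrightarrow> (\<forall>R\<in>A. \<forall>T\<in>A. \<forall>S. R \<subseteq> S \<longrightarrow> S \<subseteq> T \<longrightarrow> S \<in> A)"

definition rbd :: "'v::finite set set \<Rightarrow> ('v set \<Rightarrow> 'k::field) \<Rightarrow> 'v set \<Rightarrow> 'k" where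
  "rbd A c T = (if T \<in> A then bd c T else 0)"

lemma chain_rbd:
  fixes c :: "'v::finite set \<Rightarrow> 'k::field"
  assumes "chain A (Suc i) c"
  shows "chain A i (rbd A c)"
  unfolding chain_def
proof (intro allI impI)
  fix T assume "rbd A c T \<noteq> 0"
  then have T: "T \<in> A" and "bd c T \<noteq> 0" by (auto simp: rbd_def split: if_splits)
  then obtain v where "v \<notin> T" "c (insert v T) \<noteq> 0"
    unfolding wbd_def by (auto elim!: sum.not_neutral_contains_not_neutral)
  then have "card (insert v T) = Suc i" using assms unfolding chain_def by blast
  then show "T \<in> A \<and> card T = i" using \<open>v \<notin> T\<close> T by simp
qed

text \<open>If \<open>insert v T\<close> leaves \<open>A\<close> although \<open>T\<close> lies in
  it, convexity keeps every larger set outside \<open>A\<close> too. So the chain vanishes above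
  \<open>insert v T\<close>, and truncation discards only a zero value there.\<close>

lemma bd_rbd:
  assumes "order_convex A" "chain A i c" "T \<in> A"
  shows "bd (rbd A c) T = 0"
proof -
  have "bd (rbd A c) T = bd (bd c) T"
  proof (rule wbd_cong)
    fix v assume "v \<notin> T"
    show "rbd A c (insert v T) = bd c (insert v T)"
    proof (cases "insert v T \<in> A")
      case False
      have "insert u (insert v T) \<notin> A" for u
        using False assms(1,3) unfolding order_convex_def by (meson subset_insertI)
      then have "c (insert u (insert v T)) = 0" for u
        using assms(2) unfolding chain_def by blast
      then show ?thesis using False by (simp add: rbd_def wbd_def)
    qed (simp add: rbd_def)
  qed
  then show ?thesis by (simp add: wbd_wbd)
qed

lemma chain_add:
  assumes "chain A i c" "chain A i d"
  shows "chain A i (\<lambda>T. c T + d T :: 'k::field)"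
  unfolding chain_def
proof (intro allI impI)
  fix T assume "c T + d T \<noteq> 0"
  then have "c T \<noteq> 0 \<or> d T \<noteq> 0" by auto
  then show "T \<in> A \<and> card T = i" using assms unfolding chain_def by blast
qed

lemma chain_diff:
  assumes "chain A i c" "chain A i d"
  shows "chain A i (\<lambda>T. c T - d T :: 'k::field)"
  unfolding chain_def
proof (intro allI impI)
  fix T assume "c T - d T \<noteq> 0"
  then have "c T \<noteq> 0 \<or> d T \<noteq> 0" by auto
  then show "T \<in> A \<and> card T = i" using assms unfolding chain_def by blast
qed

lemma chain_mono: "chain A i c \<Longrightarrow> A \<subseteq> A' \<Longrightarrow> chain A' i c"
  unfolding chain_def by blast

section \<open>Long exact sequences, cones and filtrations\<close>

lemma upper_insert:
  assumes "\<forall>T\<in>A1. \<forall>S\<in>A2. \<not> S \<subseteq> T" "T \<in> A2"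
  shows "insert v T \<notin> A1"
  using assms subset_insertI[of T v] by blast

lemma bd_upper:
  assumes low: "\<forall>T\<in>A1. \<forall>S\<in>A2. \<not> S \<subseteq> T" and T: "T \<in> A2" and c: "chain A1 i c"
  shows "bd c T = 0"
proof -
  have "c (insert v T) = 0" for v
    using upper_insert[OF low T, of v] c by (auto simp: chain_def)
  then show ?thesis by (simp add: wbd_def)
qed

text \<open>By \<open>low\<close>, boundaries of chains on \<open>A1\<close> vanish on
  \<open>A2\<close>, so \<open>A1\<close> spans a subcomplex with quotient \<open>A2\<close>. This
  is exactness of the long homology sequence at its middle term: fill the cycle in the quotient,
  subtract the boundary of the filling, and fill the remainder in \<open>A1\<close>.\<close>

lemma acyclic_extension:
  assumes conv: "order_convex (A1 \<union> A2)"
    and low: "\<forall>T\<in>A1. \<forall>S\<in>A2. \<not> S \<subseteq> T"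
    and a1: "acyclic_at TYPE('k::field) A1 i" and a2: "acyclic_at TYPE('k) A2 i"
  shows "acyclic_at TYPE('k) (A1 \<union> A2) i"
  unfolding acyclic_at_def
proof (intro allI impI)
  fix c :: "'a set \<Rightarrow> 'k"
  assume c: "chain (A1 \<union> A2) i c" and cyc: "\<forall>T\<in>A1 \<union> A2. bd c T = 0"
  define c2 where "c2 T = (if T \<in> A2 then c T else 0)" for T
  have c2: "chain A2 i c2" using c by (auto simp: chain_def c2_def)
  have "bd c2 T = 0" if T: "T \<in> A2" for T
  proof -
    have "bd c2 T = bd c T"
    proof (rule wbd_cong)
      fix v
      show "c2 (insert v T) = c (insert v T)"
        using upper_insert[OF low T, of v] c by (auto simp: chain_def c2_def)
    qed
    then show ?thesis using cyc T by simp
  qed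
  then obtain d2 where d2: "chain A2 (Suc i) d2" and d2c: "\<forall>T\<in>A2. bd d2 T = c2 T"
    using a2 c2 unfolding acyclic_at_def by blast
  have d2': "chain (A1 \<union> A2) (Suc i) d2" using chain_mono[OF d2] by blast
  define c1 where "c1 T = c T - rbd (A1 \<union> A2) d2 T" for T
  have c1: "chain (A1 \<union> A2) i c1" unfolding c1_def
    by (intro chain_diff c chain_rbd d2')
  have z: "c1 T = 0" if "T \<in> A2" for T using that d2c by (simp add: c1_def rbd_def c2_def)
  have c1': "chain A1 i c1" using c1 z unfolding chain_def by blast
  have "bd c1 T = 0" if T: "T \<in> A1" for T
    unfolding c1_def wbd_diff using cyc bd_rbd[OF conv d2'] T by auto
  then obtain d1 where d1: "chain A1 (Suc i) d1" and d1c: "\<forall>T\<in>A1. bd d1 T = c1 T"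
    using a1 c1' unfolding acyclic_at_def by blast
  have "bd (\<lambda>T. d1 T + d2 T) T = c T" if T: "T \<in> A1 \<union> A2" for T
  proof (cases "T \<in> A1")
    case True
    then show ?thesis using d1c T by (simp add: wbd_add c1_def rbd_def)
  next
    case False
    then have "T \<in> A2" using T by simp
    then show ?thesis using bd_upper[OF low _ d1, of T] d2c by (simp add: wbd_add c2_def)
  qed
  moreover have "chain (A1 \<union> A2) (Suc i) (\<lambda>T. d1 T + d2 T)"
    using chain_mono[OF d1, of "A1 \<union> A2"] d2' by (simp add: chain_add)
  ultimately show "\<exists>c'. chain (A1 \<union> A2) (Suc i) c' \<and> (\<forall>T\<in>A1 \<union> A2. bd c' T = c T)" by blast
qed

text \<open>The segment of the long exact sequence from position \<open>Suc i\<close> of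
  \<open>A2\<close> through position \<open>i\<close> of \<open>A1\<close> to position
  \<open>i\<close> of the union. A filling in the union may stick out into \<open>A2\<close>; its
  part there is a relative cycle, and subtracting the boundary of a filling \<open>e\<close> of that
  part pushes it into \<open>A1\<close>.\<close>

lemma acyclic_lower_part:
  assumes conv: "order_convex (A1 \<union> A2)"
    and low: "\<forall>T\<in>A1. \<forall>S\<in>A2. \<not> S \<subseteq> T"
    and a: "acyclic_at TYPE('k::field) (A1 \<union> A2) i" and a2: "acyclic_at TYPE('k) A2 (Suc i)"
  shows "acyclic_at TYPE('k) A1 i"
  unfolding acyclic_at_def
proof (intro allI impI)
  fix c :: "'a set \<Rightarrow> 'k"
  assume c: "chain A1 i c" and cyc: "\<forall>T\<in>A1. bd c T = 0"
  have "\<forall>T\<in>A1 \<union> A2. bd c T = 0" using cyc bd_upper[OF low _ c] by auto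
  then obtain d where d: "chain (A1 \<union> A2) (Suc i) d" and dc: "\<forall>T\<in>A1 \<union> A2. bd d T = c T"
    using a chain_mono[OF c, of "A1 \<union> A2"] unfolding acyclic_at_def by blast
  define d2 where "d2 T = (if T \<in> A2 then d T else 0)" for T
  have d2: "chain A2 (Suc i) d2" using d by (auto simp: chain_def d2_def)
  have "bd d2 T = 0" if T: "T \<in> A2" for T
  proof -
    have "bd d2 T = bd d T"
    proof (rule wbd_cong)
      fix v
      show "d2 (insert v T) = d (insert v T)"
        using upper_insert[OF low T, of v] d by (auto simp: chain_def d2_def)
    qed
    also have "\<dots> = c T" using dc T by simp
    also have "\<dots> = 0" using c T low unfolding chain_def by blast
    finally show ?thesis .
  qed
  then obtain e where e: "chain A2 (Suc (Suc i)) e" and ed: "\<forall>T\<in>A2. bd e T = d2 T"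
    using a2 d2 unfolding acyclic_at_def by blast
  have e': "chain (A1 \<union> A2) (Suc (Suc i)) e" using chain_mono[OF e] by blast
  define f where "f T = d T - rbd (A1 \<union> A2) e T" for T
  have f: "chain (A1 \<union> A2) (Suc i) f" unfolding f_def
    by (intro chain_diff d chain_rbd e')
  have "f T = 0" if "T \<in> A2" for T using that ed by (simp add: f_def rbd_def d2_def)
  then have "chain A1 (Suc i) f" using f unfolding chain_def by blast
  moreover have "bd f T = c T" if "T \<in> A1" for T
    unfolding f_def wbd_diff using dc bd_rbd[OF conv e'] that by auto
  ultimately show "\<exists>c'. chain A1 (Suc i) c' \<and> (\<forall>T\<in>A1. bd c' T = c T)" by blast
qed

text \<open>The members of \<open>A\<close> come in pairs \<open>T\<close>,
  \<open>insert x T\<close>, and adding \<open>x\<close> with its sign is a contracting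
  homotopy.\<close>

lemma acyclic_cone:
  assumes cone: "\<And>T. x \<notin> T \<Longrightarrow> insert x T \<in> A \<longleftrightarrow> T \<in> A"
  shows "acyclic_at TYPE('k::field) A i"
  unfolding acyclic_at_def
proof (intro allI impI)
  fix c :: "'a set \<Rightarrow> 'k"
  assume c: "chain A i c" and cyc: "\<forall>T\<in>A. bd c T = 0"
  define d where "d T = (if x \<in> T then ksign x (T - {x}) * c (T - {x}) else 0)" for T
  have "chain A (Suc i) d"
    unfolding chain_def
  proof (intro allI impI)
    fix T assume "d T \<noteq> 0"
    then have x: "x \<in> T" and "c (T - {x}) \<noteq> 0" by (auto simp: d_def split: if_splits)
    then have *: "T - {x} \<in> A" "card (T - {x}) = i" using c unfolding chain_def by blast+
    then show "T \<in> A \<and> card T = Suc i"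
      using x cone[of "T - {x}"] card_Suc_Diff1[of T x] by (simp add: insert_absorb)
  qed
  moreover have "bd d S = c S" if S: "S \<in> A" for S
  proof (cases "x \<in> S")
    case False
    have "bd d S = (\<Sum>v\<in>-S. if v = x then c S else 0)"
      unfolding wbd_def using False
      by (intro sum.cong) (auto simp: d_def ksign_sq_left)
    then show ?thesis using False by simp
  next
    case True
    define R where "R = S - {x}"
    have R: "x \<notin> R" "S = insert x R" using True by (auto simp: R_def)
    have RA: "R \<in> A" using cone[OF R(1)] R S by simp
    \<comment> \<open>The cycle condition at \<open>R\<close>, the set without the apex, trades the
      sum over all \<open>v\<close> outside \<open>S\<close> for the single term at
      \<open>x\<close>.\<close>
    have "0 = bd c R" using cyc RA by simp
    also have "\<dots> = (\<Sum>v\<in>insert x (-S). ksign v R * c (insert v R))"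
      unfolding wbd_def by (rule sum.cong) (use R in auto)
    also have "\<dots> = ksign x R * c S + (\<Sum>v\<in>-S. ksign v R * c (insert v R))"
      using R by simp
    finally have *: "(\<Sum>v\<in>-S. ksign v R * c (insert v R)) = - (ksign x R * c S)"
      by (metis add.commute add_eq_0_iff)
    have "bd d S = (\<Sum>v\<in>-S. - ksign x R * (ksign v R * c (insert v R)))"
      unfolding wbd_def
    proof (rule sum.cong)
      fix v assume "v \<in> - S"
      then have v: "v \<notin> R" "v \<noteq> x" using R by auto
      have ins: "insert v S - {x} = insert v R" using R v by auto
      have "ksign v S * (1 * d (insert v S)) = (ksign v (insert x R) * ksign x (insert v R)) * c (insert v R)"
        using ins True R(2) by (simp add: d_def)
      also have "ksign v (insert x R) * ksign x (insert v R)
         = (ksign v (insert x R) * ksign x R) * (ksign x R * ksign x (insert v R) :: 'k)"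
        by (simp add: mult.assoc ksign_sq_left)
      also have "ksign v (insert x R) * ksign x R = - (ksign x (insert v R) * ksign v R :: 'k)"
        using R v by (intro ksign_swap) auto
      also have "- (ksign x (insert v R) * ksign v R) * (ksign x R * ksign x (insert v R))
         = - (ksign x (insert v R) * (ksign x (insert v R) * (ksign v R * ksign x R)) :: 'k)"
        by (simp add: mult_ac)
      also have "\<dots> = - (ksign v R * ksign x R)" by (simp add: ksign_sq_left)
      finally show "ksign v S * (1 * d (insert v S)) = - ksign x R * (ksign v R * c (insert v R))"
        by (simp add: mult_ac)
    qed simp
    also have "\<dots> = - ksign x R * - (ksign x R * c S)"
      by (simp only: sum_distrib_left[symmetric] *)
    finally show ?thesis by (simp add: ksign_sq_left)
  qed
  ultimately show "\<exists>c'. chain A (Suc i) c' \<and> (\<forall>T\<in>A. bd c' T = c T)" by blast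
qed

lemma acyclic_no_faces:
  assumes "\<forall>T\<in>A. card T \<noteq> i"
  shows "acyclic_at TYPE('k::field) A i"
  unfolding acyclic_at_def
proof (intro allI impI)
  fix c :: "'a set \<Rightarrow> 'k"
  assume "chain A i c"
  then have "\<forall>T\<in>A. c T = 0" using assms by (auto simp: chain_def)
  then have "chain A (Suc i) (\<lambda>_. 0 :: 'k) \<and> (\<forall>T\<in>A. bd (\<lambda>_. 0) T = c T)"
    by (simp add: chain_def wbd_def)
  then show "\<exists>c'. chain A (Suc i) c' \<and> (\<forall>T\<in>A. bd c' T = c T)" by blast
qed

text \<open>Since \<open>\<rho>\<close> does not increase along inclusions, the sets with value
  \<open>k\<close> span a subcomplex of those with value at most \<open>k\<close>. The levels are
  glued one at a time, up to the largest value that occurs.\<close>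

lemma acyclic_levels:
  fixes A :: "'v::finite set set" and \<rho> :: "'v set \<Rightarrow> nat"
  assumes conv: "order_convex A"
    and mono: "\<And>S T. T \<in> A \<Longrightarrow> S \<in> A \<Longrightarrow> S \<subseteq> T \<Longrightarrow> \<rho> T \<le> \<rho> S"
    and lev: "\<And>k. acyclic_at TYPE('k::field) {T\<in>A. \<rho> T = k} i"
  shows "acyclic_at TYPE('k) A i"
proof -
  have cv: "order_convex {T\<in>A. \<rho> T < k}" for k
    unfolding order_convex_def
  proof (intro ballI allI impI)
    fix R T S assume *: "R \<in> {T\<in>A. \<rho> T < k}" "T \<in> {T\<in>A. \<rho> T < k}" "R \<subseteq> S" "S \<subseteq> T"
    then have "S \<in> A" using conv unfolding order_convex_def by blast
    with * mono[of S R] show "S \<in> {T\<in>A. \<rho> T < k}" by auto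
  qed
  have "acyclic_at TYPE('k) {T\<in>A. \<rho> T < k} i" for k
  proof (induction k)
    case 0
    then show ?case by (intro acyclic_no_faces) auto
  next
    case (Suc k)
    have eq: "{T\<in>A. \<rho> T < Suc k} = {T\<in>A. \<rho> T = k} \<union> {T\<in>A. \<rho> T < k}" by auto
    show ?case unfolding eq
    proof (rule acyclic_extension[OF _ _ lev Suc])
      show "order_convex ({T\<in>A. \<rho> T = k} \<union> {T\<in>A. \<rho> T < k})" using cv[of "Suc k"] eq by simp
      show "\<forall>T\<in>{T\<in>A. \<rho> T = k}. \<forall>S\<in>{T\<in>A. \<rho> T < k}. \<not> S \<subseteq> T"
        using mono by (metis (mono_tags, lifting) leD mem_Collect_eq)
    qed
  qed
  from this[of "Suc (Max (range \<rho>))"] show ?thesis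
    by (simp add: less_Suc_eq_le)
qed

section \<open>Matchable sets\<close>

text \<open>Only the vertex set of a matching matters below, so the matching itself is forgotten:
  \<open>B\<close> is matchable if the subgraph induced on it has a perfect matching.\<close>

inductive matchable :: "'v set set \<Rightarrow> 'v set \<Rightarrow> bool" for E where
  empty: "matchable E {}"
| add_edge: "matchable E B \<Longrightarrow> {u, v} \<in> E \<Longrightarrow> u \<noteq> v \<Longrightarrow> u \<notin> B \<Longrightarrow> v \<notin> B \<Longrightarrow>
    matchable E (insert u (insert v B))"

lemma matchable_finite: "matchable E B \<Longrightarrow> finite B"
  by (induction rule: matchable.induct) auto

text \<open>The order in which edges were added is immaterial, so the edge at a prescribed vertex
  may be taken as the last one.\<close>

lemma matchable_partner:
  assumes "matchable E B" "w \<in> B"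
  obtains w' where "w' \<in> B" "w' \<noteq> w" "{w, w'} \<in> E" "matchable E (B - {w, w'})"
proof -
  have "\<exists>w'. w' \<in> B \<and> w' \<noteq> w \<and> {w, w'} \<in> E \<and> matchable E (B - {w, w'})"
    using assms
  proof (induction rule: matchable.induct)
    case (add_edge B u v)
    consider "w = u" | "w = v" | "w \<in> B" "w \<noteq> u" "w \<noteq> v" using add_edge.prems by auto
    then show ?case
    proof cases
      case 1
      then have "insert u (insert v B) - {w, v} = B" using add_edge by auto
      then show ?thesis using 1 add_edge by (intro exI[of _ v]) auto
    next
      case 2
      then have "insert u (insert v B) - {w, u} = B" using add_edge by auto
      then show ?thesis using 2 add_edge by (intro exI[of _ u]) (auto simp: insert_commute)
    next
      case 3
      then obtain w' where w': "w' \<in> B" "w' \<noteq> w" "{w, w'} \<in> E" "matchable E (B - {w, w'})"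
        using add_edge.IH by blast
      then have "insert u (insert v B) - {w, w'} = insert u (insert v (B - {w, w'}))"
        using 3 add_edge by auto
      then show ?thesis using w' add_edge by (intro exI[of _ w']) (auto intro!: matchable.add_edge)
    qed
  qed auto
  then show thesis using that by blast
qed

lemma matchable_subset:
  assumes "matchable E B" "2 * s \<le> card B"
  shows "\<exists>B'\<subseteq>B. matchable E B' \<and> card B' = 2 * s"
  using assms
proof (induction rule: matchable.induct)
  case empty
  then show ?case by (intro exI[of _ "{}"]) (auto intro: matchable.empty)
next
  case (add_edge B u v)
  have c: "card (insert u (insert v B)) = card B + 2"
    using add_edge matchable_finite[of E B] by simp
  show ?case
  proof (cases "2 * s \<le> card B")
    case True
    then show ?thesis using add_edge.IH by blast
  next
    case False
    have "even (card B)" using add_edge.hyps(1)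
    proof (induction rule: matchable.induct)
      case (add_edge B u v)
      then show ?case using matchable_finite[of E B] by simp
    qed simp
    then have "2 * s = card B + 2" using False c add_edge.prems by presburger
    then show ?thesis using c matchable.add_edge[OF add_edge.hyps] by auto
  qed
qed

text \<open>Follow the path of the symmetric difference of a perfect matching of \<open>A\<close> and one of
  \<open>B\<close> that starts at \<open>w\<close>. It ends in \<open>B - A\<close> or in \<open>A - B\<close>.\<close>

lemma matchable_exchange:
  assumes "matchable E A" "matchable E B" "w \<in> B" "w \<notin> A"
  shows "(\<exists>v\<in>B - A. v \<noteq> w \<and> matchable E (insert w (insert v A))) \<or>
    (\<exists>v\<in>A - B. matchable E (insert w (A - {v})))"
  using assms
proof (induction "card B" arbitrary: A B w rule: less_induct)
  case less
  obtain x where x: "x \<in> B" "x \<noteq> w" "{w, x} \<in> E" "matchable E (B - {w, x})"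
    using matchable_partner[OF less.prems(2,3)] by blast
  show ?case
  proof (cases "x \<in> A")
    case False
    then have "matchable E (insert w (insert x A))" using x less.prems by (intro matchable.add_edge) auto
    then show ?thesis using x False by blast
  next
    case True
    obtain y where y: "y \<in> A" "y \<noteq> x" "{x, y} \<in> E" "matchable E (A - {x, y})"
      using matchable_partner[OF less.prems(1) True] by blast
    have yw: "y \<noteq> w" using y less.prems by auto
    show ?thesis
    proof (cases "y \<in> B")
      case False
      have "matchable E (insert w (insert x (A - {x, y})))"
        using x y less.prems by (intro matchable.add_edge) auto
      moreover have "insert x (A - {x, y}) = A - {y}" using True y by auto
      ultimately show ?thesis using False y by auto
    next
      case yB: True
      \<comment> \<open>The path has run through \<open>w\<close>, \<open>x\<close>,
        \<open>y\<close> and goes on from \<open>y\<close>; the edge at \<open>w\<close> is removed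
        from the matching of \<open>B\<close> and the edge at \<open>y\<close> from that of
        \<open>A\<close>.\<close>
      have "card (B - {w, x}) < card B"
        using x less.prems matchable_finite[of E B] by (intro psubset_card_mono) auto
      then have "(\<exists>v\<in>(B - {w, x}) - (A - {x, y}). v \<noteq> y \<and> matchable E (insert y (insert v (A - {x, y})))) \<or>
        (\<exists>v\<in>(A - {x, y}) - (B - {w, x}). matchable E (insert y (A - {x, y} - {v})))"
        using x y yB yw by (intro less.hyps) auto
      then show ?thesis
      proof (elim disjE bexE conjE)
        fix v assume v: "v \<in> (B - {w, x}) - (A - {x, y})" "v \<noteq> y"
          "matchable E (insert y (insert v (A - {x, y})))"
        have "matchable E (insert w (insert x (insert y (insert v (A - {x, y})))))"
          by (rule matchable.add_edge[OF v(3) x(3)]) (use v x y yw less.prems in auto)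
        moreover have "insert x (insert y (insert v (A - {x, y}))) = insert v A" using True y by auto
        ultimately show ?thesis using v by auto
      next
        fix v assume v: "v \<in> (A - {x, y}) - (B - {w, x})"
          "matchable E (insert y (A - {x, y} - {v}))"
        have "matchable E (insert w (insert x (insert y (A - {x, y} - {v}))))"
          by (rule matchable.add_edge[OF v(2) x(3)]) (use v x y yw less.prems in auto)
        moreover have "insert x (insert y (A - {x, y} - {v})) = A - {v}" using True y v by auto
        moreover have "v \<in> A - B" using v less.prems by auto
        ultimately show ?thesis by auto
      qed
    qed
  qed
qed

section \<open>Maximum matchings inside a vertex set\<close>

lemma card_exchange:
  assumes "finite C" "w \<notin> C" "v \<in> C"
  shows "card (insert w (C - {v})) = card C"
  using assms card_Suc_Diff1[of C v] by (simp del: card_Diff_singleton)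

definition has_match :: "'v set set \<Rightarrow> nat \<Rightarrow> 'v set \<Rightarrow> bool" where
  "has_match E s U \<longleftrightarrow> (\<exists>B\<subseteq>U. matchable E B \<and> card B = 2 * s)"

lemma has_match_Suc:
  assumes "has_match E (Suc s) U"
  shows "has_match E s U"
proof -
  obtain B where B: "B \<subseteq> U" "matchable E B" "card B = 2 * Suc s"
    using assms unfolding has_match_def by blast
  then obtain B' where "B' \<subseteq> B" "matchable E B'" "card B' = 2 * s"
    using matchable_subset[of E B s] by auto
  then show ?thesis using B unfolding has_match_def by blast
qed

lemma has_match_mono: "has_match E s U \<Longrightarrow> U \<subseteq> U' \<Longrightarrow> has_match E s U'"
  unfolding has_match_def by blast

text \<open>Take a larger matchable set \<open>C\<close> in \<open>U\<close> missing as few elements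
  of \<open>B\<close> as possible. Either outcome of an exchange from \<open>C\<close> towards
  \<open>B\<close> would bring in one more element of \<open>B\<close>, so
  \<open>B \<subseteq> C\<close>. An exchange from \<open>B\<close> towards \<open>C\<close> can
  then remove nothing and has to add two vertices.\<close>

lemma matchable_augment:
  fixes B U :: "'v::finite set"
  assumes B: "matchable E B" "B \<subseteq> U" "card B = 2 * s" and U: "has_match E (Suc s) U"
  obtains u v where "u \<in> U - B" "v \<in> U - B" "u \<noteq> v" "matchable E (insert u (insert v B))"
proof -
  define P where "P C \<longleftrightarrow> C \<subseteq> U \<and> matchable E C \<and> card B < card C" for C
  obtain C0 where "C0 \<subseteq> U" "matchable E C0" "card C0 = 2 * Suc s"
    using U unfolding has_match_def by blast
  then have "P C0" using B unfolding P_def by simp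
  then obtain C where C: "P C" and min: "\<And>C'. P C' \<Longrightarrow> card (B - C) \<le> card (B - C')"
    using ex_has_least_nat[of P C0 "\<lambda>C. card (B - C)"] by blast
  have "B \<subseteq> C"
  proof (rule ccontr)
    assume "\<not> B \<subseteq> C"
    then obtain w where w: "w \<in> B" "w \<notin> C" by blast
    have smaller: "card (B - C') < card (B - C)" if "w \<in> C'" "B - C' \<subseteq> B - C" for C'
      using that w by (intro psubset_card_mono) auto
    from matchable_exchange[of E C B w] w C B(1)
    consider v where "v \<in> B - C" "v \<noteq> w" "matchable E (insert w (insert v C))"
      | v where "v \<in> C - B" "matchable E (insert w (C - {v}))"
      unfolding P_def by blast
    then show False
    proof cases
      case 1
      then have "P (insert w (insert v C))" using C w B unfolding P_def by auto
      from min[OF this] smaller[of "insert w (insert v C)"] show False by auto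
    next
      case 2
      then have "card (insert w (C - {v})) = card C" using w by (intro card_exchange) auto
      then have "P (insert w (C - {v}))" using 2 C w B unfolding P_def by auto
      from min[OF this] smaller[of "insert w (C - {v})"] 2 show False by auto
    qed
  qed
  moreover have "B \<noteq> C" using C unfolding P_def by auto
  ultimately obtain w where w: "w \<in> C" "w \<notin> B" by blast
  from matchable_exchange[of E B C w] w C B(1) \<open>B \<subseteq> C\<close>
  obtain v where "v \<in> C - B" "v \<noteq> w" "matchable E (insert w (insert v B))"
    unfolding P_def by blast
  then show thesis using that[of w v] w C unfolding P_def by auto
qed

text \<open>Distinct powers of two make the weight injective on sets, so the heaviest set of a
  family is unique and is identified by its weight alone.\<close>

definition weight :: "'v::finite set \<Rightarrow> nat" where
  "weight B = (\<Sum>x\<in>B. 2 ^ vidx x)"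

lemma weight_inject: "weight B = weight B' \<longleftrightarrow> B = B'"
proof -
  have w: "weight B = set_encode (vidx ` B)" for B :: "'a set"
    unfolding weight_def set_encode_def using inj_vidx by (subst sum.reindex) (auto intro: inj_on_subset)
  show ?thesis unfolding w
    by (simp add: set_encode_eq inj_image_eq_iff[OF inj_vidx])
qed

lemma weight_exchange:
  assumes "w \<notin> B" "b \<in> B" "vidx b < vidx w"
  shows "weight B < weight (insert w (B - {b}))"
  using assms by (simp add: weight_def sum.remove[of B b])

lemma finite_argmax:
  fixes f :: "'a \<Rightarrow> nat"
  assumes "finite S" "S \<noteq> {}"
  shows "\<exists>x\<in>S. \<forall>y\<in>S. f y \<le> f x"
proof -
  have "Max (f ` S) \<in> f ` S" using assms by simp
  then obtain x where "x \<in> S" "f x = Max (f ` S)" by force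
  then show ?thesis using assms by (metis Max_ge finite_imageI imageI)
qed

text \<open>Local optimality implies global optimality, as in the greedy algorithm on a matroid.
  Compare \<open>B\<close> with the heaviest candidate \<open>C\<close> at the largest vertex
  \<open>w\<close> of their symmetric difference: whichever of them lacks \<open>w\<close> gains
  weight by an exchange that brings \<open>w\<close> in. The other outcome of the exchange property,
  two added vertices, would produce a matching of size \<open>Suc s\<close> in
  \<open>U\<close>.\<close>

lemma max_weight_matchable:
  fixes B U :: "'v::finite set"
  assumes B: "matchable E B" "B \<subseteq> U" "card B = 2 * s" and U: "\<not> has_match E (Suc s) U"
    and loc: "\<And>w b. w \<in> U - B \<Longrightarrow> b \<in> B \<Longrightarrow> vidx b < vidx w \<Longrightarrow> \<not> matchable E (insert w (B - {b}))"
    and B': "matchable E B'" "B' \<subseteq> U" "card B' = 2 * s"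
  shows "weight B' \<le> weight B"
proof -
  define P where "P C \<longleftrightarrow> matchable E C \<and> C \<subseteq> U \<and> card C = 2 * s" for C
  have fin: "finite {C. P C}" "{C. P C} \<noteq> {}" using B unfolding P_def by auto
  obtain C where C: "P C" and max: "\<And>C'. P C' \<Longrightarrow> weight C' \<le> weight C"
    using finite_argmax[OF fin, of weight] by auto
  have no_aug: False if "P D" "matchable E (insert w (insert v D))" "w \<in> U - D" "v \<in> U - D" "v \<noteq> w" for D v w
  proof -
    have "insert w (insert v D) \<subseteq> U" "card (insert w (insert v D)) = 2 * Suc s"
      using that unfolding P_def by auto
    then show False using that(2) U unfolding has_match_def by blast
  qed
  have PB: "P B" using B by (simp add: P_def)
  have "C = B"
  proof (rule ccontr)
    assume "C \<noteq> B"
    then have D: "finite (sym_diff B C)" "sym_diff B C \<noteq> {}" by auto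
    obtain w where w: "w \<in> sym_diff B C" and wmax: "\<And>v. v \<in> sym_diff B C \<Longrightarrow> vidx v \<le> vidx w"
      using finite_argmax[OF D, of vidx] by metis
    have less: "vidx v < vidx w" if "v \<in> sym_diff B C" "v \<noteq> w" for v
      using wmax[OF that(1)] that(2) injD[OF inj_vidx, of v w] by fastforce
    show False
    proof (cases "w \<in> B")
      case False
      with w have wC: "w \<in> C" by auto
      from matchable_exchange[of E B C w] wC False C PB
      consider v where "v \<in> C - B" "v \<noteq> w" "matchable E (insert w (insert v B))"
        | v where "v \<in> B - C" "matchable E (insert w (B - {v}))"
        unfolding P_def by blast
      then show False
      proof cases
        case 1
        then show False using no_aug[OF PB, of w v] wC False C unfolding P_def by auto
      next
        case 2
        then show False using loc[of w v] less[of v] wC False C unfolding P_def by auto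
      qed
    next
      case True
      with w have wC: "w \<notin> C" by auto
      from matchable_exchange[of E C B w] wC True C PB
      consider v where "v \<in> B - C" "v \<noteq> w" "matchable E (insert w (insert v C))"
        | v where "v \<in> C - B" "matchable E (insert w (C - {v}))"
        unfolding P_def by blast
      then show False
      proof cases
        case 1
        then show False using no_aug[OF C, of w v] wC True B unfolding P_def by auto
      next
        case 2
        have "card (insert w (C - {v})) = card C" using 2 wC by (intro card_exchange) auto
        then have "P (insert w (C - {v}))" using 2 C True B unfolding P_def by auto
        from max[OF this] weight_exchange[of w C v] less[of v] 2 wC True show False by auto
      qed
    qed
  qed
  then show ?thesis using max[of B'] B' by (auto simp: P_def)
qed

section \<open>Independent sets of a graph\<close>

definition indep :: "('v \<Rightarrow> 'v \<Rightarrow> bool) \<Rightarrow> 'v set \<Rightarrow> bool" where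
  "indep H Y \<longleftrightarrow> (\<forall>u\<in>Y. \<forall>v\<in>Y. u \<noteq> v \<longrightarrow> \<not> H u v)"

lemma indep_subset: "indep H Y \<Longrightarrow> Z \<subseteq> Y \<Longrightarrow> indep H Z"
  unfolding indep_def by blast

lemma indep_insert: "indep H Y \<Longrightarrow> \<forall>v\<in>Y. \<not> H x v \<and> \<not> H v x \<Longrightarrow> indep H (insert x Y)"
  unfolding indep_def by blast

text \<open>\<open>F\<close> is forced into \<open>T\<close>, and the independent set is the
  complement of \<open>T\<close> in \<open>X\<close>. Removing a vertex from \<open>T\<close>
  enlarges the independent set, so the boundary of this family is the coboundary of the independence
  complex on \<open>X\<close>.\<close>

definition indep_family :: "('v \<Rightarrow> 'v \<Rightarrow> bool) \<Rightarrow> 'v set \<Rightarrow> 'v set \<Rightarrow> 'v set set" where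
  "indep_family H F X = {T. F \<subseteq> T \<and> T \<subseteq> F \<union> X \<and> indep H (X - T)}"

lemma order_convex_indep_family: "order_convex (indep_family H F X)"
  unfolding order_convex_def
proof (intro ballI allI impI)
  fix R T S assume *: "R \<in> indep_family H F X" "T \<in> indep_family H F X" "R \<subseteq> S" "S \<subseteq> T"
  then have "F \<subseteq> S" "S \<subseteq> F \<union> X" by (auto simp: indep_family_def)
  moreover have "indep H (X - S)"
    by (rule indep_subset[of H "X - R"]) (use * in \<open>auto simp: indep_family_def\<close>)
  ultimately show "S \<in> indep_family H F X" by (simp add: indep_family_def)
qed

text \<open>Sort by whether \<open>x\<close> lies in the independent set. If it does, its neighbours
  \<open>N\<close> become forced and \<open>x\<close> disappears; if not, \<open>x\<close> becomes
  forced. A vertex moved from \<open>X\<close> to \<open>F\<close> raises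
  \<open>2 * card F + card X\<close> by one, and the loss of \<open>x\<close> in the former case is
  made up by \<open>card N > 0\<close>. Without neighbours, \<open>x\<close> is the apex of a
  cone.\<close>

lemma acyclic_indep_family:
  fixes F X :: "'v::finite set"
  assumes "F \<inter> X = {}" "2 * i < 2 * card F + card X" and sym: "\<And>u v. H u v \<Longrightarrow> H v u"
  shows "acyclic_at TYPE('k::field) (indep_family H F X) i"
  using assms(1,2)
proof (induction "card X" arbitrary: F X rule: less_induct)
  case less
  show ?case
  proof (cases "X = {}")
    case True
    then show ?thesis using less.prems by (intro acyclic_no_faces) (auto simp: indep_family_def)
  next
    case False
    then obtain x where x: "x \<in> X" by blast
    define N where "N = {y\<in>X. y \<noteq> x \<and> H x y}"
    have cX: "card X = Suc (card (X - {x}))" using card_Suc_Diff1[of X x] x by (simp del: card_Diff_singleton)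
    have xF: "x \<notin> F" using less.prems x by auto
    show ?thesis
    proof (cases "N = {}")
      case True
      have "insert x T \<in> indep_family H F X \<longleftrightarrow> T \<in> indep_family H F X" if "x \<notin> T" for T
      proof -
        have "X - T = insert x (X - insert x T)" using x that by auto
        moreover have "\<not> H x v \<and> \<not> H v x" if "v \<in> X - insert x T" for v
          using True sym that unfolding N_def by blast
        ultimately have "indep H (X - insert x T) \<longleftrightarrow> indep H (X - T)"
          using indep_insert[of H "X - insert x T" x] indep_subset[of H "X - T" "X - insert x T"] by auto
        then show ?thesis using x xF by (auto simp: indep_family_def)
      qed
      then show ?thesis by (rule acyclic_cone)
    next
      case N: False
      let ?A1 = "indep_family H (F \<union> N) (X - {x} - N)"
      let ?A2 = "indep_family H (insert x F) (X - {x})"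
      have eq: "indep_family H F X = ?A1 \<union> ?A2"
      proof (intro equalityI subsetI)
        fix T assume T: "T \<in> indep_family H F X"
        show "T \<in> ?A1 \<union> ?A2"
        proof (cases "x \<in> T")
          case True
          then have "X - {x} - T = X - T" by auto
          then have "T \<in> ?A2" using T True by (auto simp: indep_family_def)
          then show ?thesis ..
        next
          case False
          have NT: "N \<subseteq> T"
          proof
            fix y assume "y \<in> N"
            then have y: "y \<in> X" "x \<noteq> y" "H x y" by (auto simp: N_def)
            have "indep H (X - T)" using T by (simp add: indep_family_def)
            then show "y \<in> T" using x y False by (auto simp: indep_def)
          qed
          have "indep H (X - {x} - N - T)"
            by (rule indep_subset[of H "X - T"]) (use T in \<open>auto simp: indep_family_def\<close>)
          then have "T \<in> ?A1" using T False NT by (auto simp: indep_family_def)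
          then show ?thesis ..
        qed
      next
        fix T assume "T \<in> ?A1 \<union> ?A2"
        then show "T \<in> indep_family H F X"
        proof
          assume T: "T \<in> ?A2"
          then have T': "insert x F \<subseteq> T" "T \<subseteq> insert x F \<union> (X - {x})" "indep H (X - {x} - T)"
            by (simp_all only: indep_family_def mem_Collect_eq)
          have "X - {x} - T = X - T" using T'(1) by blast
          then have "indep H (X - T)" using T'(3) by simp
          moreover have "F \<subseteq> T" "T \<subseteq> F \<union> X" using T' x by blast+
          ultimately show ?thesis by (simp add: indep_family_def)
        next
          assume T: "T \<in> ?A1"
          have "\<forall>v\<in>X - {x} - N - T. \<not> H x v \<and> \<not> H v x"
            using sym unfolding N_def by blast
          then have "indep H (insert x (X - {x} - N - T))"
            using T by (intro indep_insert) (auto simp: indep_family_def)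
          moreover have "X - T \<subseteq> insert x (X - {x} - N - T)" using T by (auto simp: indep_family_def)
          ultimately have "indep H (X - T)" by (rule indep_subset)
          moreover have "F \<subseteq> T" "T \<subseteq> F \<union> X" using T by (auto simp: indep_family_def N_def)
          ultimately show ?thesis by (simp add: indep_family_def)
        qed
      qed
      have NX: "N \<subseteq> X - {x}" by (auto simp: N_def)
      have cN: "card (X - {x} - N) + card N = card (X - {x})" "card N > 0"
        using NX N card_mono[of "X - {x}" N] by (simp_all add: card_Diff_subset card_gt_0_iff)
      have cFN: "card (F \<union> N) = card F + card N"
        using NX less.prems by (intro card_Un_disjoint) auto
      show ?thesis unfolding eq
      proof (rule acyclic_extension)
        show "order_convex (?A1 \<union> ?A2)" using order_convex_indep_family eq by metis
        have "x \<notin> T" if "T \<in> ?A1" for T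
          using that xF NX by (auto simp: indep_family_def)
        moreover have "x \<in> S" if "S \<in> ?A2" for S
          using that by (auto simp: indep_family_def)
        ultimately show "\<forall>T\<in>?A1. \<forall>S\<in>?A2. \<not> S \<subseteq> T" by blast
        show "acyclic_at TYPE('k) ?A1 i"
        proof (rule less.hyps)
          show "card (X - {x} - N) < card X" "2 * i < 2 * card (F \<union> N) + card (X - {x} - N)"
            using cX cN cFN less.prems by linarith+
          show "(F \<union> N) \<inter> (X - {x} - N) = {}" using less.prems by auto
        qed
        show "acyclic_at TYPE('k) ?A2 i"
          using cX less.prems xF by (intro less.hyps) auto
      qed
    qed
  qed
qed

section \<open>Complexes of sets whose complement contains a matching\<close>

definition match_family :: "'v set set \<Rightarrow> nat \<Rightarrow> 'v set \<Rightarrow> 'v set set" where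
  "match_family E s W = {T. T \<subseteq> W \<and> has_match E s (W - T)}"

lemma match_family_lower:
  assumes "T \<in> match_family E s W" "S \<subseteq> T"
  shows "S \<in> match_family E s W"
  using assms has_match_mono[of E s "W - T" "W - S"] by (auto simp: match_family_def)

lemma order_convex_match_family: "order_convex (match_family E s W)"
  unfolding order_convex_def using match_family_lower by blast

text \<open>\<open>B\<close> is the heaviest choice in \<open>W - T\<close> when \<open>T\<close>
  avoids \<open>B\<close> and contains the set \<open>F\<close> of vertices that could replace a
  smaller vertex of \<open>B\<close>. The matching number of \<open>W - T\<close> stays at
  \<open>s\<close> when no two vertices left outside \<open>T\<close> and \<open>B\<close> can be
  added to \<open>B\<close> together, which is independence for \<open>H\<close>.\<close>

lemma acyclic_match_level:
  fixes W B :: "'v::finite set" and E :: "'v set set" and s :: nat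
  defines "\<rho> \<equiv> \<lambda>T. Max (weight ` {B. B \<subseteq> W - T \<and> matchable E B \<and> card B = 2 * s})"
  assumes i: "2 * i + 2 * s < card W" and B: "B \<subseteq> W" "matchable E B" "card B = 2 * s"
  shows "acyclic_at TYPE('k::field)
    {T \<in> match_family E s W - match_family E (Suc s) W. \<rho> T = weight B} i"
proof -
  define F where "F = {w \<in> W - B. \<exists>b\<in>B. vidx b < vidx w \<and> matchable E (insert w (B - {b}))}"
  define X where "X = W - B - F"
  define H where "H u v \<longleftrightarrow> matchable E (insert u (insert v B))" for u v
  have bases: "finite (weight ` {B. B \<subseteq> W - T \<and> matchable E B \<and> card B = 2 * s})" for T
    by simp
  have "{T \<in> match_family E s W - match_family E (Suc s) W. \<rho> T = weight B} = indep_family H F X"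
  proof (intro equalityI subsetI)
    fix T assume "T \<in> {T \<in> match_family E s W - match_family E (Suc s) W. \<rho> T = weight B}"
    then have T: "T \<subseteq> W" "has_match E s (W - T)" "\<not> has_match E (Suc s) (W - T)" and r: "\<rho> T = weight B"
      by (auto simp: match_family_def)
    have "\<rho> T \<in> weight ` {B. B \<subseteq> W - T \<and> matchable E B \<and> card B = 2 * s}"
      unfolding \<rho>_def using T(2) by (intro Max_in bases) (auto simp: has_match_def)
    then have BT: "B \<subseteq> W - T" unfolding r by (auto simp: weight_inject)
    have max: "weight B' \<le> weight B" if "B' \<subseteq> W - T" "matchable E B'" "card B' = 2 * s" for B'
      unfolding r[symmetric] \<rho>_def using that by (intro Max_ge bases) auto
    have "F \<subseteq> T"
    proof
      fix w assume w: "w \<in> F"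
      then obtain b where b: "b \<in> B" "vidx b < vidx w" "matchable E (insert w (B - {b}))" "w \<in> W" "w \<notin> B"
        unfolding F_def by blast
      show "w \<in> T"
      proof (rule ccontr)
        assume "w \<notin> T"
        moreover have "card (insert w (B - {b})) = 2 * s"
          using b B card_exchange[of B w b] by simp
        ultimately show False
          using max[of "insert w (B - {b})"] weight_exchange[OF b(5,1,2)] b BT by auto
      qed
    qed
    moreover have "T \<subseteq> F \<union> X" using T BT unfolding X_def by blast
    moreover have "\<not> H u v" if "u \<in> X - T" "v \<in> X - T" "u \<noteq> v" for u v
    proof
      assume "H u v"
      moreover have "insert u (insert v B) \<subseteq> W - T" "card (insert u (insert v B)) = 2 * Suc s"
        using that BT B unfolding X_def by auto
      ultimately show False using T(3) unfolding H_def has_match_def by blast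
    qed
    ultimately show "T \<in> indep_family H F X" by (auto simp: indep_family_def indep_def)
  next
    fix T assume "T \<in> indep_family H F X"
    then have T: "F \<subseteq> T" "T \<subseteq> F \<union> X" and ind: "\<And>u v. u \<in> X - T \<Longrightarrow> v \<in> X - T \<Longrightarrow> u \<noteq> v \<Longrightarrow> \<not> H u v"
      by (auto simp: indep_family_def indep_def)
    have TW: "T \<subseteq> W" "B \<subseteq> W - T" using T(2) B unfolding F_def X_def by auto
    have no: "\<not> has_match E (Suc s) (W - T)"
    proof
      assume "has_match E (Suc s) (W - T)"
      from matchable_augment[OF B(2) TW(2) B(3) this] obtain u v
        where "u \<in> W - T - B" "v \<in> W - T - B" "u \<noteq> v" "H u v" unfolding H_def by blast
      then show False using ind[of u v] T unfolding X_def by blast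
    qed
    \<comment> \<open>Every improving exchange would bring in a vertex of \<open>F\<close>, and
      \<open>F\<close> lies in \<open>T\<close>; hence local optimality holds within
      \<open>W - T\<close>.\<close>
    have "weight B' \<le> weight B" if "B' \<subseteq> W - T" "matchable E B'" "card B' = 2 * s" for B'
    proof (rule max_weight_matchable[OF B(2) TW(2) B(3) no _ that(2,1,3)])
      show "\<not> matchable E (insert w (B - {b}))" if "w \<in> W - T - B" "b \<in> B" "vidx b < vidx w" for w b
        using that T unfolding F_def by blast
    qed
    then have "\<rho> T = weight B"
      unfolding \<rho>_def using TW B by (intro Max_eqI bases) auto
    moreover have "has_match E s (W - T)" using TW B unfolding has_match_def by blast
    ultimately show "T \<in> {T \<in> match_family E s W - match_family E (Suc s) W. \<rho> T = weight B}"
      using TW no by (simp add: match_family_def)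
  qed
  moreover have "acyclic_at TYPE('k) (indep_family H F X) i"
  proof (rule acyclic_indep_family)
    show "F \<inter> X = {}" by (auto simp: X_def)
    have "card W = card B + card F + card X"
    proof -
      have "W = B \<union> F \<union> X" "B \<inter> F = {}" "(B \<union> F) \<inter> X = {}" using B unfolding F_def X_def by auto
      then show ?thesis by (metis card_Un_disjoint finite)
    qed
    \<comment> \<open>\<open>B\<close> takes up \<open>2 * s\<close> vertices of \<open>W\<close>,
      which turns the hypothesis into \<open>2 * i < card F + card X\<close>.\<close>
    then show "2 * i < 2 * card F + card X" using i B by linarith
    show "H v u" if "H u v" for u v using that by (simp add: H_def insert_commute)
  qed
  ultimately show ?thesis by simp
qed

text \<open>The sets whose complement has matching number exactly \<open>s\<close> span the quotient
  \<open>?A2\<close> of the complex for \<open>s\<close> by the complex for \<open>Suc s\<close>.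
  Position \<open>i\<close> of the latter is caught between position \<open>Suc i\<close> of
  \<open>?A2\<close> and position \<open>i\<close> of the complex for \<open>s\<close>, and the
  hypothesis for \<open>Suc s\<close> covers both.\<close>

theorem acyclic_match_family:
  fixes W :: "'v::finite set"
  assumes "2 * (i + s) < card W"
  shows "acyclic_at TYPE('k::field) (match_family E s W) i"
  using assms
proof (induction s arbitrary: i)
  case 0
  then obtain x where "x \<in> W" by fastforce
  moreover have "match_family E 0 W = Pow W"
    by (auto simp: match_family_def has_match_def intro: matchable.empty)
  ultimately show ?case by (intro acyclic_cone[of x]) auto
next
  case (Suc s)
  let ?A1 = "match_family E (Suc s) W" and ?A2 = "match_family E s W - match_family E (Suc s) W"
  have sub: "?A1 \<subseteq> match_family E s W" by (auto simp: match_family_def dest: has_match_Suc)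
  then have eq: "?A1 \<union> ?A2 = match_family E s W" by blast
  define \<rho> where "\<rho> T = Max (weight ` {B. B \<subseteq> W - T \<and> matchable E B \<and> card B = 2 * s})" for T
  show ?case
  proof (rule acyclic_lower_part)
    show "order_convex (?A1 \<union> ?A2)" unfolding eq by (rule order_convex_match_family)
    show "\<forall>T\<in>?A1. \<forall>S\<in>?A2. \<not> S \<subseteq> T" using match_family_lower by blast
    show "acyclic_at TYPE('k) (?A1 \<union> ?A2) i" unfolding eq using Suc.prems by (intro Suc.IH) simp
    show "acyclic_at TYPE('k) ?A2 (Suc i)"
    proof (rule acyclic_levels[where \<rho> = \<rho>])
      show "order_convex ?A2"
        unfolding order_convex_def using match_family_lower by blast
      show "\<rho> T \<le> \<rho> S" if T: "T \<in> ?A2" and "S \<subseteq> T" for S T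
        unfolding \<rho>_def
      proof (rule Max_mono)
        show "weight ` {B. B \<subseteq> W - T \<and> matchable E B \<and> card B = 2 * s} \<noteq> {}"
          using T by (auto simp: match_family_def has_match_def)
      qed (use that in auto)
      fix k
      show "acyclic_at TYPE('k) {T \<in> ?A2. \<rho> T = k} (Suc i)"
      proof (cases "\<exists>B\<subseteq>W. matchable E B \<and> card B = 2 * s \<and> weight B = k")
        case True
        then obtain B where "B \<subseteq> W" "matchable E B" "card B = 2 * s" "weight B = k" by blast
        then show ?thesis
          using acyclic_match_level[of "Suc i" s W B E, where 'k='k] Suc.prems by (simp add: \<rho>_def)
      next
        case False
        have "{T \<in> ?A2. \<rho> T = k} = {}"
        proof (rule ccontr)
          assume "{T \<in> ?A2. \<rho> T = k} \<noteq> {}"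
          then obtain T where T: "T \<in> ?A2" "\<rho> T = k" by blast
          have "\<rho> T \<in> weight ` {B. B \<subseteq> W - T \<and> matchable E B \<and> card B = 2 * s}"
            unfolding \<rho>_def using T by (intro Max_in) (auto simp: match_family_def has_match_def)
          then show False using False T by auto
        qed
        then show ?thesis by (metis acyclic_no_faces empty_iff)
      qed
    qed
  qed
qed

section \<open>Koszul complexes of monomial ideals\<close>

lemma lookup_Abs_finite [simp]:
  fixes f :: "'v::finite \<Rightarrow> 'b::zero"
  shows "Poly_Mapping.lookup (Abs_poly_mapping f) = f"
  by (rule lookup_Abs_poly_mapping) simp

definition ind :: "'v::finite set \<Rightarrow> ('v \<Rightarrow>\<^sub>0 nat)" where
  "ind T = Abs_poly_mapping (\<lambda>v. if v \<in> T then 1 else 0)"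

lemma lookup_ind: "Poly_Mapping.lookup (ind T) v = (if v \<in> T then 1 else 0)"
  by (simp add: ind_def)

lemma keys_ind [simp]: "Poly_Mapping.keys (ind T) = T"
  by (auto simp: in_keys_iff lookup_ind split: if_splits)

lemma mon_deg_add: "mon_deg (a + b) = mon_deg a + mon_deg b"
  by (simp add: mon_deg_def lookup_add sum.distrib)

lemma mon_deg_ind: "mon_deg (ind T) = card T"
  by (simp add: mon_deg_def lookup_ind sum.If_cases)

lemma mon_deg_single: "mon_deg (Poly_Mapping.single v n) = n"
  by (simp add: mon_deg_def lookup_single when_def)

lemma mon_deg_eq_0_iff: "mon_deg m = 0 \<longleftrightarrow> m = 0"
  by (auto simp: mon_deg_def intro: poly_mapping_eqI)

lemma finite_mon_deg: "finite {m :: 'v::finite \<Rightarrow>\<^sub>0 nat. mon_deg m = N}"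
proof -
  let ?S = "{m :: 'v \<Rightarrow>\<^sub>0 nat. mon_deg m = N}"
  have "Poly_Mapping.lookup ` ?S \<subseteq> (UNIV \<rightarrow>\<^sub>E {..N})"
    by (auto simp: mon_deg_def intro!: member_le_sum)
  moreover have "finite ((UNIV :: 'v set) \<rightarrow>\<^sub>E {..N})" by (intro finite_PiE) auto
  ultimately have "finite (Poly_Mapping.lookup ` ?S)" by (rule finite_subset)
  moreover have "inj_on Poly_Mapping.lookup ?S"
    unfolding inj_on_def by (intro ballI impI poly_mapping_eqI) (rule fun_cong)
  ultimately show ?thesis by (rule finite_imageD)
qed

lemma lookup_Var_mult:
  fixes p :: "('v::finite, 'k::field) mpoly"
  shows "Poly_Mapping.lookup (Var v * p) m =
    (if Poly_Mapping.lookup m v = 0 then 0 else Poly_Mapping.lookup p (m - Poly_Mapping.single v 1))"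
proof -
  let ?s = "Poly_Mapping.single v 1 :: 'v \<Rightarrow>\<^sub>0 nat"
  have "Poly_Mapping.lookup (Var v * p) m =
     (\<Sum>l. (1 when ?s = l) * (\<Sum>q. Poly_Mapping.lookup p q when m = l + q))"
    by (simp add: lookup_mult Var_def lookup_single)
  also have "\<dots> = (\<Sum>l. (\<Sum>q. Poly_Mapping.lookup p q when m = l + q) when ?s = l)"
    by (simp add: when_mult)
  also have "\<dots> = (\<Sum>q. Poly_Mapping.lookup p q when m = ?s + q)" by simp
  also have "\<dots> = (if Poly_Mapping.lookup m v = 0 then 0 else Poly_Mapping.lookup p (m - ?s))"
  proof (cases "Poly_Mapping.lookup m v = 0")
    case True
    have "m \<noteq> ?s + q" for q
    proof
      assume "m = ?s + q"
      then have "Poly_Mapping.lookup m v = 1 + Poly_Mapping.lookup q v" by (simp add: lookup_add)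
      then show False using True by simp
    qed
    then show ?thesis using True by simp
  next
    case False
    have "m = ?s + q \<longleftrightarrow> m - ?s = q" for q
    proof
      assume "m - ?s = q"
      moreover have "m = ?s + (m - ?s)"
        using False by (intro poly_mapping_eqI) (auto simp: lookup_add lookup_minus lookup_single when_def)
      ultimately show "m = ?s + q" by simp
    qed simp
    then show ?thesis using False by simp
  qed
  finally show ?thesis .
qed

lemma lookup_ksign_mult:
  "Poly_Mapping.lookup (ksign v T * p :: ('v::finite, 'k::field) mpoly) m = ksign v T * Poly_Mapping.lookup p m"
  by (simp add: ksign_def minus_one_power_iff)

lemma lookup_wbd_Var:
  fixes f :: "'v::finite set \<Rightarrow> ('v, 'k::field) mpoly"
  shows "Poly_Mapping.lookup (wbd Var f T) m = (\<Sum>v\<in>-T. ksign v T *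
    (if Poly_Mapping.lookup m v = 0 then 0
     else Poly_Mapping.lookup (f (insert v T)) (m - Poly_Mapping.single v 1)))"
  by (simp add: wbd_def lookup_sum lookup_ksign_mult lookup_Var_mult)

lemma homogeneous_iff:
  "homogeneous d p \<longleftrightarrow> (\<forall>m. Poly_Mapping.lookup p m \<noteq> 0 \<longrightarrow> int (mon_deg m) = d)"
  by (auto simp: homogeneous_def in_keys_iff)

text \<open>The upper Koszul simplicial complex in multidegree \<open>b\<close> of the monomial
  ideal with exponent set \<open>N\<close>. Subtraction of exponents is truncated, so
  \<open>T\<close> has to be required inside the support of \<open>b\<close>.\<close>

definition koszul_cells :: "('v::finite \<Rightarrow>\<^sub>0 nat) set \<Rightarrow> ('v \<Rightarrow>\<^sub>0 nat) \<Rightarrow> 'v set set" where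
  "koszul_cells N b = {T. T \<subseteq> Poly_Mapping.keys b \<and> b - ind T \<in> N}"

text \<open>The Koszul complex of a monomial ideal splits into the chain complexes of the families
  \<open>koszul_cells N b\<close>, one for each multidegree \<open>b\<close>.\<close>

lemma koszul_exact_monomial:
  fixes f :: "'v::finite set \<Rightarrow> ('v, 'k::field) mpoly"
  assumes up: "\<And>a c. a \<in> N \<Longrightarrow> a + c \<in> N"
    and hom: "\<And>T. card T = i \<Longrightarrow> homogeneous d (f T)"
    and keys: "\<And>T. card T = i \<Longrightarrow> Poly_Mapping.keys (f T) \<subseteq> N"
    and cyc: "\<And>T. Suc (card T) = i \<Longrightarrow> wbd Var f T = 0"
    and acyc: "\<And>b. int (mon_deg b) = d + int i \<Longrightarrow> acyclic_at TYPE('k) (koszul_cells N b) i \<or>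
       (\<forall>T. card T = i \<longrightarrow> Poly_Mapping.lookup (f T) (b - ind T) = 0)"
  shows "\<exists>g. (\<forall>T. card T = Suc i \<longrightarrow> homogeneous (d - 1) (g T) \<and> Poly_Mapping.keys (g T) \<subseteq> N) \<and>
    (\<forall>T. card T = i \<longrightarrow> wbd Var g T = f T)"
proof -
  \<comment> \<open>The strand of \<open>f\<close> in multidegree \<open>b\<close>. The basis
    element of \<open>T\<close> has multidegree \<open>ind T\<close>, so its coefficient is read off
    at \<open>b - ind T\<close>.\<close>
  define c where "c b T = (if T \<in> koszul_cells N b \<and> card T = i
    then Poly_Mapping.lookup (f T) (b - ind T) else 0)" for b T
  have ex: "\<exists>c'. chain (koszul_cells N b) (Suc i) c' \<and> (\<forall>T\<in>koszul_cells N b. bd c' T = c b T)"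
    if b: "int (mon_deg b) = d + int i" for b
    using acyc[OF b]
  proof
    assume "acyclic_at TYPE('k) (koszul_cells N b) i"
    moreover have "chain (koszul_cells N b) i (c b)" by (auto simp: chain_def c_def)
    moreover have "bd (c b) T = 0" if T: "T \<in> koszul_cells N b" for T
    proof (cases "Suc (card T) = i")
      case False
      then have "c b (insert v T) = 0" if "v \<notin> T" for v using that by (simp add: c_def)
      then show ?thesis by (auto simp: wbd_def intro!: sum.neutral)
    next
      case True
      have "0 = Poly_Mapping.lookup (wbd Var f T) (b - ind T)" using cyc[OF True] by simp
      also have "\<dots> = bd (c b) T"
        unfolding lookup_wbd_Var unfolding wbd_def
      proof (rule sum.cong)
        fix v assume "v \<in> - T"
        then have v: "v \<notin> T" by simp
        have eq: "b - ind T - Poly_Mapping.single v 1 = b - ind (insert v T)"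
          using v by (intro poly_mapping_eqI) (auto simp: lookup_minus lookup_ind lookup_single when_def)
        have lv: "Poly_Mapping.lookup (b - ind T) v = Poly_Mapping.lookup b v"
          using v by (simp add: lookup_minus lookup_ind)
        have "(if Poly_Mapping.lookup (b - ind T) v = 0 then 0
          else Poly_Mapping.lookup (f (insert v T)) (b - ind T - Poly_Mapping.single v 1)) = c b (insert v T)"
        proof (cases "Poly_Mapping.lookup b v = 0")
          case True
          then have "insert v T \<notin> koszul_cells N b" by (auto simp: koszul_cells_def in_keys_iff)
          then show ?thesis using True lv by (simp add: c_def)
        next
          case False
          have card: "card (insert v T) = i" using v True by simp
          show ?thesis
          proof (cases "b - ind (insert v T) \<in> N")
            case True
            then have "insert v T \<in> koszul_cells N b"
              using T False by (auto simp: koszul_cells_def in_keys_iff)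
            then show ?thesis using False lv eq card by (simp add: c_def)
          next
            case notin: False
            then have "Poly_Mapping.lookup (f (insert v T)) (b - ind (insert v T)) = 0"
              using keys[OF card] by (auto simp: in_keys_iff)
            then show ?thesis using lv eq card by (simp add: c_def)
          qed
        qed
        then show "ksign v T * (if Poly_Mapping.lookup (b - ind T) v = 0 then 0
          else Poly_Mapping.lookup (f (insert v T)) (b - ind T - Poly_Mapping.single v 1)) =
          ksign v T * (1 * c b (insert v T))" by simp
      qed simp
      finally show ?thesis by simp
    qed
    ultimately show ?thesis unfolding acyclic_at_def by blast
  next
    \<comment> \<open>This alternative is there for multidegree 0 of the whole ring: its only cell
      is the empty set, which is not acyclic at 0.\<close>
    assume "\<forall>T. card T = i \<longrightarrow> Poly_Mapping.lookup (f T) (b - ind T) = 0"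
    then have "c b T = 0" for T by (simp add: c_def)
    then show ?thesis by (intro exI[of _ "\<lambda>_. 0"]) (simp add: chain_def wbd_def)
  qed
  \<comment> \<open>Choosing 0 outside total degree \<open>d + i\<close> leaves finitely many
    exponents, so that \<open>g T\<close> below is a polynomial.\<close>
  define c' where "c' b = (if int (mon_deg b) = d + int i then
     (SOME c'. chain (koszul_cells N b) (Suc i) c' \<and> (\<forall>T\<in>koszul_cells N b. bd c' T = c b T))
     else (\<lambda>_. 0))" for b
  have c': "chain (koszul_cells N b) (Suc i) (c' b)" "\<And>T. T \<in> koszul_cells N b \<Longrightarrow> bd (c' b) T = c b T"
    if "int (mon_deg b) = d + int i" for b
    using someI_ex[OF ex[OF that]] that by (simp_all add: c'_def)
  have nz: "int (mon_deg b) = d + int i \<and> T \<in> koszul_cells N b \<and> card T = Suc i" if "c' b T \<noteq> 0" for b T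
  proof -
    have "int (mon_deg b) = d + int i" using that by (auto simp: c'_def split: if_splits)
    with c'(1)[OF this] that show ?thesis by (auto simp: chain_def)
  qed
  define g where "g T = Abs_poly_mapping (\<lambda>a. c' (a + ind T) T)" for T
  have deg: "int (mon_deg a) = d - 1 \<and> a \<in> N" if "c' (a + ind T) T \<noteq> 0" for a T
    using nz[OF that] by (simp add: mon_deg_add mon_deg_ind koszul_cells_def)
  have look: "Poly_Mapping.lookup (g T) a = c' (a + ind T) T" for T a
  proof -
    have "{a. c' (a + ind T) T \<noteq> 0} \<subseteq> {a. mon_deg a = nat (d - 1)}"
      using deg by (metis (mono_tags, lifting) mem_Collect_eq nat_int subsetI)
    then have "finite {a. c' (a + ind T) T \<noteq> 0}" using finite_mon_deg finite_subset by blast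
    then show ?thesis unfolding g_def by simp
  qed
  have "wbd Var g T = f T" if T: "card T = i" for T
  proof (rule poly_mapping_eqI)
    fix m
    define b where "b = m + ind T"
    have bm: "b - ind T = m" by (simp add: b_def)
    have "Poly_Mapping.lookup (wbd Var g T) m = bd (c' b) T"
      unfolding lookup_wbd_Var unfolding wbd_def
    proof (rule sum.cong)
      fix v assume "v \<in> - T"
      then have v: "v \<notin> T" by simp
      show "ksign v T * (if Poly_Mapping.lookup m v = 0 then 0
          else Poly_Mapping.lookup (g (insert v T)) (m - Poly_Mapping.single v 1)) =
          ksign v T * (1 * c' b (insert v T))"
      proof (cases "Poly_Mapping.lookup m v = 0")
        case True
        then have "insert v T \<notin> koszul_cells N b"
          using v by (auto simp: koszul_cells_def in_keys_iff b_def lookup_add lookup_ind)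
        then have "c' b (insert v T) = 0" using nz by blast
        then show ?thesis using True by simp
      next
        case False
        then have "m - Poly_Mapping.single v 1 + ind (insert v T) = b"
          using v unfolding b_def
          by (intro poly_mapping_eqI) (auto simp: lookup_minus lookup_ind lookup_single when_def lookup_add)
        then show ?thesis using False by (simp add: look)
      qed
    qed simp
    also have "\<dots> = Poly_Mapping.lookup (f T) m"
    proof (cases "int (mon_deg b) = d + int i \<and> m \<in> N")
      case True
      then have "T \<in> koszul_cells N b"
        by (auto simp: koszul_cells_def bm) (simp add: b_def in_keys_iff lookup_add lookup_ind)
      then show ?thesis using True c'(2)[of b T] T by (simp add: c_def bm)
    next
      case False
      \<comment> \<open>A nonzero value would put \<open>b - ind (insert v T)\<close> into
        \<open>N\<close> in the right degree, and upward closure would put its product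
        \<open>m\<close> with \<open>v\<close> there as well.\<close>
      have "c' b (insert v T) = 0" if "v \<notin> T" for v
      proof (rule ccontr)
        assume "c' b (insert v T) \<noteq> 0"
        from nz[OF this] have d: "int (mon_deg b) = d + int i" and ins: "insert v T \<subseteq> Poly_Mapping.keys b"
          and "b - ind (insert v T) \<in> N" by (auto simp: koszul_cells_def)
        then have "b - ind (insert v T) + Poly_Mapping.single v 1 \<in> N" using up by blast
        moreover have "b - ind (insert v T) + Poly_Mapping.single v 1 = m"
          using that ins unfolding b_def
          by (intro poly_mapping_eqI)
            (auto simp: lookup_minus lookup_ind lookup_single when_def lookup_add in_keys_iff)
        ultimately show False using False d by simp
      qed
      then have "bd (c' b) T = 0" by (auto simp: wbd_def intro!: sum.neutral)
      moreover have "Poly_Mapping.lookup (f T) m = 0"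
      proof (rule ccontr)
        assume nz0: "Poly_Mapping.lookup (f T) m \<noteq> 0"
        then have "m \<in> N" using keys[OF T] by (auto simp: in_keys_iff)
        moreover have "int (mon_deg m) = d" using nz0 hom[OF T] by (simp add: homogeneous_iff)
        ultimately show False using False T by (simp add: b_def mon_deg_add mon_deg_ind)
      qed
      ultimately show ?thesis by simp
    qed
    finally show "Poly_Mapping.lookup (wbd Var g T) m = Poly_Mapping.lookup (f T) m" .
  qed
  moreover have "homogeneous (d - 1) (g T) \<and> Poly_Mapping.keys (g T) \<subseteq> N" for T
    using deg by (auto simp: homogeneous_iff look in_keys_iff)
  ultimately show ?thesis by blast
qed

lemma acyclic_koszul_cells_UNIV:
  assumes "b \<noteq> 0"
  shows "acyclic_at TYPE('k::field) (koszul_cells UNIV b) i"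
proof -
  obtain v where "v \<in> Poly_Mapping.keys b" using assms by (metis all_not_in_conv keys_eq_empty)
  then show ?thesis by (intro acyclic_cone[of v]) (auto simp: koszul_cells_def)
qed

text \<open>If \<open>v\<close> has exponent at least 2, subtracting it once does not change the
  support, so \<open>v\<close> is the apex of a cone. Otherwise \<open>b\<close> is the indicator of
  its support \<open>W\<close>, and the cells are the sets whose complement in \<open>W\<close>
  contains the matching.\<close>

lemma acyclic_koszul_cells_match:
  fixes b :: "'v::finite \<Rightarrow>\<^sub>0 nat"
  assumes b: "mon_deg b > card (UNIV :: 'v set) div 2 + s + i"
  shows "acyclic_at TYPE('k::field) (koszul_cells {a. has_match E s (Poly_Mapping.keys a)} b) i"
proof (cases "\<exists>v. Poly_Mapping.lookup b v \<ge> 2")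
  case True
  then obtain v where v: "Poly_Mapping.lookup b v \<ge> 2" by blast
  have "Poly_Mapping.keys (b - ind (insert v T)) = Poly_Mapping.keys (b - ind T)" for T
    using v by (auto simp: in_keys_iff lookup_minus lookup_ind)
  then show ?thesis
    using v by (intro acyclic_cone[of v]) (auto simp: koszul_cells_def in_keys_iff)
next
  case False
  have le: "Poly_Mapping.lookup b v \<le> 1" for v
  proof -
    have "\<not> 2 \<le> Poly_Mapping.lookup b v" using False by blast
    then show ?thesis by linarith
  qed
  have "b = ind (Poly_Mapping.keys b)"
  proof (rule poly_mapping_eqI)
    fix v show "Poly_Mapping.lookup b v = Poly_Mapping.lookup (ind (Poly_Mapping.keys b)) v"
      using le[of v] by (auto simp: lookup_ind in_keys_iff)
  qed
  then have card: "mon_deg b = card (Poly_Mapping.keys b)" by (metis mon_deg_ind)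
  have "Poly_Mapping.keys (b - ind T) = Poly_Mapping.keys b - T" for T
    using le by (auto simp: in_keys_iff lookup_minus lookup_ind)
  then have eq: "koszul_cells {a. has_match E s (Poly_Mapping.keys a)} b = match_family E s (Poly_Mapping.keys b)"
    by (auto simp: koszul_cells_def match_family_def)
  have "card (Poly_Mapping.keys b) \<le> card (UNIV :: 'v set)" by (simp add: card_mono)
  moreover define n h where "n = card (UNIV :: 'v set)" and "h = n div 2"
  moreover have "n < 2 * h + 2" by (simp add: h_def)
  ultimately have "2 * (i + s) < card (Poly_Mapping.keys b)" using b card by simp
  then show ?thesis unfolding eq by (rule acyclic_match_family)
qed

section \<open>Regularity and syzygies\<close>

lemma homogeneous_0 [simp]: "homogeneous d 0"
  by (simp add: homogeneous_def)

lemma homogeneous_1: "homogeneous 0 1"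
  by (simp add: homogeneous_def mon_deg_eq_0_iff)

lemma homogeneous_const: "homogeneous 0 (Poly_Mapping.single 0 c)"
  by (auto simp: homogeneous_iff lookup_single when_def mon_deg_eq_0_iff)

lemma homogeneous_Var: "homogeneous 1 (Var v)"
  by (auto simp: homogeneous_iff Var_def lookup_single when_def mon_deg_single split: if_splits)

lemma homogeneous_add: "homogeneous d p \<Longrightarrow> homogeneous d q \<Longrightarrow> homogeneous d (p + q)"
  unfolding homogeneous_iff lookup_add by (metis add.right_neutral)

lemma homogeneous_uminus: "homogeneous d p \<Longrightarrow> homogeneous d (- p)"
  by (simp add: homogeneous_iff)

lemma homogeneous_diff: "homogeneous d p \<Longrightarrow> homogeneous d q \<Longrightarrow> homogeneous d (p - q)"
  using homogeneous_add[of d p "- q"] homogeneous_uminus[of d q] by simp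

lemma homogeneous_sum: "(\<And>x. x \<in> A \<Longrightarrow> homogeneous d (f x)) \<Longrightarrow> homogeneous d (sum f A)"
  by (induction A rule: infinite_finite_induct) (auto intro: homogeneous_add)

lemma homogeneous_mult: "homogeneous d p \<Longrightarrow> homogeneous e q \<Longrightarrow> homogeneous (d + e) (p * q)"
  unfolding homogeneous_def using keys_mult[of p q] by (fastforce simp: mon_deg_add)

lemma homogeneous_ksign: "homogeneous 0 (ksign v T)"
  by (simp add: ksign_def minus_one_power_iff homogeneous_1 homogeneous_uminus)

lemma homogeneous_wbd:
  assumes "\<And>v. v \<notin> T \<Longrightarrow> homogeneous d (c (insert v T))"
  shows "homogeneous (d + 1) (wbd Var c T)"
  unfolding wbd_def
proof (rule homogeneous_sum)
  fix v assume "v \<in> - T"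
  then have "homogeneous (0 + (1 + d)) (ksign v T * (Var v * c (insert v T)))"
    by (intro homogeneous_mult homogeneous_ksign homogeneous_Var assms) simp
  then show "homogeneous (d + 1) (ksign v T * (Var v * c (insert v T)))" by (simp add: add.commute)
qed

text \<open>The Koszul complex resolves the ground field, so the only homology of the ring sits at
  \<open>i = 0\<close> in degree 0. The condition on the constant term of \<open>f {}\<close>
  removes precisely this class.\<close>

lemma koszul_exact_free:
  fixes f :: "'v::finite set \<Rightarrow> ('v, 'k::field) mpoly"
  assumes hom: "\<And>T. card T = i \<Longrightarrow> homogeneous d (f T)"
    and cyc: "\<And>T. Suc (card T) = i \<Longrightarrow> wbd Var f T = 0"
    and "i = 0 \<Longrightarrow> Poly_Mapping.lookup (f {}) 0 = 0"
  shows "\<exists>g. (\<forall>T. card T = Suc i \<longrightarrow> homogeneous (d - 1) (g T)) \<and>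
    (\<forall>T. card T = i \<longrightarrow> wbd Var g T = f T)"
proof -
  have "acyclic_at TYPE('k) (koszul_cells UNIV b) i \<or>
       (\<forall>T. card T = i \<longrightarrow> Poly_Mapping.lookup (f T) (b - ind T) = 0)" for b
  proof (cases "b = 0")
    case False
    then show ?thesis using acyclic_koszul_cells_UNIV by blast
  next
    case b: True
    show ?thesis
    proof (cases "i = 0")
      case True
      moreover have "ind {} = (0 :: 'v \<Rightarrow>\<^sub>0 nat)" by (rule poly_mapping_eqI) (simp add: lookup_ind)
      ultimately show ?thesis using assms(3) b by simp
    next
      case False
      then show ?thesis using b by (intro disjI1 acyclic_no_faces) (auto simp: koszul_cells_def)
    qed
  qed
  then have "\<exists>g. (\<forall>T. card T = Suc i \<longrightarrow> homogeneous (d - 1) (g T) \<and> Poly_Mapping.keys (g T) \<subseteq> UNIV) \<and>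
    (\<forall>T. card T = i \<longrightarrow> wbd Var g T = f T)"
    by (intro koszul_exact_monomial hom cyc) auto
  then show ?thesis by blast
qed

section \<open>Graded submodules of free modules\<close>

type_synonym ('v, 'k) pvec = "nat \<Rightarrow> ('v, 'k) mpoly"

text \<open>A module is recorded only through its homogeneous pieces. Coordinates indexed by all
  natural numbers let free modules of every rank share one type, as the iteration of syzygies
  requires.\<close>

definition graded_submodule :: "(int \<Rightarrow> ('v::finite, 'k::field) pvec set) \<Rightarrow> bool" where
  "graded_submodule D \<longleftrightarrow>
     (\<forall>e. (\<lambda>_. 0) \<in> D e) \<and>
     (\<forall>e. \<forall>a\<in>D e. \<forall>b\<in>D e. (\<lambda>l. a l + b l) \<in> D e) \<and>
     (\<forall>d e p. \<forall>a\<in>D e. homogeneous d p \<longrightarrow> (\<lambda>l. p * a l) \<in> D (d + e))"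

text \<open>The vanishing of the Koszul homology \<open>H i\<close> in the degrees above \<open>B + i\<close>, that is,
  regularity at most \<open>B\<close>. A Koszul \<open>i\<close>-chain of degree \<open>d + i\<close> has coefficients of
  degree \<open>d\<close>.\<close>

definition koszul_bounded :: "(int \<Rightarrow> ('v::finite, 'k::field) pvec set) \<Rightarrow> int \<Rightarrow> bool" where
  "koszul_bounded D B \<longleftrightarrow> (\<forall>i d f. B < d \<longrightarrow> (\<forall>T. card T = i \<longrightarrow> f T \<in> D d) \<longrightarrow>
     (\<forall>T l. Suc (card T) = i \<longrightarrow> wbd Var (\<lambda>S. f S l) T = 0) \<longrightarrow>
     (\<exists>g. (\<forall>T. card T = Suc i \<longrightarrow> g T \<in> D (d - 1)) \<and>
          (\<forall>T l. card T = i \<longrightarrow> wbd Var (\<lambda>S. g S l) T = f T l)))"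

lemma koszul_boundedD:
  assumes "koszul_bounded D B" "B < d" "\<And>T. card T = i \<Longrightarrow> f T \<in> D d"
    "\<And>T l. Suc (card T) = i \<Longrightarrow> wbd Var (\<lambda>S. f S l) T = 0"
  obtains g where "\<And>T. card T = Suc i \<Longrightarrow> g T \<in> D (d - 1)"
    "\<And>T l. card T = i \<Longrightarrow> wbd Var (\<lambda>S. g S l) T = f T l"
proof -
  have "\<exists>g. (\<forall>T. card T = Suc i \<longrightarrow> g T \<in> D (d - 1)) \<and>
          (\<forall>T l. card T = i \<longrightarrow> wbd Var (\<lambda>S. g S l) T = f T l)"
    using assms(1)[unfolded koszul_bounded_def, rule_format, of d i f] assms(2-4) by blast
  then show thesis using that by blast
qed

type_synonym ('v, 'k) gens = "(int \<times> ('v, 'k) pvec) list"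

definition lincomb :: "('v::finite, 'k::field) gens \<Rightarrow> ('v, 'k) pvec \<Rightarrow> ('v, 'k) pvec" where
  "lincomb L c l = (\<Sum>k<length L. c k * snd (L ! k) l)"

definition homogeneous_coeffs :: "int \<Rightarrow> ('v::finite, 'k::field) gens \<Rightarrow> ('v, 'k) pvec \<Rightarrow> bool" where
  "homogeneous_coeffs e L c \<longleftrightarrow> (\<forall>k<length L. homogeneous (e - fst (L ! k)) (c k))"

definition hspan :: "('v::finite, 'k::field) gens \<Rightarrow> int \<Rightarrow> ('v, 'k) pvec set" where
  "hspan L e = {lincomb L c | c. homogeneous_coeffs e L c}"

text \<open>Padding with zeros beyond the length of \<open>L\<close> turns syzygies into vectors of
  the same kind as those in \<open>D\<close>, so the construction can be repeated.\<close>

definition syz :: "('v::finite, 'k::field) gens \<Rightarrow> int \<Rightarrow> ('v, 'k) pvec set" where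
  "syz L e = {c. (\<forall>k\<ge>length L. c k = 0) \<and> homogeneous_coeffs e L c \<and> (\<forall>l. lincomb L c l = 0)}"

definition generates :: "('v::finite, 'k::field) gens \<Rightarrow> (int \<Rightarrow> ('v, 'k) pvec set) \<Rightarrow> bool" where
  "generates L D \<longleftrightarrow> (\<forall>x\<in>set L. snd x \<in> D (fst x)) \<and> (\<forall>e. D e \<subseteq> hspan L e)"

text \<open>Minimality in the sense of Nakayama: all homogeneous syzygies have their coefficients in
  the irrelevant ideal.\<close>

definition minimal_gens :: "('v::finite, 'k::field) gens \<Rightarrow> bool" where
  "minimal_gens L \<longleftrightarrow> (\<forall>e. \<forall>c\<in>syz L e. \<forall>k<length L. Poly_Mapping.lookup (c k) 0 = 0)"

lemma lincomb_add: "lincomb L (\<lambda>k. c k + d k) l = lincomb L c l + lincomb L d l"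
  by (simp add: lincomb_def distrib_right sum.distrib)

lemma lincomb_diff: "lincomb L (\<lambda>k. c k - d k) l = lincomb L c l - lincomb L d l"
  by (simp add: lincomb_def left_diff_distrib sum_subtractf)

lemma lincomb_mult: "lincomb L (\<lambda>k. p * c k) l = p * lincomb L c l"
  by (simp add: lincomb_def sum_distrib_left mult.assoc)

lemma lincomb_sum: "lincomb L (\<lambda>k. \<Sum>x\<in>A. c x k) l = (\<Sum>x\<in>A. lincomb L (c x) l)"
  unfolding lincomb_def sum_distrib_right by (rule sum.swap)

lemma lincomb_cong: "(\<And>k. k < length L \<Longrightarrow> c k = d k) \<Longrightarrow> lincomb L c l = lincomb L d l"
  by (simp add: lincomb_def)

lemma lincomb_wbd: "lincomb L (\<lambda>k. wbd w (\<lambda>S. c S k) T) l = wbd w (\<lambda>S. lincomb L (c S) l) T"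
  unfolding wbd_def lincomb_sum by (simp add: lincomb_mult)

lemma lincomb_unit:
  "k < length L \<Longrightarrow> lincomb L (\<lambda>j. if j = k then p else 0) l = p * snd (L ! k) l"
proof -
  assume k: "k < length L"
  have "lincomb L (\<lambda>j. if j = k then p else 0) l = (\<Sum>j<length L. if j = k then p * snd (L ! k) l else 0)"
    unfolding lincomb_def by (rule sum.cong) auto
  then show ?thesis using k by simp
qed

lemma homogeneous_mult_shift:
  "homogeneous d p \<Longrightarrow> homogeneous (e - f) q \<Longrightarrow> homogeneous (d + e - f) (p * q)"
  using homogeneous_mult[of d p "e - f" q] by (simp add: algebra_simps)

lemma graded_submodule_hspan:
  fixes L :: "('v::finite, 'k::field) gens"
  shows "graded_submodule (hspan L)"
  unfolding graded_submodule_def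
proof (intro conjI allI ballI impI)
  fix e
  show "(\<lambda>_. 0) \<in> hspan L e"
    unfolding hspan_def
    by (intro CollectI exI[of _ "\<lambda>_. 0"]) (auto simp: homogeneous_coeffs_def lincomb_def)
next
  fix e a b assume "a \<in> hspan L e" "b \<in> hspan L e"
  then obtain c d where "a = lincomb L c" "homogeneous_coeffs e L c"
    "b = lincomb L d" "homogeneous_coeffs e L d" unfolding hspan_def by blast
  then show "(\<lambda>l. a l + b l) \<in> hspan L e"
    unfolding hspan_def
    by (intro CollectI exI[of _ "\<lambda>k. c k + d k"])
      (auto simp: homogeneous_coeffs_def lincomb_add fun_eq_iff intro: homogeneous_add)
next
  fix d e and p :: "('v, 'k) mpoly" and a assume "a \<in> hspan L e" and p: "homogeneous d p"
  then obtain c where "a = lincomb L c" "homogeneous_coeffs e L c" unfolding hspan_def by blast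
  then show "(\<lambda>l. p * a l) \<in> hspan L (d + e)"
    unfolding hspan_def using p
    by (intro CollectI exI[of _ "\<lambda>k. p * c k"])
      (auto simp: homogeneous_coeffs_def lincomb_mult fun_eq_iff intro: homogeneous_mult_shift)
qed

lemma graded_submodule_syz:
  fixes L :: "('v::finite, 'k::field) gens"
  shows "graded_submodule (syz L)"
  unfolding graded_submodule_def
proof (intro conjI allI ballI impI)
  fix e
  show "(\<lambda>_. 0) \<in> syz L e" by (auto simp: syz_def homogeneous_coeffs_def lincomb_def)
next
  fix e a b assume "a \<in> syz L e" "b \<in> syz L e"
  then show "(\<lambda>l. a l + b l) \<in> syz L e"
    by (auto simp: syz_def homogeneous_coeffs_def lincomb_add intro: homogeneous_add)
next
  fix d e and p :: "('v, 'k) mpoly" and a assume "a \<in> syz L e" "homogeneous d p"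
  then show "(\<lambda>l. p * a l) \<in> syz L (d + e)"
    by (auto simp: syz_def homogeneous_coeffs_def lincomb_mult intro: homogeneous_mult_shift)
qed

lemma graded_submodule_0: "graded_submodule D \<Longrightarrow> (\<lambda>_. 0) \<in> D e"
  by (simp add: graded_submodule_def)

lemma graded_submodule_add:
  "graded_submodule D \<Longrightarrow> a \<in> D e \<Longrightarrow> b \<in> D e \<Longrightarrow> (\<lambda>l. a l + b l) \<in> D e"
  by (simp add: graded_submodule_def)

lemma graded_submodule_sum:
  assumes "graded_submodule D" "\<And>x. x \<in> A \<Longrightarrow> a x \<in> D e"
  shows "(\<lambda>l. \<Sum>x\<in>A. a x l) \<in> D e"
  using assms(2)
proof (induction A rule: infinite_finite_induct)
  case (insert x A)
  then have "a x \<in> D e" "(\<lambda>l. \<Sum>x\<in>A. a x l) \<in> D e" by auto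
  then have "(\<lambda>l. a x l + (\<Sum>x\<in>A. a x l)) \<in> D e"
    by (rule graded_submodule_add[OF assms(1)])
  then show ?case using insert by simp
qed (use assms(1) in \<open>simp_all add: graded_submodule_def\<close>)

lemma graded_submodule_mult:
  assumes "graded_submodule D" "a \<in> D (e - d)" "homogeneous d p"
  shows "(\<lambda>l. p * a l) \<in> D e"
proof -
  note assms(1)[unfolded graded_submodule_def, THEN conjunct2, THEN conjunct2, rule_format]
  from this[OF assms(2,3)] show ?thesis by simp
qed

lemma graded_submodule_lincomb:
  assumes D: "graded_submodule D" and L: "\<And>x. x \<in> set L \<Longrightarrow> snd x \<in> D (fst x)"
    and c: "homogeneous_coeffs e L c"
  shows "lincomb L c \<in> D e"
proof -
  have "(\<lambda>l. \<Sum>k<length L. c k * snd (L ! k) l) \<in> D e"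
  proof (rule graded_submodule_sum[OF D])
    fix k assume "k \<in> {..<length L}"
    then have "snd (L ! k) \<in> D (fst (L ! k))" "homogeneous (e - fst (L ! k)) (c k)"
      using L c by (auto simp: homogeneous_coeffs_def)
    then show "(\<lambda>l. c k * snd (L ! k) l) \<in> D e"
      using graded_submodule_mult[OF D, of _ e "e - fst (L ! k)"] by simp
  qed
  then show ?thesis by (simp add: lincomb_def[abs_def])
qed

lemma hspan_subset:
  assumes "graded_submodule D" "\<And>x. x \<in> set L \<Longrightarrow> snd x \<in> D (fst x)"
  shows "hspan L e \<subseteq> D e"
  using graded_submodule_lincomb[OF assms] unfolding hspan_def by blast

lemma gens_in_hspan:
  assumes "x \<in> set L"
  shows "snd x \<in> hspan L (fst x)"
proof -
  obtain k where k: "k < length L" "L ! k = x" using assms by (auto simp: in_set_conv_nth)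
  have "snd x = lincomb L (\<lambda>j. if j = k then 1 else 0)" using k by (auto simp: lincomb_unit)
  moreover have "homogeneous_coeffs (fst x) L (\<lambda>j. if j = k then 1 else 0)"
    using k by (auto simp: homogeneous_coeffs_def homogeneous_1)
  ultimately show ?thesis unfolding hspan_def by blast
qed

lemma hspan_mono: "set L \<subseteq> set L' \<Longrightarrow> hspan L e \<subseteq> hspan L' e"
  by (rule hspan_subset[OF graded_submodule_hspan]) (auto intro: gens_in_hspan)

text \<open>Dimension shifting: the Koszul complex of a free module is exact in positive homological
  degree, so the Koszul homology of the syzygies is that of the module, shifted by one.\<close>

lemma koszul_bounded_syz:
  assumes D: "graded_submodule D" and gen: "generates L D" and min: "minimal_gens L"
    and bdd: "koszul_bounded D B"
  shows "koszul_bounded (syz L) (B + 1)"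
  unfolding koszul_bounded_def
proof (intro allI impI)
  fix i d and f :: "'a set \<Rightarrow> ('a, 'b) pvec"
  assume d: "B + 1 < d" and f: "\<forall>T. card T = i \<longrightarrow> f T \<in> syz L d"
    and cyc: "\<forall>T l. Suc (card T) = i \<longrightarrow> wbd Var (\<lambda>S. f S l) T = 0"
  define r where "r = length L"
  have L: "\<And>x. x \<in> set L \<Longrightarrow> snd x \<in> D (fst x)" using gen by (simp add: generates_def)
  \<comment> \<open>Each coordinate of \<open>f\<close> is a cycle over the ring and is filled
    separately. For \<open>i = 0\<close> minimality supplies the vanishing constant term.\<close>
  have "\<exists>g. (\<forall>T. card T = Suc i \<longrightarrow> homogeneous (d - fst (L ! k) - 1) (g T)) \<and>
      (\<forall>T. card T = i \<longrightarrow> wbd Var g T = f T k)" if k: "k < r" for k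
  proof (rule koszul_exact_free)
    show "homogeneous (d - fst (L ! k)) (f T k)" if "card T = i" for T
      using f k that by (auto simp: syz_def homogeneous_coeffs_def r_def)
    show "Poly_Mapping.lookup (f {} k) 0 = 0" if "i = 0"
      using f that min k unfolding minimal_gens_def r_def by (metis card.empty)
  qed (use cyc in auto)
  then obtain g where g: "\<And>k T. k < r \<Longrightarrow> card T = Suc i \<Longrightarrow> homogeneous (d - fst (L ! k) - 1) (g k T)"
    and gf: "\<And>k T. k < r \<Longrightarrow> card T = i \<Longrightarrow> wbd Var (g k) T = f T k" by metis
  define G where "G T k = (if k < r then g k T else 0)" for T k
  have wG: "wbd Var (\<lambda>S. G S k) T = f T k" if "card T = i" for T k
  proof (cases "k < r")
    case True
    then show ?thesis using gf that by (simp add: G_def)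
  next
    case False
    then have "f T k = 0" using f that by (auto simp: syz_def r_def)
    then show ?thesis using False by (simp add: G_def wbd_def)
  qed
  have G_hom: "homogeneous_coeffs (d - 1) L (G T)" if "card T = Suc i" for T
    using g that by (auto simp: homogeneous_coeffs_def G_def r_def algebra_simps)
  \<comment> \<open>The image of \<open>G\<close> in \<open>D\<close> is a cycle at
    \<open>Suc i\<close>, because \<open>f\<close> consists of syzygies. Its coefficients have
    degree \<open>d - 1 > B\<close>, so it is the boundary of some \<open>w\<close>.\<close>
  obtain w where w: "\<And>T. card T = Suc (Suc i) \<Longrightarrow> w T \<in> D (d - 1 - 1)"
    and wh: "\<And>T l. card T = Suc i \<Longrightarrow> wbd Var (\<lambda>S. w S l) T = lincomb L (G T) l"
  proof (rule koszul_boundedD[OF bdd, of "d - 1" "Suc i" "\<lambda>T. lincomb L (G T)"])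
    show "lincomb L (G T) \<in> D (d - 1)" if "card T = Suc i" for T
      by (rule graded_submodule_lincomb[OF D L G_hom[OF that]])
    fix T :: "'a set" and l assume T: "Suc (card T) = Suc i"
    have "wbd Var (\<lambda>S. lincomb L (G S) l) T = lincomb L (\<lambda>k. wbd Var (\<lambda>S. G S k) T) l"
      by (simp add: lincomb_wbd)
    also have "\<dots> = lincomb L (f T) l" using T wG by simp
    also have "\<dots> = 0" using f T by (simp add: syz_def)
    finally show "wbd Var (\<lambda>S. lincomb L (G S) l) T = 0" .
  qed (use d in auto)
  have "\<exists>c. w T = lincomb L c \<and> homogeneous_coeffs (d - 1 - 1) L c" if "card T = Suc (Suc i)" for T
    using w[OF that] gen unfolding generates_def hspan_def by blast
  then obtain u where u: "\<And>T. card T = Suc (Suc i) \<Longrightarrow> w T = lincomb L (u T)"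
    and u_hom: "\<And>T. card T = Suc (Suc i) \<Longrightarrow> homogeneous_coeffs (d - 1 - 1) L (u T)" by metis
  define U where "U T k = (if k < r then u T k else 0)" for T k
  \<comment> \<open>Subtracting the boundary of a lift \<open>U\<close> of \<open>w\<close> makes
    the image in \<open>D\<close> zero, and leaves the boundary \<open>f\<close> of \<open>G\<close>
    unchanged because the differential squares to zero.\<close>
  define h where "h T k = G T k - wbd Var (\<lambda>S. U S k) T" for T k
  have "h T \<in> syz L (d - 1)" if T: "card T = Suc i" for T
  proof -
    have "h T k = 0" if "k \<ge> length L" for k
      using that by (simp add: h_def G_def U_def r_def wbd_def)
    moreover have "homogeneous_coeffs (d - 1) L (h T)"
      unfolding homogeneous_coeffs_def
    proof (intro allI impI)
      fix k assume k: "k < length L"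
      have "homogeneous (d - 1 - 1 - fst (L ! k) + 1) (wbd Var (\<lambda>S. U S k) T)"
      proof (rule homogeneous_wbd)
        fix v assume "v \<notin> T"
        then have "card (insert v T) = Suc (Suc i)" using T by simp
        from u_hom[OF this] show "homogeneous (d - 1 - 1 - fst (L ! k)) (U (insert v T) k)"
          using k by (simp add: U_def r_def homogeneous_coeffs_def)
      qed
      then have "homogeneous (d - 1 - fst (L ! k)) (wbd Var (\<lambda>S. U S k) T)" by (simp add: algebra_simps)
      then show "homogeneous (d - 1 - fst (L ! k)) (h T k)"
        using G_hom[OF T] k unfolding h_def homogeneous_coeffs_def by (intro homogeneous_diff) auto
    qed
    moreover have "lincomb L (h T) l = 0" for l
    proof -
      have "lincomb L (h T) l = lincomb L (G T) l - wbd Var (\<lambda>S. lincomb L (U S) l) T"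
        by (simp add: h_def[abs_def] lincomb_diff lincomb_wbd)
      also have "wbd Var (\<lambda>S. lincomb L (U S) l) T = wbd Var (\<lambda>S. w S l) T"
      proof (rule wbd_cong)
        fix v assume "v \<notin> T"
        then have "card (insert v T) = Suc (Suc i)" using T by simp
        then show "lincomb L (U (insert v T)) l = w (insert v T) l"
          using u by (simp add: U_def r_def cong: lincomb_cong)
      qed
      finally show ?thesis using wh[OF T] by simp
    qed
    ultimately show ?thesis by (simp add: syz_def)
  qed
  moreover have "wbd Var (\<lambda>S. h S k) T = f T k" if "card T = i" for T k
    unfolding h_def wbd_diff using wG[OF that] wbd_wbd[of Var "\<lambda>S. U S k" T] by simp
  ultimately show "\<exists>g. (\<forall>T. card T = Suc i \<longrightarrow> g T \<in> syz L (d - 1)) \<and>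
    (\<forall>T l. card T = i \<longrightarrow> wbd Var (\<lambda>S. g S l) T = f T l)" by blast
qed

text \<open>The case \<open>i = 0\<close> of the bound: every element is a cycle there, and being a
  boundary means lying in the irrelevant ideal times the piece one degree below.\<close>

lemma koszul_bounded_decompose:
  fixes D :: "int \<Rightarrow> ('v::finite, 'k::field) pvec set"
  assumes bdd: "koszul_bounded D B" and e: "B < e" and a: "a \<in> D e"
  obtains g where "\<And>v. g v \<in> D (e - 1)" "\<And>l. a l = (\<Sum>v\<in>UNIV. ksign v {} * (Var v * g v l))"
proof -
  obtain g where g: "\<And>T. card T = Suc 0 \<Longrightarrow> g T \<in> D (e - 1)"
    and ga: "\<And>T :: 'v set. \<And>l. card T = 0 \<Longrightarrow> wbd Var (\<lambda>S. g S l) T = a l"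
    using koszul_boundedD[OF bdd e, of 0 "\<lambda>_. a"] a by auto
  show thesis
  proof (rule that[of "\<lambda>v. g {v}"])
    show "a l = (\<Sum>v\<in>UNIV. ksign v {} * (Var v * g {v} l))" for l
      using ga[of "{}" l] by (simp add: wbd_def)
  qed (simp add: g)
qed

text \<open>A generator of degree above \<open>B\<close> would be a combination of variables times
  elements one degree lower. Writing these in terms of \<open>L\<close> gives a syzygy whose
  coefficient at \<open>k\<close> is 1 minus something without constant term, against
  minimality.\<close>

lemma minimal_gens_degree_le:
  fixes D :: "int \<Rightarrow> ('v::finite, 'k::field) pvec set"
  assumes gen: "generates L D" and min: "minimal_gens L"
    and bdd: "koszul_bounded D B" and k: "k < length L"
  shows "fst (L ! k) \<le> B"
proof (rule ccontr)
  assume "\<not> fst (L ! k) \<le> B"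
  define \<delta> where "\<delta> = fst (L ! k)"
  have "B < \<delta>" using \<open>\<not> fst (L ! k) \<le> B\<close> by (simp add: \<delta>_def)
  moreover have "snd (L ! k) \<in> D \<delta>" using gen k by (simp add: generates_def \<delta>_def)
  ultimately obtain g where g: "\<And>v. g v \<in> D (\<delta> - 1)"
    and ga: "\<And>l. snd (L ! k) l = (\<Sum>v\<in>UNIV. ksign v {} * (Var v * g v l))"
    using koszul_bounded_decompose[OF bdd] by blast
  have "\<exists>c. g v = lincomb L c \<and> homogeneous_coeffs (\<delta> - 1) L c" for v
    using g[of v] gen unfolding generates_def hspan_def by blast
  then obtain c where c: "\<And>v. g v = lincomb L (c v)"
    and c_hom: "\<And>v. homogeneous_coeffs (\<delta> - 1) L (c v)" by metis
  \<comment> \<open>Reindexing by singletons makes the combination a Koszul boundary at the empty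
    set, so that the lemmas on \<open>wbd\<close> apply to it.\<close>
  define C where "C S j = c (the_elem S) j" for S j
  define W where "W j = wbd Var (\<lambda>S. C S j) {}" for j
  define z where "z j = (if j < length L then (if j = k then 1 else 0) - W j else 0)" for j
  have W: "lincomb L W l = snd (L ! k) l" for l
  proof -
    have "lincomb L W l = wbd Var (\<lambda>S. lincomb L (C S) l) {}"
      unfolding W_def by (rule lincomb_wbd)
    also have "\<dots> = (\<Sum>v\<in>UNIV. ksign v {} * (Var v * lincomb L (c v) l))"
      by (simp add: wbd_def C_def[abs_def])
    finally show ?thesis using ga c by simp
  qed
  have "lincomb L z l = 0" for l
  proof -
    have "lincomb L z l = lincomb L (\<lambda>j. (if j = k then 1 else 0) - W j) l"
      by (rule lincomb_cong) (simp add: z_def)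
    then show ?thesis using k by (simp add: lincomb_diff lincomb_unit W)
  qed
  moreover have "homogeneous_coeffs \<delta> L z"
    unfolding homogeneous_coeffs_def
  proof (intro allI impI)
    fix j assume j: "j < length L"
    have "homogeneous (\<delta> - 1 - fst (L ! j) + 1) (W j)"
      unfolding W_def using c_hom j by (intro homogeneous_wbd) (auto simp: C_def homogeneous_coeffs_def)
    then have "homogeneous (\<delta> - fst (L ! j)) (W j)" by (simp add: algebra_simps)
    moreover have "homogeneous (\<delta> - fst (L ! j)) (if j = k then 1 else 0)"
      by (simp add: \<delta>_def homogeneous_1)
    moreover have "z j = (if j = k then 1 else 0) - W j" using j by (simp add: z_def)
    ultimately show "homogeneous (\<delta> - fst (L ! j)) (z j)" by (metis homogeneous_diff)
  qed
  ultimately have "z \<in> syz L \<delta>" by (simp add: syz_def z_def)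
  then have "Poly_Mapping.lookup (z k) 0 = 0" using min k unfolding minimal_gens_def by blast
  moreover have "Poly_Mapping.lookup (W k) 0 = 0"
    unfolding W_def lookup_wbd_Var by simp
  ultimately show False using k by (simp add: z_def lookup_minus)
qed

section \<open>Finite generation and minimal generators\<close>

lemma homogeneous_0_const:
  assumes "homogeneous 0 p"
  shows "p = Poly_Mapping.single 0 (Poly_Mapping.lookup p 0)"
proof (rule poly_mapping_eqI)
  fix m show "Poly_Mapping.lookup p m = Poly_Mapping.lookup (Poly_Mapping.single 0 (Poly_Mapping.lookup p 0)) m"
    using assms by (auto simp: homogeneous_iff lookup_single when_def mon_deg_eq_0_iff)
qed

lemma lookup_const_mult:
  fixes p :: "('v::finite, 'k::field) mpoly"
  shows "Poly_Mapping.lookup (Poly_Mapping.single 0 c * p) m = c * Poly_Mapping.lookup p m"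
  unfolding mult_map_scale_conv_mult[symmetric] by (simp add: map.rep_eq when_def)

text \<open>Gaussian elimination over the finite set \<open>X\<close> of positions that may be
  nonzero: the vectors vanishing at one position form a subspace with fewer positions, and a single
  further vector spans the rest.\<close>

lemma finite_dim_generated:
  fixes V :: "('v::finite, 'k::field) pvec set"
  assumes "finite X"
    and "(\<lambda>_. 0) \<in> V"
    and "\<And>a b. a \<in> V \<Longrightarrow> b \<in> V \<Longrightarrow> (\<lambda>l. a l + b l) \<in> V"
    and "\<And>a c. a \<in> V \<Longrightarrow> (\<lambda>l. Poly_Mapping.single 0 c * a l) \<in> V"
    and "\<And>a l m. a \<in> V \<Longrightarrow> (l, m) \<notin> X \<Longrightarrow> Poly_Mapping.lookup (a l) m = 0"
  shows "\<exists>G. set G \<subseteq> V \<and> V \<subseteq> hspan (map (Pair d) G) d"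
  using assms
proof (induction X arbitrary: V rule: finite_induct)
  case empty
  have "a = (\<lambda>_. 0)" if "a \<in> V" for a
    using empty.prems(4)[OF that] by (auto intro!: ext poly_mapping_eqI)
  then have "V \<subseteq> hspan (map (Pair d) []) d"
    using graded_submodule_0[OF graded_submodule_hspan[of "[]"], of d] by auto
  then show ?case by (intro exI[of _ "[]"]) simp
next
  case (insert x X)
  obtain l0 m0 where x: "x = (l0, m0)" by (cases x)
  define V' where "V' = {a\<in>V. Poly_Mapping.lookup (a l0) m0 = 0}"
  have "\<exists>G. set G \<subseteq> V' \<and> V' \<subseteq> hspan (map (Pair d) G) d"
  proof (rule insert.IH)
    show "Poly_Mapping.lookup (a l) m = 0" if "a \<in> V'" "(l, m) \<notin> X" for a l m
      using that insert.prems(4)[of a l m] x by (auto simp: V'_def)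
  qed (use insert.prems in \<open>auto simp: V'_def lookup_add lookup_const_mult\<close>)
  then obtain G where G: "set G \<subseteq> V'" "V' \<subseteq> hspan (map (Pair d) G) d" by blast
  show ?case
  proof (cases "V = V'")
    case True
    then show ?thesis using G by blast
  next
    case False
    then obtain a0 where a0: "a0 \<in> V" "Poly_Mapping.lookup (a0 l0) m0 \<noteq> 0" by (auto simp: V'_def)
    let ?H = "hspan (map (Pair d) (a0 # G))"
    have "a \<in> ?H d" if a: "a \<in> V" for a
    proof -
      define t where "t = Poly_Mapping.lookup (a l0) m0 / Poly_Mapping.lookup (a0 l0) m0"
      define a' where "a' l = a l + Poly_Mapping.single 0 (- t) * a0 l" for l
      have "a' \<in> V" unfolding a'_def using a a0 insert.prems(2,3) by blast
      moreover have "Poly_Mapping.lookup (a' l0) m0 = 0"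
        using a0 by (simp add: a'_def lookup_add lookup_const_mult t_def)
      ultimately have "a' \<in> V'" by (simp add: V'_def)
      then have a': "a' \<in> ?H d" using G(2) hspan_mono[of "map (Pair d) G" "map (Pair d) (a0 # G)" d] by auto
      have "a0 \<in> ?H d" using gens_in_hspan[of "(d, a0)" "map (Pair d) (a0 # G)"] by simp
      then have "(\<lambda>l. Poly_Mapping.single 0 t * a0 l) \<in> ?H d"
        by (intro graded_submodule_mult[OF graded_submodule_hspan, of _ _ _ 0] homogeneous_const) simp
      with a' have "(\<lambda>l. a' l + Poly_Mapping.single 0 t * a0 l) \<in> ?H d"
        by (rule graded_submodule_add[OF graded_submodule_hspan])
      moreover have "a' l + Poly_Mapping.single 0 t * a0 l = a l" for l
        by (simp add: a'_def single_uminus)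
      ultimately show ?thesis by simp
    qed
    moreover have "set (a0 # G) \<subseteq> V" using G a0 by (auto simp: V'_def)
    ultimately show ?thesis by blast
  qed
qed

text \<open>Being contained in a free module with \<open>r\<close> basis elements of degrees
  \<open>\<delta>\<close> makes every homogeneous piece finite-dimensional and the pieces of very
  low degree zero.\<close>

definition finite_rank :: "(int \<Rightarrow> ('v::finite, 'k::field) pvec set) \<Rightarrow> bool" where
  "finite_rank D \<longleftrightarrow> (\<exists>r \<delta>. \<forall>e. \<forall>a\<in>D e. (\<forall>l\<ge>r. a l = 0) \<and> (\<forall>l<r. homogeneous (e - \<delta> l) (a l)))"

lemma finite_rank_syz: "finite_rank (syz L)"
  unfolding finite_rank_def syz_def homogeneous_coeffs_def
  by (intro exI[of _ "length L"] exI[of _ "\<lambda>l. fst (L ! l)"]) auto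

text \<open>Pieces below all basis degrees vanish, and a piece above \<open>B\<close> comes from the
  one before it. Finite spanning sets of the pieces in between therefore generate
  everything.\<close>

lemma finitely_generated:
  fixes D :: "int \<Rightarrow> ('v::finite, 'k::field) pvec set"
  assumes D: "graded_submodule D" and bdd: "koszul_bounded D B" and "finite_rank D"
  shows "\<exists>L. generates L D"
proof -
  obtain r \<delta> where D0: "\<And>e a l. a \<in> D e \<Longrightarrow> l \<ge> r \<Longrightarrow> a l = 0"
    and Dh: "\<And>e a l. a \<in> D e \<Longrightarrow> l < r \<Longrightarrow> homogeneous (e - \<delta> l) (a l)"
    using assms(3) unfolding finite_rank_def by blast
  \<comment> \<open>The element 0 keeps the set nonempty when the rank is 0; any lower bound of the
    basis degrees will do.\<close>
  define d0 where "d0 = Min (insert 0 (\<delta> ` {..<r}))"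
  have d0: "d0 \<le> \<delta> l" if "l < r" for l unfolding d0_def using that by (intro Min_le) auto
  have zero: "a = (\<lambda>_. 0)" if "a \<in> D e" "e < d0" for a e
  proof
    fix l show "a l = 0"
    proof (cases "l < r")
      case True
      then have "homogeneous (e - \<delta> l) (a l)" "e - \<delta> l < 0" using Dh d0[of l] that by auto
      then show ?thesis by (intro poly_mapping_eqI) (auto simp: homogeneous_iff)
    qed (use D0 that in auto)
  qed
  have "\<exists>G. set G \<subseteq> D d \<and> D d \<subseteq> hspan (map (Pair d) G) d" for d
  proof (rule finite_dim_generated)
    show "finite (SIGMA l:{..<r}. {m :: 'v \<Rightarrow>\<^sub>0 nat. mon_deg m = nat (d - \<delta> l)})"
      by (intro finite_SigmaI finite_mon_deg) simp
    show "(\<lambda>_. 0) \<in> D d" by (rule graded_submodule_0[OF D])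
    show "(\<lambda>l. a l + b l) \<in> D d" if "a \<in> D d" "b \<in> D d" for a b
      using graded_submodule_add[OF D] that by blast
    show "(\<lambda>l. Poly_Mapping.single 0 c * a l) \<in> D d" if "a \<in> D d" for a c
      using that by (intro graded_submodule_mult[OF D, of _ _ 0] homogeneous_const) simp
    show "Poly_Mapping.lookup (a l) m = 0"
      if a: "a \<in> D d" and n: "(l, m) \<notin> (SIGMA l:{..<r}. {m. mon_deg m = nat (d - \<delta> l)})" for a l m
    proof (cases "l < r")
      case True
      then have "int (mon_deg m) \<noteq> d - \<delta> l" using n by auto
      then show ?thesis using Dh[OF a True] by (auto simp: homogeneous_iff)
    qed (use D0[OF a] in auto)
  qed
  then obtain G where G: "\<And>d. set (G d) \<subseteq> D d" "\<And>d. D d \<subseteq> hspan (map (Pair d) (G d)) d" by metis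
  define L where "L = concat (map (\<lambda>d. map (Pair d) (G d)) [d0..B])"
  have below: "D e \<subseteq> hspan L e" if "e < d0 + int n" for n e
    using that
  proof (induction n arbitrary: e)
    case 0
    then show ?case
      using zero[of _ e] graded_submodule_0[OF graded_submodule_hspan[of L], of e] by auto
  next
    case (Suc n)
    show ?case
    proof (cases "e < d0 + int n")
      case False
      then have e: "e \<ge> d0" by simp
      show ?thesis
      proof (cases "e \<le> B")
        case True
        then have "set (map (Pair e) (G e)) \<subseteq> set L" using e by (auto simp: L_def)
        then show ?thesis using G(2)[of e] hspan_mono by blast
      next
        case False
        show ?thesis
        proof
          fix a assume "a \<in> D e"
          then obtain g where g: "\<And>v. g v \<in> D (e - 1)"
            and ga: "\<And>l. a l = (\<Sum>v\<in>UNIV. ksign v {} * (Var v * g v l))"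
            using koszul_bounded_decompose[OF bdd _ \<open>a \<in> D e\<close>] False by (auto simp: not_le)
          have "g v \<in> hspan L (e - 1)" for v using g Suc.IH[of "e - 1"] Suc.prems by fastforce
          then have "(\<lambda>l. ksign v {} * Var v * g v l) \<in> hspan L e" for v
            using homogeneous_mult[OF homogeneous_ksign homogeneous_Var, of v "{}" v]
            by (intro graded_submodule_mult[OF graded_submodule_hspan, of _ _ _ 1]) auto
          then have "(\<lambda>l. \<Sum>v\<in>UNIV. ksign v {} * Var v * g v l) \<in> hspan L e"
            by (intro graded_submodule_sum[OF graded_submodule_hspan])
          moreover have "a = (\<lambda>l. \<Sum>v\<in>UNIV. ksign v {} * Var v * g v l)"
            using ga by (simp add: fun_eq_iff mult.assoc)
          ultimately show "a \<in> hspan L e" by simp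
        qed
      qed
    qed (use Suc.IH in blast)
  qed
  have "D e \<subseteq> hspan L e" for e
    by (rule below[of e "nat (e - d0 + 1)"]) simp
  moreover have "\<forall>x\<in>set L. snd x \<in> D (fst x)" using G(1) by (auto simp: L_def)
  ultimately show ?thesis unfolding generates_def by blast
qed

text \<open>A shortest generating list is minimal: if the coefficient at \<open>k\<close> of a
  homogeneous syzygy has a constant term, homogeneity makes it a nonzero scalar, and generator
  \<open>k\<close> is a combination of the others.\<close>

lemma minimal_generators_exist:
  fixes D :: "int \<Rightarrow> ('v::finite, 'k::field) pvec set"
  assumes D: "graded_submodule D" and bdd: "koszul_bounded D B" and fr: "finite_rank D"
  shows "\<exists>L. generates L D \<and> minimal_gens L"
proof -
  obtain L0 where "generates L0 D" using finitely_generated[OF assms] by blast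
  then obtain L where L: "generates L D" and least: "\<And>L'. generates L' D \<Longrightarrow> length L \<le> length L'"
    using ex_has_least_nat[of "\<lambda>L. generates L D" L0 length] by blast
  have "minimal_gens L"
    unfolding minimal_gens_def
  proof (intro allI ballI impI, rule ccontr)
    fix e c k assume c: "c \<in> syz L e" and k: "k < length L" and nz: "Poly_Mapping.lookup (c k) 0 \<noteq> 0"
    define \<alpha> where "\<alpha> = Poly_Mapping.lookup (c k) 0"
    have hom: "homogeneous (e - fst (L ! k)) (c k)" using c k by (simp add: syz_def homogeneous_coeffs_def)
    then have e: "e = fst (L ! k)" using nz unfolding homogeneous_iff by (force simp: mon_deg_def)
    then have ck: "c k = Poly_Mapping.single 0 \<alpha>" using homogeneous_0_const[of "c k"] hom by (simp add: \<alpha>_def)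
    define L' where "L' = take k L @ drop (Suc k) L"
    have set_L': "L ! j \<in> set L'" if "j < length L" "j \<noteq> k" for j
    proof (cases "j < k")
      case True
      then have "take k L ! j = L ! j" "j < length (take k L)" using k by auto
      then have "L ! j \<in> set (take k L)" by (metis nth_mem)
      then show ?thesis by (simp add: L'_def)
    next
      case False
      then have "drop (Suc k) L ! (j - Suc k) = L ! j" "j - Suc k < length (drop (Suc k) L)" using that by auto
      then have "L ! j \<in> set (drop (Suc k) L)" by (metis nth_mem)
      then show ?thesis by (simp add: L'_def)
    qed
    define b where "b l = (\<Sum>j\<in>{..<length L} - {k}. c j * snd (L ! j) l)" for l
    have "(\<lambda>l. c j * snd (L ! j) l) \<in> hspan L' e" if "j \<in> {..<length L} - {k}" for j
    proof (rule graded_submodule_mult[OF graded_submodule_hspan, of _ _ _ "e - fst (L ! j)"])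
      show "snd (L ! j) \<in> hspan L' (e - (e - fst (L ! j)))" using gens_in_hspan[OF set_L'[of j]] that by simp
      show "homogeneous (e - fst (L ! j)) (c j)" using c that by (simp add: syz_def homogeneous_coeffs_def)
    qed
    then have "b \<in> hspan L' e" unfolding b_def[abs_def] by (intro graded_submodule_sum[OF graded_submodule_hspan])
    then have "(\<lambda>l. Poly_Mapping.single 0 (- inverse \<alpha>) * b l) \<in> hspan L' e"
      by (intro graded_submodule_mult[OF graded_submodule_hspan, of _ _ _ 0] homogeneous_const) simp
    moreover have "Poly_Mapping.single 0 (- inverse \<alpha>) * b l = snd (L ! k) l" for l
    proof -
      have "0 = c k * snd (L ! k) l + b l"
        using c k unfolding b_def by (simp add: syz_def lincomb_def sum.remove)
      then have "b l = - (c k * snd (L ! k) l)" by (simp add: eq_neg_iff_add_eq_0 add.commute)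
      then have "Poly_Mapping.single 0 (- inverse \<alpha>) * b l
         = (Poly_Mapping.single 0 (inverse \<alpha>) * Poly_Mapping.single 0 \<alpha>) * snd (L ! k) l"
        by (simp add: ck single_uminus mult.assoc)
      also have "\<dots> = snd (L ! k) l" using nz by (simp add: mult_single \<alpha>_def)
      finally show ?thesis .
    qed
    ultimately have gk: "snd (L ! k) \<in> hspan L' (fst (L ! k))" using e by simp
    have "snd x \<in> hspan L' (fst x)" if x: "x \<in> set L" for x
    proof -
      obtain j where "j < length L" "x = L ! j" using x by (auto simp: in_set_conv_nth)
      then show ?thesis using gk gens_in_hspan[OF set_L'[of j]] by (cases "j = k") auto
    qed
    then have "hspan L f \<subseteq> hspan L' f" for f by (rule hspan_subset[OF graded_submodule_hspan])
    moreover have "D f \<subseteq> hspan L f" for f using L by (simp add: generates_def)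
    ultimately have "D f \<subseteq> hspan L' f" for f by (meson subset_trans)
    moreover have "set L' \<subseteq> set L" by (auto simp: L'_def dest: in_set_takeD in_set_dropD)
    ultimately have "generates L' D" using L by (auto simp: generates_def)
    from least[OF this] show False using k by (simp add: L'_def)
  qed
  then show ?thesis using L by blast
qed

section \<open>Resolutions as sequences of syzygies\<close>

definition hcomp :: "int \<Rightarrow> ('v::finite, 'k::field) mpoly \<Rightarrow> ('v, 'k) mpoly" where
  "hcomp d p = Poly_Mapping.mapp (\<lambda>m c. if int (mon_deg m) = d then c else 0) p"

lemma lookup_hcomp:
  "Poly_Mapping.lookup (hcomp d p) m = (if int (mon_deg m) = d then Poly_Mapping.lookup p m else 0)"
  by (simp add: hcomp_def lookup_mapp when_def in_keys_iff)

lemma homogeneous_hcomp: "homogeneous d (hcomp d p)"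
  by (simp add: homogeneous_iff lookup_hcomp)

lemma hcomp_homogeneous: "homogeneous d p \<Longrightarrow> hcomp d p = p"
  by (rule poly_mapping_eqI) (auto simp: homogeneous_iff lookup_hcomp)

lemma hcomp_0 [simp]: "hcomp d 0 = 0"
  by (rule poly_mapping_eqI) (simp add: lookup_hcomp)

lemma hcomp_add: "hcomp d (p + q) = hcomp d p + hcomp d q"
  by (rule poly_mapping_eqI) (simp add: lookup_hcomp lookup_add)

lemma hcomp_sum: "hcomp d (sum f A) = (\<Sum>x\<in>A. hcomp d (f x))"
  by (induction A rule: infinite_finite_induct) (auto simp: hcomp_add)

lemma hcomp_mult:
  assumes g: "homogeneous e g"
  shows "hcomp d (p * g) = hcomp (d - e) p * g"
proof -
  define q where "q = p - hcomp (d - e) p"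
  have q: "int (mon_deg m) \<noteq> d - e" if "m \<in> Poly_Mapping.keys q" for m
    using that by (auto simp: q_def in_keys_iff lookup_minus lookup_hcomp)
  have "Poly_Mapping.lookup (hcomp d (q * g)) m = 0" for m
  proof (rule ccontr)
    assume "Poly_Mapping.lookup (hcomp d (q * g)) m \<noteq> 0"
    then have d: "int (mon_deg m) = d" and "m \<in> Poly_Mapping.keys (q * g)"
      by (auto simp: lookup_hcomp in_keys_iff split: if_splits)
    then obtain a b where "m = a + b" "a \<in> Poly_Mapping.keys q" "b \<in> Poly_Mapping.keys g"
      using keys_mult by blast
    moreover from this have "int (mon_deg b) = e" using g by (simp add: homogeneous_def)
    ultimately show False using q[of a] d by (simp add: mon_deg_add)
  qed
  then have "hcomp d (q * g) = 0" by (intro poly_mapping_eqI) simp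
  moreover have "homogeneous d (hcomp (d - e) p * g)"
    using homogeneous_mult[OF homogeneous_hcomp g, of "d - e" p] by simp
  moreover have "p * g = hcomp (d - e) p * g + q * g" by (simp add: q_def algebra_simps)
  ultimately show ?thesis by (simp add: hcomp_add hcomp_homogeneous)
qed

lemma sum_hcomp:
  assumes "finite A" "(\<lambda>m. int (mon_deg m)) ` Poly_Mapping.keys p \<subseteq> A"
  shows "(\<Sum>d\<in>A. hcomp d p) = p"
proof (rule poly_mapping_eqI)
  fix m
  have "Poly_Mapping.lookup (\<Sum>d\<in>A. hcomp d p) m
     = (\<Sum>d\<in>A. if int (mon_deg m) = d then Poly_Mapping.lookup p m else 0)"
    by (simp add: lookup_sum lookup_hcomp)
  also have "\<dots> = Poly_Mapping.lookup p m"
  proof (cases "m \<in> Poly_Mapping.keys p")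
    case True
    then have "int (mon_deg m) \<in> A" using assms(2) by blast
    then show ?thesis using assms(1) by simp
  next
    case False
    then have "Poly_Mapping.lookup p m = 0" by (simp add: in_keys_iff)
    then show ?thesis by simp
  qed
  finally show "Poly_Mapping.lookup (\<Sum>d\<in>A. hcomp d p) m = Poly_Mapping.lookup p m" .
qed

definition homog_gens :: "(nat \<Rightarrow> int) \<Rightarrow> ('v::finite, 'k::field) gens \<Rightarrow> bool" where
  "homog_gens \<delta> L \<longleftrightarrow> (\<forall>k<length L. \<forall>l. homogeneous (fst (L ! k) - \<delta> l) (snd (L ! k) l))"

lemma hcomp_lincomb:
  assumes "homog_gens \<delta> L"
  shows "hcomp (e - \<delta> l) (lincomb L c l) = lincomb L (\<lambda>k. hcomp (e - fst (L ! k)) (c k)) l"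
  unfolding lincomb_def hcomp_sum
proof (rule sum.cong)
  fix k assume "k \<in> {..<length L}"
  then have "homogeneous (fst (L ! k) - \<delta> l) (snd (L ! k) l)" using assms by (simp add: homog_gens_def)
  from hcomp_mult[OF this, of "e - \<delta> l" "c k"]
  show "hcomp (e - \<delta> l) (c k * snd (L ! k) l) = hcomp (e - fst (L ! k)) (c k) * snd (L ! k) l"
    by simp
qed simp

text \<open>Matrix kernels contain inhomogeneous vectors as well, whereas \<open>syz\<close>
  collects homogeneous ones. The lemmas below translate exactness from one setting to the
  other.\<close>

definition lker :: "('v::finite, 'k::field) gens \<Rightarrow> ('v, 'k) pvec set" where
  "lker L = {c. (\<forall>k\<ge>length L. c k = 0) \<and> (\<forall>l. lincomb L c l = 0)}"

lemma syz_subset_lker: "syz L e \<subseteq> lker L"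
  by (auto simp: syz_def lker_def)

lemma lincomb_lincomb:
  "lincomb L (lincomb L' b) l = (\<Sum>k<length L'. b k * lincomb L (snd (L' ! k)) l)"
proof -
  have "lincomb L (lincomb L' b) l = lincomb L (\<lambda>j. \<Sum>k<length L'. b k * snd (L' ! k) j) l"
    by (rule lincomb_cong) (simp add: lincomb_def)
  then show ?thesis by (simp add: lincomb_sum lincomb_mult)
qed

lemma range_lincomb_subset_lker:
  assumes "\<And>x. x \<in> set L' \<Longrightarrow> snd x \<in> lker L"
  shows "range (lincomb L') \<subseteq> lker L"
proof
  fix c assume "c \<in> range (lincomb L')"
  then obtain b where c: "c = lincomb L' b" by blast
  have L': "snd (L' ! k) \<in> lker L" if "k < length L'" for k using assms that by simp
  have "c k = 0" if "k \<ge> length L" for k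
    using L' that by (simp add: c lincomb_def lker_def)
  moreover have "lincomb L c l = 0" for l
    using L' by (simp add: c lincomb_lincomb lker_def)
  ultimately show "c \<in> lker L" by (simp add: lker_def)
qed

text \<open>The generators are homogeneous, so every homogeneous component of a kernel vector is
  itself a syzygy, and the vector is the finite sum of its components.\<close>

lemma lker_subset_range:
  fixes L L' :: "('v::finite, 'k::field) gens"
  assumes hom: "homog_gens \<delta> L" and gen: "\<And>e. syz L e \<subseteq> hspan L' e"
  shows "lker L \<subseteq> range (lincomb L')"
proof
  fix c assume c: "c \<in> lker L"
  \<comment> \<open>The total degrees in which \<open>c\<close> has a component; a monomial in
    coordinate \<open>k\<close> is shifted by the degree of generator \<open>k\<close>.\<close>
  define E where "E = (\<Union>k<length L. (\<lambda>m. int (mon_deg m) + fst (L ! k)) ` Poly_Mapping.keys (c k))"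
  have fin: "finite E" by (simp add: E_def)
  define h where "h e k = (if k < length L then hcomp (e - fst (L ! k)) (c k) else 0)" for e k
  have "h e \<in> syz L e" for e
  proof -
    have "lincomb L (h e) l = lincomb L (\<lambda>k. hcomp (e - fst (L ! k)) (c k)) l" for l
      by (rule lincomb_cong) (simp add: h_def)
    also have "\<dots> l = hcomp (e - \<delta> l) (lincomb L c l)" for l
      using hcomp_lincomb[OF hom] by simp
    finally have "lincomb L (h e) l = 0" for l using c by (simp add: lker_def)
    then show ?thesis by (simp add: syz_def homogeneous_coeffs_def h_def homogeneous_hcomp)
  qed
  then have "\<exists>b. h e = lincomb L' b" for e using gen[of e] unfolding hspan_def by blast
  then obtain b where b: "\<And>e. h e = lincomb L' (b e)" by metis
  have "c k = (\<Sum>e\<in>E. h e k)" for k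
  proof (cases "k < length L")
    case False
    then show ?thesis using c by (simp add: h_def lker_def)
  next
    case True
    have "(\<Sum>e\<in>E. h e k) = (\<Sum>e\<in>E. hcomp (e - fst (L ! k)) (c k))" using True by (simp add: h_def)
    also have "\<dots> = (\<Sum>d\<in>(\<lambda>e. e - fst (L ! k)) ` E. hcomp d (c k))"
      by (subst sum.reindex) (auto simp: inj_on_def)
    also have "\<dots> = c k"
    proof (rule sum_hcomp)
      show "(\<lambda>m. int (mon_deg m)) ` Poly_Mapping.keys (c k) \<subseteq> (\<lambda>e. e - fst (L ! k)) ` E"
      proof
        fix x assume "x \<in> (\<lambda>m. int (mon_deg m)) ` Poly_Mapping.keys (c k)"
        then have "x + fst (L ! k) \<in> E" using True by (auto simp: E_def)
        then show "x \<in> (\<lambda>e. e - fst (L ! k)) ` E" by (metis add_diff_cancel_right' image_eqI)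
      qed
    qed (use fin in simp)
    finally show ?thesis by simp
  qed
  then have "c = lincomb L' (\<lambda>k. \<Sum>e\<in>E. b e k)"
    by (auto simp: lincomb_sum b)
  then show "c \<in> range (lincomb L')" by blast
qed

text \<open>A homogeneous vector is not changed by passing to its component of its own degree, so
  arbitrary coefficients can be replaced by their components of the fitting degrees.\<close>

lemma syz_subset_hspan:
  assumes hom: "homog_gens (\<lambda>l. fst (L ! l)) L'" and ker: "lker L \<subseteq> range (lincomb L')"
  shows "syz L e \<subseteq> hspan L' e"
proof
  fix c assume c: "c \<in> syz L e"
  then obtain b where b: "c = lincomb L' b" using ker syz_subset_lker by blast
  have "c l = lincomb L' (\<lambda>k. hcomp (e - fst (L' ! k)) (b k)) l" for l
  proof -
    have "homogeneous (e - fst (L ! l)) (c l)"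
      using c by (cases "l < length L") (auto simp: syz_def homogeneous_coeffs_def)
    then have "c l = hcomp (e - fst (L ! l)) (lincomb L' b l)" by (simp add: b hcomp_homogeneous)
    then show ?thesis using hcomp_lincomb[OF hom] by simp
  qed
  then have "c = lincomb L' (\<lambda>k. hcomp (e - fst (L' ! k)) (b k))" by blast
  moreover have "homogeneous_coeffs e L' (\<lambda>k. hcomp (e - fst (L' ! k)) (b k))"
    by (simp add: homogeneous_coeffs_def homogeneous_hcomp)
  ultimately show "c \<in> hspan L' e" unfolding hspan_def by blast
qed

lemma homog_gens_syz:
  assumes "\<And>x. x \<in> set L' \<Longrightarrow> snd x \<in> syz L (fst x)"
  shows "homog_gens (\<lambda>l. fst (L ! l)) L'"
  unfolding homog_gens_def
proof (intro allI impI)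
  fix k l assume "k < length L'"
  then have "snd (L' ! k) \<in> syz L (fst (L' ! k))" using assms by simp
  then show "homogeneous (fst (L' ! k) - fst (L ! l)) (snd (L' ! k) l)"
    by (cases "l < length L") (auto simp: syz_def homogeneous_coeffs_def)
qed

section \<open>Matrices as lists of generators\<close>

definition mat_gens :: "('v::finite, 'k::field) mpoly mat \<Rightarrow> nat \<Rightarrow> ('v, 'k) gens \<Rightarrow> bool" where
  "mat_gens A n L \<longleftrightarrow> A \<in> carrier_mat n (length L) \<and>
     (\<forall>k<length L. \<forall>l. snd (L ! k) l = (if l < n then A $$ (l, k) else 0))"

lemma mult_mat_vec_gens:
  assumes "mat_gens A n L"
  shows "A *\<^sub>v vec (length L) c = vec n (lincomb L c)"
proof (rule eq_vecI)
  fix l assume l: "l < dim_vec (vec n (lincomb L c))"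
  have A: "A \<in> carrier_mat n (length L)" using assms by (simp add: mat_gens_def)
  then have "(A *\<^sub>v vec (length L) c) $ l = (\<Sum>k\<in>{0..<length L}. A $$ (l, k) * c k)"
    using l by (auto simp: scalar_prod_def intro!: sum.cong)
  also have "\<dots> = (\<Sum>k<length L. c k * snd (L ! k) l)"
    unfolding atLeast0LessThan using assms l by (intro sum.cong) (auto simp: mat_gens_def mult.commute)
  finally show "(A *\<^sub>v vec (length L) c) $ l = vec n (lincomb L c) $ l" using l by (simp add: lincomb_def)
qed (use assms in \<open>auto simp: mat_gens_def\<close>)

lemma lincomb_outside:
  assumes "mat_gens A n L" "l \<ge> n"
  shows "lincomb L c l = 0"
  using assms by (simp add: lincomb_def mat_gens_def)

lemma carrier_vec_image: "carrier_vec n = vec n ` {c. \<forall>k\<ge>n. c k = 0}"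
proof (intro equalityI subsetI)
  fix v :: "'a vec" assume v: "v \<in> carrier_vec n"
  then have "v = vec n (\<lambda>k. if k < n then v $ k else 0)" by (intro eq_vecI) auto
  then show "v \<in> vec n ` {c. \<forall>k\<ge>n. c k = 0}" by (intro image_eqI) auto
qed auto

lemma inj_on_vec: "inj_on (vec n) {c. \<forall>k\<ge>n. c k = 0}"
proof (rule inj_onI, rule ext)
  fix c d :: "nat \<Rightarrow> 'a" and k
  assume *: "c \<in> {c. \<forall>k\<ge>n. c k = 0}" "d \<in> {c. \<forall>k\<ge>n. c k = 0}" "vec n c = vec n d"
  show "c k = d k"
  proof (cases "k < n")
    case True
    then have "vec n c $ k = vec n d $ k" using * by simp
    then show ?thesis using True by simp
  qed (use * in auto)
qed

lemma range_lincomb_supported: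
  "range (lincomb L) = lincomb L ` {c. \<forall>k\<ge>length L. c k = 0}"
proof (intro equalityI subsetI)
  fix a assume "a \<in> range (lincomb L)"
  then obtain c where "a = lincomb L c" by blast
  then have "a = lincomb L (\<lambda>k. if k < length L then c k else 0)"
    by (auto simp: fun_eq_iff intro!: lincomb_cong)
  then show "a \<in> lincomb L ` {c. \<forall>k\<ge>length L. c k = 0}" by (intro image_eqI) auto
qed auto

lemma mat_image_gens:
  assumes "mat_gens A n L"
  shows "(\<lambda>b. A *\<^sub>v b) ` carrier_vec (length L) = vec n ` range (lincomb L)"
  unfolding carrier_vec_image range_lincomb_supported image_image
  by (simp add: mult_mat_vec_gens[OF assms])

lemma vec_eq_0_iff: "vec n c = 0\<^sub>v n \<longleftrightarrow> (\<forall>k<n. c k = 0)"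
  by (auto simp: vec_eq_iff)

lemma mat_kernel_gens:
  assumes A: "mat_gens A n L"
  shows "mat_kernel A = vec (length L) ` lker L"
proof -
  have "mat_kernel A = {v \<in> carrier_vec (length L). A *\<^sub>v v = 0\<^sub>v n}"
    using A mat_kernel[of A n "length L"] by (auto simp: mat_gens_def)
  also have "\<dots> = vec (length L) ` {c. (\<forall>k\<ge>length L. c k = 0) \<and> (\<forall>l<n. lincomb L c l = 0)}"
    unfolding carrier_vec_image by (auto simp: mult_mat_vec_gens[OF A] vec_eq_0_iff)
  also have "{c. (\<forall>k\<ge>length L. c k = 0) \<and> (\<forall>l<n. lincomb L c l = 0)} = lker L"
    unfolding lker_def using lincomb_outside[OF A] by (auto simp: not_less) (meson not_less)
  finally show ?thesis .
qed

lemma vec_image_eq_iff: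
  assumes "A \<subseteq> {c. \<forall>k\<ge>n. c k = 0}" "B \<subseteq> {c. \<forall>k\<ge>n. c k = 0}"
  shows "vec n ` A = vec n ` B \<longleftrightarrow> A = B"
  by (rule inj_on_image_eq_iff[OF inj_on_vec assms])

lemma lker_supported: "lker L \<subseteq> {c. \<forall>k\<ge>length L. c k = 0}"
  by (auto simp: lker_def)

text \<open>Vectors of length \<open>n\<close> correspond bijectively to sequences that vanish from
  \<open>n\<close> on, so the matrix equation and the sequence equation are images of each other
  under an injective map.\<close>

lemma exact_iff:
  assumes A: "mat_gens A n L" and A': "mat_gens A' (length L) L'"
  shows "mat_kernel A = (\<lambda>b. A' *\<^sub>v b) ` carrier_vec (length L') \<longleftrightarrow> lker L = range (lincomb L')"
  unfolding mat_kernel_gens[OF A] mat_image_gens[OF A']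
  using lincomb_outside[OF A'] by (intro vec_image_eq_iff lker_supported) auto

definition rank_one :: "('v::finite, 'k::field) mpoly \<Rightarrow> ('v, 'k) pvec" where
  "rank_one f l = (if l = 0 then f else 0)"

lemma exact_0_iff:
  assumes gens: "length gens = length L" "\<And>k. k < length L \<Longrightarrow> snd (L ! k) = rank_one (gens ! k)"
    and A': "mat_gens A' (length L) L'"
  shows "{a \<in> carrier_vec (length gens). (\<Sum>k<length gens. a $ k * gens ! k) = 0}
    = (\<lambda>b. A' *\<^sub>v b) ` carrier_vec (length L') \<longleftrightarrow> lker L = range (lincomb L')"
proof -
  have "lincomb L c l = (if l = 0 then \<Sum>k<length L. c k * gens ! k else 0)" for c l
    using gens by (simp add: lincomb_def rank_one_def)
  then have "lker L = {c. (\<forall>k\<ge>length L. c k = 0) \<and> (\<Sum>k<length L. c k * gens ! k) = 0}"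
    by (auto simp: lker_def)
  then have "vec (length L) ` lker L = {a \<in> carrier_vec (length gens). (\<Sum>k<length gens. a $ k * gens ! k) = 0}"
    unfolding carrier_vec_image gens(1) by auto
  then show ?thesis
    unfolding mat_image_gens[OF A'] using lincomb_outside[OF A']
    by (subst vec_image_eq_iff[OF lker_supported, of "range (lincomb L')", symmetric]) auto
qed

text \<open>A minimal graded free resolution, with the basis elements of each free module replaced by
  their degrees and their images in the previous one.\<close>

definition minimal_syzygies ::
  "(int \<Rightarrow> ('v::finite, 'k::field) pvec set) \<Rightarrow> (nat \<Rightarrow> ('v, 'k) gens) \<Rightarrow> bool" where
  "minimal_syzygies D L \<longleftrightarrow> generates (L 0) D \<and> (\<forall>i. generates (L (Suc i)) (syz (L i))) \<and>
     (\<forall>i. minimal_gens (L i))"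

section \<open>Degrees in a minimal resolution\<close>

lemma minimal_syzygies_koszul_bounded:
  assumes L: "minimal_syzygies D L" and D: "graded_submodule D" and bdd: "koszul_bounded D B"
  shows "koszul_bounded (syz (L i)) (B + 1 + int i)"
proof (induction i)
  case 0
  show ?case using L koszul_bounded_syz[OF D _ _ bdd] by (simp add: minimal_syzygies_def)
next
  case (Suc i)
  have "koszul_bounded (syz (L (Suc i))) (B + 1 + int i + 1)"
    using L koszul_bounded_syz[OF graded_submodule_syz _ _ Suc] by (simp add: minimal_syzygies_def)
  then show ?case by (simp add: algebra_simps)
qed

lemma minimal_syzygies_degree_le:
  assumes L: "minimal_syzygies D L" and D: "graded_submodule D" and bdd: "koszul_bounded D B"
    and k: "k < length (L i)"
  shows "fst (L i ! k) \<le> B + int i"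
proof (cases i)
  case 0
  then show ?thesis
    using L k minimal_gens_degree_le[OF _ _ bdd, of "L 0"] by (simp add: minimal_syzygies_def)
next
  case (Suc j)
  then have "fst (L i ! k) \<le> B + 1 + int j"
    using L k minimal_gens_degree_le[OF _ _ minimal_syzygies_koszul_bounded[OF L D bdd], of "L (Suc j)"]
    by (simp add: minimal_syzygies_def)
  then show ?thesis using Suc by simp
qed

text \<open>Every generator of a syzygy module is nonzero with coordinates free of constant terms,
  so its degree exceeds that of some generator one step earlier. The resulting lower bound on degree
  minus homological position makes the set of such differences finite.\<close>

lemma minimal_syzygies_degree_ge:
  assumes L: "minimal_syzygies D L"
  shows "\<exists>b. \<forall>i. \<forall>k<length (L i). b + int i \<le> fst (L i ! k)"
proof -
  define b where "b = Min (insert 0 ((\<lambda>k. fst (L 0 ! k)) ` {..<length (L 0)}))"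
  have "b + int i \<le> fst (L i ! k)" if "k < length (L i)" for i k
    using that
  proof (induction i arbitrary: k)
    case 0
    then show ?case unfolding b_def by (auto intro: Min_le)
  next
    case (Suc i)
    define x where "x = L (Suc i) ! k"
    have x: "snd x \<in> syz (L i) (fst x)"
      using L Suc.prems by (simp add: minimal_syzygies_def generates_def x_def)
    have "\<exists>l. snd x l \<noteq> 0"
    proof (rule ccontr)
      assume "\<nexists>l. snd x l \<noteq> 0"
      \<comment> \<open>A zero generator would have the unit vector as a syzygy, which minimality
        forbids.\<close>
      then have "(\<lambda>j. if j = k then 1 else 0) \<in> syz (L (Suc i)) (fst x)"
        using Suc.prems by (auto simp: syz_def homogeneous_coeffs_def x_def homogeneous_1 lincomb_unit)
      then show False
        using L Suc.prems unfolding minimal_syzygies_def minimal_gens_def by fastforce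
    qed
    then obtain l where l: "snd x l \<noteq> 0" by blast
    then have len: "l < length (L i)" using x by (auto simp: syz_def not_less[symmetric])
    have hom: "homogeneous (fst x - fst (L i ! l)) (snd x l)"
      using x len by (simp add: syz_def homogeneous_coeffs_def)
    obtain m where m: "Poly_Mapping.lookup (snd x l) m \<noteq> 0"
      using l by (metis lookup_zero poly_mapping_eqI)
    have "Poly_Mapping.lookup (snd x l) 0 = 0"
      using L x len unfolding minimal_syzygies_def minimal_gens_def by blast
    then have "m \<noteq> 0" using m by auto
    then have "int (mon_deg m) \<ge> 1" using mon_deg_eq_0_iff[of m] by linarith
    then have "fst x - fst (L i ! l) \<ge> 1" using hom m unfolding homogeneous_iff by metis
    then show ?case using Suc.IH[OF len] by (simp add: x_def)
  qed
  then show ?thesis by blast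
qed

text \<open>The Koszul bound has to be carried along in \<open>P\<close>, because it is what makes
  the next syzygy module finitely generated.\<close>

lemma minimal_syzygies_exist:
  fixes D :: "int \<Rightarrow> ('v::finite, 'k::field) pvec set"
  assumes D: "graded_submodule D" and bdd: "koszul_bounded D B" and fr: "finite_rank D"
  shows "\<exists>L. minimal_syzygies D L"
proof -
  define P where "P n L \<longleftrightarrow> minimal_gens L \<and> koszul_bounded (syz L) (B + 1 + int n) \<and> (n = 0 \<longrightarrow> generates L D)"
    for n and L :: "('v, 'k) gens"
  have "\<exists>L. P 0 L"
    using minimal_generators_exist[OF assms] koszul_bounded_syz[OF D _ _ bdd] unfolding P_def by auto
  moreover have "\<exists>L'. P (Suc n) L' \<and> generates L' (syz L)" if "P n L" for n L
  proof -
    have b: "koszul_bounded (syz L) (B + 1 + int n)" using that by (simp add: P_def)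
    obtain L' where "generates L' (syz L)" "minimal_gens L'"
      using minimal_generators_exist[OF graded_submodule_syz b finite_rank_syz] by blast
    moreover from this have "koszul_bounded (syz L') (B + 1 + int n + 1)"
      by (rule koszul_bounded_syz[OF graded_submodule_syz _ _ b])
    ultimately show ?thesis unfolding P_def by (auto simp: algebra_simps)
  qed
  ultimately obtain L where "\<And>n. P n (L n)" "\<And>n. generates (L (Suc n)) (syz (L n))"
    using dependent_nat_choice[of P "\<lambda>n L L'. generates L' (syz L)"] by metis
  then have "minimal_syzygies D L" unfolding minimal_syzygies_def P_def by blast
  then show ?thesis by blast
qed

section \<open>Squarefree powers of edge ideals\<close>

lemma module_times: "Modules.module ((*) :: 'a::comm_ring_1 \<Rightarrow> 'a \<Rightarrow> 'a)"
  by unfold_locales (simp_all add: algebra_simps)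

abbreviation is_ideal :: "'a::comm_ring_1 set \<Rightarrow> bool" where
  "is_ideal \<equiv> Modules.module.subspace (*)"

lemmas is_idealI = Modules.module.subspaceI[OF module_times]
lemmas is_ideal_0 = Modules.module.subspace_0[OF module_times]
lemmas is_ideal_add = Modules.module.subspace_add[OF module_times]
lemmas is_ideal_mult = Modules.module.subspace_scale[OF module_times]
lemmas is_ideal_sum = Modules.module.subspace_sum[OF module_times]

lemma ideal_gen_base: "a \<in> A \<Longrightarrow> a \<in> ideal_gen A"
  unfolding ideal_gen_def by (rule Modules.module.span_base[OF module_times])

lemma is_ideal_ideal_gen: "is_ideal (ideal_gen A)"
  unfolding ideal_gen_def by (rule Modules.module.subspace_span[OF module_times])

lemma ideal_gen_minimal: "A \<subseteq> I \<Longrightarrow> is_ideal I \<Longrightarrow> ideal_gen A \<subseteq> I"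
  unfolding ideal_gen_def by (rule Modules.module.span_minimal[OF module_times])

definition monomial_ideal :: "('v \<Rightarrow>\<^sub>0 nat) set \<Rightarrow> ('v, 'k::field) mpoly set" where
  "monomial_ideal N = {f. Poly_Mapping.keys f \<subseteq> N}"

lemma is_ideal_monomial_ideal:
  assumes up: "\<And>a c. a \<in> N \<Longrightarrow> a + c \<in> N"
  shows "is_ideal (monomial_ideal N :: ('v, 'k::field) mpoly set)"
proof (rule is_idealI)
  fix f g :: "('v, 'k) mpoly"
  assume "f \<in> monomial_ideal N" "g \<in> monomial_ideal N"
  then show "f + g \<in> monomial_ideal N" using keys_add[of f g] by (auto simp: monomial_ideal_def)
next
  fix c f :: "('v, 'k) mpoly"
  assume f: "f \<in> monomial_ideal N"
  show "c * f \<in> monomial_ideal N"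
    unfolding monomial_ideal_def
  proof (intro CollectI subsetI)
    fix m assume "m \<in> Poly_Mapping.keys (c * f)"
    then obtain a b where "m = a + b" "b \<in> Poly_Mapping.keys f" using keys_mult by blast
    then show "m \<in> N" using f up[of b a] by (auto simp: monomial_ideal_def add.commute)
  qed
qed (simp add: monomial_ideal_def)

lemma sum_monomials: "(\<Sum>m\<in>Poly_Mapping.keys f. Poly_Mapping.single m (Poly_Mapping.lookup f m)) = f"
proof (rule poly_mapping_eqI)
  fix m
  have "Poly_Mapping.lookup (\<Sum>a\<in>Poly_Mapping.keys f. Poly_Mapping.single a (Poly_Mapping.lookup f a)) m
     = (\<Sum>a\<in>Poly_Mapping.keys f. if a = m then Poly_Mapping.lookup f m else 0)"
    unfolding lookup_sum by (rule sum.cong) (auto simp: lookup_single when_def)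
  then show "Poly_Mapping.lookup (\<Sum>a\<in>Poly_Mapping.keys f. Poly_Mapping.single a (Poly_Mapping.lookup f a)) m
     = Poly_Mapping.lookup f m"
    by (simp add: in_keys_iff)
qed

lemma monomial_ideal_subset:
  assumes I: "is_ideal I" and N: "\<And>m. m \<in> N \<Longrightarrow> \<exists>a c. m = c + a \<and> Poly_Mapping.single a 1 \<in> I"
  shows "monomial_ideal N \<subseteq> (I :: ('v, 'k::field) mpoly set)"
proof
  fix f :: "('v, 'k) mpoly" assume f: "f \<in> monomial_ideal N"
  have "(\<Sum>m\<in>Poly_Mapping.keys f. Poly_Mapping.single m (Poly_Mapping.lookup f m)) \<in> I"
  proof (rule is_ideal_sum[OF I])
    fix m assume "m \<in> Poly_Mapping.keys f"
    then obtain a c where m: "m = c + a" and a: "Poly_Mapping.single a 1 \<in> I"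
      using f N unfolding monomial_ideal_def by blast
    have "Poly_Mapping.single m (Poly_Mapping.lookup f m)
       = Poly_Mapping.single c (Poly_Mapping.lookup f m) * Poly_Mapping.single a 1"
      by (simp add: m mult_single)
    then show "Poly_Mapping.single m (Poly_Mapping.lookup f m) \<in> I"
      using is_ideal_mult[OF I a] by simp
  qed
  then show "f \<in> I" by (simp add: sum_monomials)
qed

text \<open>This identifies minimality of a resolution, a condition on matrix entries, with the
  condition on constant terms in \<open>minimal_gens\<close>.\<close>

lemma irrelevant_ideal_iff:
  fixes p :: "('v::finite, 'k::field) mpoly"
  shows "p \<in> irrelevant_ideal \<longleftrightarrow> Poly_Mapping.lookup p 0 = 0"
proof -
  have "(irrelevant_ideal :: ('v, 'k) mpoly set) = monomial_ideal {m. m \<noteq> 0}"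
  proof (rule antisym)
    show "irrelevant_ideal \<subseteq> (monomial_ideal {m. m \<noteq> 0} :: ('v, 'k) mpoly set)"
      unfolding irrelevant_ideal_def
    proof (rule ideal_gen_minimal)
      have "Poly_Mapping.single v 1 \<noteq> (0 :: 'v \<Rightarrow>\<^sub>0 nat)" for v
        by (metis lookup_single_eq lookup_zero zero_neq_one)
      then show "range Var \<subseteq> (monomial_ideal {m. m \<noteq> 0} :: ('v, 'k) mpoly set)"
        by (auto simp: monomial_ideal_def Var_def)
      have "a + c \<noteq> 0" if "a \<noteq> 0" for a c :: "'v \<Rightarrow>\<^sub>0 nat"
        using that unfolding mon_deg_eq_0_iff[symmetric] by (simp add: mon_deg_add)
      then show "is_ideal (monomial_ideal {m. m \<noteq> 0} :: ('v, 'k) mpoly set)"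
        by (intro is_ideal_monomial_ideal) auto
    qed
    show "monomial_ideal {m. m \<noteq> 0} \<subseteq> (irrelevant_ideal :: ('v, 'k) mpoly set)"
    proof (rule monomial_ideal_subset)
      show "is_ideal (irrelevant_ideal :: ('v, 'k) mpoly set)"
        unfolding irrelevant_ideal_def by (rule is_ideal_ideal_gen)
      fix m :: "'v \<Rightarrow>\<^sub>0 nat" assume "m \<in> {m. m \<noteq> 0}"
      then have "Poly_Mapping.keys m \<noteq> {}" by simp
      then obtain v where v: "v \<in> Poly_Mapping.keys m" by blast
      have "m = (m - Poly_Mapping.single v 1) + Poly_Mapping.single v 1"
        using v by (intro poly_mapping_eqI) (auto simp: lookup_add lookup_minus lookup_single when_def in_keys_iff)
      moreover have "Poly_Mapping.single (Poly_Mapping.single v 1) 1 \<in> (irrelevant_ideal :: ('v, 'k) mpoly set)"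
        unfolding irrelevant_ideal_def by (rule ideal_gen_base) (auto simp: Var_def)
      ultimately show "\<exists>a c. m = c + a \<and> Poly_Mapping.single a 1 \<in> (irrelevant_ideal :: ('v, 'k) mpoly set)"
        by blast
    qed
  qed
  then have "p \<in> irrelevant_ideal \<longleftrightarrow> 0 \<notin> Poly_Mapping.keys p" by (auto simp: monomial_ideal_def)
  then show ?thesis by (simp add: in_keys_iff)
qed

lemma is_ideal_irrelevant: "is_ideal (irrelevant_ideal :: ('v::finite, 'k::field) mpoly set)"
  unfolding irrelevant_ideal_def by (rule is_ideal_ideal_gen)

section \<open>Ideals as graded modules of rank one\<close>

definition ideal_part :: "('v::finite, 'k::field) mpoly set \<Rightarrow> int \<Rightarrow> ('v, 'k) pvec set" where
  "ideal_part I e = rank_one ` {f \<in> I. homogeneous e f}"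

lemma rank_one_inject: "rank_one f = rank_one g \<longleftrightarrow> f = g"
  by (auto simp: rank_one_def fun_eq_iff dest: spec[of _ 0])

lemma rank_one_in_ideal_part: "rank_one f \<in> ideal_part I e \<longleftrightarrow> f \<in> I \<and> homogeneous e f"
  by (auto simp: ideal_part_def rank_one_inject)

lemma graded_submodule_ideal_part:
  assumes I: "is_ideal I"
  shows "graded_submodule (ideal_part I :: int \<Rightarrow> ('v::finite, 'k::field) pvec set)"
  unfolding graded_submodule_def
proof (intro conjI allI ballI impI)
  fix e
  have "(\<lambda>_. 0) = (rank_one 0 :: ('v, 'k) pvec)" by (auto simp: rank_one_def)
  then show "(\<lambda>_. 0) \<in> ideal_part I e" using is_ideal_0[OF I] by (simp add: rank_one_in_ideal_part)
next
  fix e and a b :: "('v, 'k) pvec" assume "a \<in> ideal_part I e" "b \<in> ideal_part I e"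
  then obtain f g where "a = rank_one f" "b = rank_one g" and fg: "f \<in> I" "g \<in> I" "homogeneous e f" "homogeneous e g"
    unfolding ideal_part_def by blast
  then have "(\<lambda>l. a l + b l) = rank_one (f + g)" by (auto simp: rank_one_def)
  then show "(\<lambda>l. a l + b l) \<in> ideal_part I e"
    using fg is_ideal_add[OF I] homogeneous_add by (simp add: rank_one_in_ideal_part)
next
  fix d e and p :: "('v, 'k) mpoly" and a assume "a \<in> ideal_part I e" and p: "homogeneous d p"
  then obtain f where "a = rank_one f" and f: "f \<in> I" "homogeneous e f"
    unfolding ideal_part_def by blast
  then have "(\<lambda>l. p * a l) = rank_one (p * f)" by (auto simp: rank_one_def)
  then show "(\<lambda>l. p * a l) \<in> ideal_part I (d + e)"
    using f p is_ideal_mult[OF I] homogeneous_mult by (simp add: rank_one_in_ideal_part)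
qed

lemma finite_rank_ideal_part: "finite_rank (ideal_part I)"
  unfolding finite_rank_def
  by (intro exI[of _ 1] exI[of _ "\<lambda>_. 0"]) (auto simp: ideal_part_def rank_one_def)

lemma span_list:
  fixes gs :: "'a::comm_ring_1 list"
  assumes "f \<in> Modules.module.span (*) (set gs)"
  obtains b where "f = (\<Sum>k<length gs. b k * gs ! k)"
proof -
  let ?S = "range (\<lambda>b. \<Sum>k<length gs. b k * gs ! k)"
  have "ideal_gen (set gs) \<subseteq> ?S"
  proof (rule ideal_gen_minimal)
    show "set gs \<subseteq> ?S"
    proof
      fix g assume "g \<in> set gs"
      then obtain j where j: "j < length gs" "gs ! j = g" by (auto simp: in_set_conv_nth)
      have "(\<Sum>k<length gs. (if k = j then 1 else 0) * gs ! k) = (\<Sum>k<length gs. if k = j then g else 0)"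
        using j by (intro sum.cong) auto
      then have "g = (\<Sum>k<length gs. (if k = j then 1 else 0) * gs ! k)" using j by simp
      then show "g \<in> ?S" by (rule range_eqI[of _ _ "\<lambda>k. if k = j then 1 else 0"])
    qed
    show "is_ideal ?S"
    proof (rule is_idealI)
      show "0 \<in> ?S" by (rule range_eqI[of _ _ "\<lambda>_. 0"]) simp
    next
      fix x y assume "x \<in> ?S" "y \<in> ?S"
      then obtain b c where "x = (\<Sum>k<length gs. b k * gs ! k)" "y = (\<Sum>k<length gs. c k * gs ! k)" by blast
      then have "x + y = (\<Sum>k<length gs. (b k + c k) * gs ! k)" by (simp add: distrib_right sum.distrib)
      then show "x + y \<in> ?S" by (rule range_eqI[of _ _ "\<lambda>k. b k + c k"])
    next
      fix p x assume "x \<in> ?S"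
      then obtain b where "x = (\<Sum>k<length gs. b k * gs ! k)" by blast
      then have "p * x = (\<Sum>k<length gs. (p * b k) * gs ! k)" by (simp add: sum_distrib_left mult.assoc)
      then show "p * x \<in> ?S" by (rule range_eqI[of _ _ "\<lambda>k. p * b k"])
    qed
  qed
  then show thesis using assms that unfolding ideal_gen_def by blast
qed

text \<open>The Betti numbers belong to a resolution picked by \<open>SOME\<close>, so the degree
  bounds must reach an arbitrary minimal resolution. The columns of its matrices serve as the
  generators.\<close>

lemma syzygies_of_resolution:
  fixes I :: "('v::finite, 'k::field) mpoly set"
  assumes "minimal_graded_free_resolution (*) (\<lambda>j. {f \<in> I. homogeneous j f}) degs gens diff"
  shows "\<exists>L. minimal_syzygies (ideal_part I) L \<and> (\<forall>i. map fst (L i) = degs i)"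
proof -
  let ?D = "\<lambda>j. {f \<in> I. homogeneous j f}"
  note res = assms[unfolded minimal_graded_free_resolution_def graded_free_resolution_def]
  note irr = res[THEN conjunct2, rule_format]
  note r1 = res[THEN conjunct1]
  note len = r1[THEN conjunct1]
  note r2 = r1[THEN conjunct2]
  note gens = r2[THEN conjunct1, rule_format]
  note r3 = r2[THEN conjunct2]
  note carr = r3[THEN conjunct1, rule_format]
  note r4 = r3[THEN conjunct2]
  note hom = r4[THEN conjunct1, rule_format]
  note r5 = r4[THEN conjunct2]
  note exM = r5[THEN conjunct1]
  note r6 = r5[THEN conjunct2]
  note ex0 = r6[THEN conjunct1]
  note exS = r6[THEN conjunct2, rule_format]
  define L :: "nat \<Rightarrow> ('v, 'k) gens" where
    "L i = (case i of 0 \<Rightarrow> map (\<lambda>k. (degs 0 ! k, rank_one (gens ! k))) [0..<length (degs 0)]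
      | Suc j \<Rightarrow> map (\<lambda>k. (degs (Suc j) ! k, \<lambda>l. if l < length (degs j) then diff j $$ (l, k) else 0))
          [0..<length (degs (Suc j))])" for i
  have Llen: "length (L i) = length (degs i)" for i by (simp add: L_def split: nat.split)
  have Lfst: "fst (L i ! k) = degs i ! k" if "k < length (degs i)" for i k
    using that by (cases i) (simp_all add: L_def)
  have L0: "snd (L 0 ! k) = rank_one (gens ! k)" if "k < length (L 0)" for k
    using that by (simp add: L_def)
  have Lmat: "mat_gens (diff i) (length (L i)) (L (Suc i))" for i
    using carr[of i] unfolding mat_gens_def Llen by (auto simp: L_def)
  have "lker (L 0) = range (lincomb (L 1))"
    using exact_0_iff[OF _ L0 Lmat[of 0]] ex0 Llen len by simp
  moreover have "lker (L (Suc i)) = range (lincomb (L (Suc (Suc i))))" for i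
    using exact_iff[OF Lmat[of i] Lmat[of "Suc i"]] exS[of i] Llen by simp
  ultimately have ex: "lker (L i) = range (lincomb (L (Suc i)))" for i by (cases i) auto
  have homL: "homog_gens (\<lambda>l. fst (L i ! l)) (L (Suc i))" for i
    unfolding homog_gens_def
  proof (intro allI impI)
    fix k l assume k: "k < length (L (Suc i))"
    show "homogeneous (fst (L (Suc i) ! k) - fst (L i ! l)) (snd (L (Suc i) ! k) l)"
      using k Lmat[of i] hom[of l i k] Lfst[of k "Suc i"] Lfst[of l i]
      by (cases "l < length (L i)") (simp_all add: mat_gens_def Llen)
  qed
  have gen: "generates (L (Suc i)) (syz (L i))" for i
    unfolding generates_def
  proof (intro conjI ballI allI)
    show "syz (L i) e \<subseteq> hspan (L (Suc i)) e" for e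
      by (rule syz_subset_hspan[OF homL]) (simp add: ex)
    fix x assume "x \<in> set (L (Suc i))"
    then obtain k where k: "k < length (L (Suc i))" "x = L (Suc i) ! k" by (auto simp: in_set_conv_nth)
    have "snd x = lincomb (L (Suc i)) (\<lambda>j. if j = k then 1 else 0)" using k by (auto simp: lincomb_unit)
    then have "snd x \<in> lker (L i)" unfolding ex by blast
    then show "snd x \<in> syz (L i) (fst x)"
      using homL[of i] k by (auto simp: lker_def syz_def homogeneous_coeffs_def homog_gens_def)
  qed
  \<comment> \<open>By exactness a syzygy of \<open>L i\<close> is a combination of the columns of
    \<open>diff i\<close>, whose entries lie in the irrelevant ideal.\<close>
  have min: "minimal_gens (L i)" for i
    unfolding minimal_gens_def
  proof (intro allI ballI impI)
    fix e c k assume c: "c \<in> syz (L i) e" and k: "k < length (L i)"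
    obtain b where b: "c = lincomb (L (Suc i)) b" using c syz_subset_lker ex by blast
    have "(\<Sum>j<length (L (Suc i)). b j * snd (L (Suc i) ! j) k) \<in> irrelevant_ideal"
    proof (intro is_ideal_sum[OF is_ideal_irrelevant] is_ideal_mult[OF is_ideal_irrelevant])
      fix j assume j: "j \<in> {..<length (L (Suc i))}"
      then have "diff i $$ (k, j) \<in> elements_mat (diff i)"
        using carr[of i] k by (intro elements_matI[OF carr[of i]]) (auto simp: Llen)
      then show "snd (L (Suc i) ! j) k \<in> irrelevant_ideal"
        using irr j k Lmat[of i] by (auto simp: mat_gens_def)
    qed
    then show "Poly_Mapping.lookup (c k) 0 = 0" by (simp add: b lincomb_def irrelevant_ideal_iff)
  qed
  have hom0: "homog_gens (\<lambda>_. 0) (L 0)"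
    unfolding homog_gens_def using gens L0 Lfst[of _ 0] len by (auto simp: rank_one_def Llen)
  have "generates (L 0) (ideal_part I)"
    unfolding generates_def
  proof (intro conjI ballI allI)
    fix x assume "x \<in> set (L 0)"
    then obtain k where k: "k < length (L 0)" "x = L 0 ! k" by (auto simp: in_set_conv_nth)
    then show "snd x \<in> ideal_part I (fst x)"
      using L0 Lfst[of k 0] gens[of k] len by (simp add: Llen rank_one_in_ideal_part)
  next
    fix e
    show "ideal_part I e \<subseteq> hspan (L 0) e"
    proof
      fix a assume "a \<in> ideal_part I e"
      then obtain f where f: "a = rank_one f" "f \<in> I" "homogeneous e f" unfolding ideal_part_def by blast
      have "f \<in> Modules.module.span (*) (set gens)"
        unfolding exM by (rule Modules.module.span_base[OF module_times]) (use f in auto)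
      then obtain b where b: "f = (\<Sum>k<length gens. b k * gens ! k)" by (rule span_list)
      \<comment> \<open>The coefficients from the span may be inhomogeneous; their components of the
        right degrees give the same \<open>f\<close>.\<close>
      define b' where "b' k = hcomp (e - fst (L 0 ! k)) (b k)" for k
      have "a l = lincomb (L 0) b' l" for l
      proof -
        have "lincomb (L 0) b l = a l"
          using len L0 by (simp add: lincomb_def f(1) b rank_one_def Llen)
        moreover have "homogeneous e (a l)" using f by (simp add: rank_one_def)
        ultimately show ?thesis
          using hcomp_lincomb[OF hom0, of e b l] by (simp add: hcomp_homogeneous b'_def[abs_def])
      qed
      moreover have "homogeneous_coeffs e (L 0) b'"
        by (simp add: homogeneous_coeffs_def b'_def homogeneous_hcomp)
      ultimately show "a \<in> hspan (L 0) e" unfolding hspan_def by blast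
    qed
  qed
  then have "minimal_syzygies (ideal_part I) L" using gen min by (simp add: minimal_syzygies_def)
  moreover have "map fst (L i) = degs i" for i
    by (rule nth_equalityI) (simp_all add: Llen Lfst)
  ultimately show ?thesis by blast
qed

text \<open>Supplies the existence that gives the choice in \<open>minimal_degrees\<close> its
  meaning.\<close>

lemma resolution_of_syzygies:
  fixes I :: "('v::finite, 'k::field) mpoly set"
  assumes L: "minimal_syzygies (ideal_part I) L"
  shows "\<exists>degs gens diff. minimal_graded_free_resolution (*) (\<lambda>j. {f \<in> I. homogeneous j f}) degs gens diff"
proof -
  let ?D = "\<lambda>j. {f \<in> I. homogeneous j f}"
  define degs where "degs i = map fst (L i)" for i
  define gens where "gens = map (\<lambda>x. snd x 0) (L 0)"
  define diff where "diff i = mat (length (L i)) (length (L (Suc i))) (\<lambda>(l, k). snd (L (Suc i) ! k) l)" for i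
  have gen0: "generates (L 0) (ideal_part I)" and gen: "\<And>i. generates (L (Suc i)) (syz (L i))"
    and min: "\<And>i. minimal_gens (L i)" using L by (auto simp: minimal_syzygies_def)
  have D0: "snd (L 0 ! k) = rank_one (gens ! k) \<and> gens ! k \<in> ?D (fst (L 0 ! k))" if "k < length (L 0)" for k
  proof -
    have "snd (L 0 ! k) \<in> ideal_part I (fst (L 0 ! k))" using gen0 that by (simp add: generates_def)
    then show ?thesis using that by (auto simp: ideal_part_def gens_def rank_one_def)
  qed
  have S: "snd (L (Suc i) ! k) \<in> syz (L i) (fst (L (Suc i) ! k))" if "k < length (L (Suc i))" for i k
    using gen that by (simp add: generates_def)
  have Lmat: "mat_gens (diff i) (length (L i)) (L (Suc i))" for i
    using S by (auto simp: mat_gens_def diff_def syz_def)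
  have hom0: "homog_gens (\<lambda>_. 0) (L 0)"
    unfolding homog_gens_def using D0 by (auto simp: rank_one_def)
  have hom: "homog_gens (\<lambda>l. fst (L i ! l)) (L (Suc i))" for i
    by (rule homog_gens_syz) (use gen in \<open>simp add: generates_def\<close>)
  have "\<exists>\<delta>. homog_gens \<delta> (L i)" for i using hom0 hom by (cases i) blast+
  then have "lker (L i) \<subseteq> range (lincomb (L (Suc i)))" for i
    using lker_subset_range gen[of i] unfolding generates_def by metis
  moreover have "range (lincomb (L (Suc i))) \<subseteq> lker (L i)" for i
  proof (rule range_lincomb_subset_lker)
    fix x assume "x \<in> set (L (Suc i))"
    then have "snd x \<in> syz (L i) (fst x)" using gen[of i] by (simp add: generates_def)
    then show "snd x \<in> lker (L i)" using syz_subset_lker by blast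
  qed
  ultimately have ex: "lker (L i) = range (lincomb (L (Suc i)))" for i by (rule antisym)
  have "graded_free_resolution (*) ?D degs gens diff"
    unfolding graded_free_resolution_def
  proof (intro conjI allI impI)
    show "length gens = length (degs 0)" by (simp add: gens_def degs_def)
    show "gens ! k \<in> ?D (degs 0 ! k)" if "k < length gens" for k
      using that D0[of k] by (simp add: gens_def degs_def)
    show "diff i \<in> carrier_mat (length (degs i)) (length (degs (Suc i)))" for i
      by (simp add: diff_def degs_def)
    show "homogeneous (degs (Suc i) ! k - degs i ! l) (diff i $$ (l, k))"
      if "l < length (degs i)" "k < length (degs (Suc i))" for i l k
      using that hom[of i] by (simp add: diff_def degs_def homog_gens_def)
    show "{a \<in> carrier_vec (length gens). (\<Sum>k<length gens. a $ k * gens ! k) = 0}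
       = (\<lambda>b. diff 0 *\<^sub>v b) ` carrier_vec (length (degs 1))"
    proof -
      have "length gens = length (L 0)" by (simp add: gens_def)
      from exact_0_iff[OF this _ Lmat[of 0]] show ?thesis using D0 ex[of 0] by (simp add: degs_def)
    qed
    show "mat_kernel (diff i) = (\<lambda>b. diff (Suc i) *\<^sub>v b) ` carrier_vec (length (degs (Suc (Suc i))))" for i
      using exact_iff[OF Lmat[of i] Lmat[of "Suc i"]] ex[of "Suc i"] by (simp add: degs_def)
    show "Modules.module.span (*) (set gens) = Modules.module.span (*) (\<Union>j. ?D j)"
      unfolding ideal_gen_def[symmetric]
    proof (rule antisym)
      have "set gens \<subseteq> (\<Union>j. ?D j)"
      proof
        fix g assume "g \<in> set gens"
        then obtain k where "k < length (L 0)" "g = gens ! k"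
          by (auto simp: in_set_conv_nth gens_def)
        then show "g \<in> (\<Union>j. ?D j)" using D0[of k] by blast
      qed
      then show "ideal_gen (set gens) \<subseteq> ideal_gen (\<Union>j. ?D j)"
        by (intro ideal_gen_minimal is_ideal_ideal_gen) (auto intro: ideal_gen_base)
      show "ideal_gen (\<Union>j. ?D j) \<subseteq> ideal_gen (set gens)"
      proof (rule ideal_gen_minimal[OF _ is_ideal_ideal_gen], rule subsetI)
        fix f assume "f \<in> (\<Union>j. ?D j)"
        then obtain j where "rank_one f \<in> ideal_part I j" by (auto simp: rank_one_in_ideal_part)
        then obtain c where "rank_one f = lincomb (L 0) c"
          using gen0 unfolding generates_def hspan_def by blast
        then have "f = lincomb (L 0) c 0" by (metis rank_one_def)
        also have "\<dots> = (\<Sum>k<length (L 0). c k * gens ! k)"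
          using D0 by (simp add: lincomb_def rank_one_def)
        also have "\<dots> \<in> ideal_gen (set gens)"
          by (intro is_ideal_sum[OF is_ideal_ideal_gen] is_ideal_mult[OF is_ideal_ideal_gen] ideal_gen_base)
            (simp add: gens_def)
        finally show "f \<in> ideal_gen (set gens)" .
      qed
    qed
  qed
  moreover have "elements_mat (diff i) \<subseteq> irrelevant_ideal" for i
  proof
    fix p assume "p \<in> elements_mat (diff i)"
    then obtain l k where lk: "l < length (L i)" "k < length (L (Suc i))" "p = diff i $$ (l, k)"
      using elements_matD[of p "diff i"] by (auto simp: diff_def)
    then have "Poly_Mapping.lookup p 0 = 0"
      using S[of k i] min[of i] unfolding minimal_gens_def by (auto simp: diff_def)
    then show "p \<in> irrelevant_ideal" by (simp add: irrelevant_ideal_iff)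
  qed
  ultimately show ?thesis unfolding minimal_graded_free_resolution_def by blast
qed

text \<open>A \<open>Max\<close> is bounded by its members only over a finite nonempty set.
  Finiteness comes from the bounds on both sides, nonemptiness from \<open>f\<close>, which forces
  at least one generator.\<close>

theorem reg_ideal_le:
  fixes I :: "('v::finite, 'k::field) mpoly set"
  assumes I: "is_ideal I" and bdd: "koszul_bounded (ideal_part I) B"
    and f: "f \<in> I" "homogeneous d f" "f \<noteq> 0"
  shows "reg_ideal I \<le> B"
proof -
  let ?D = "\<lambda>j. {f \<in> I. homogeneous j f}"
  have D: "graded_submodule (ideal_part I)" by (rule graded_submodule_ideal_part[OF I])
  have "\<exists>degs gens diff. minimal_graded_free_resolution (*) ?D degs gens diff"
    using minimal_syzygies_exist[OF D bdd finite_rank_ideal_part] resolution_of_syzygies by blast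
  then have "\<exists>gens diff. minimal_graded_free_resolution (*) ?D (minimal_degrees (*) ?D) gens diff"
    unfolding minimal_degrees_def by (rule someI_ex)
  then obtain gens diff
    where "minimal_graded_free_resolution (*) ?D (minimal_degrees (*) ?D) gens diff" by blast
  from syzygies_of_resolution[OF this] obtain L where L: "minimal_syzygies (ideal_part I) L"
    and map: "\<forall>i. map fst (L i) = minimal_degrees (*) ?D i" by blast
  have deg: "minimal_degrees (*) ?D i = map fst (L i)" for i using map by simp
  obtain b where b: "\<And>i k. k < length (L i) \<Longrightarrow> b + int i \<le> fst (L i ! k)"
    using minimal_syzygies_degree_ge[OF L] by blast
  define S where "S = {j - int i | i j. graded_betti (*) ?D i j \<noteq> 0}"
  have S: "S = {j - int i | i j. j \<in> set (map fst (L i))}"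
    by (simp add: S_def graded_betti_def deg count_list_0_iff)
  have bounds: "b \<le> x \<and> x \<le> B" if x: "x \<in> S" for x
  proof -
    obtain i k where "k < length (L i)" "x = fst (L i ! k) - int i"
      using x unfolding S by (auto simp: in_set_conv_nth)
    then show ?thesis using b[of k i] minimal_syzygies_degree_le[OF L D bdd, of k i] by simp
  qed
  then have "finite S" by (intro finite_subset[of S "{b..B}"]) auto
  moreover have "S \<noteq> {}"
  proof -
    have "L 0 \<noteq> []"
    proof
      assume "L 0 = []"
      have "ideal_part I d \<subseteq> hspan (L 0) d" using L by (simp add: minimal_syzygies_def generates_def)
      moreover have "rank_one f \<in> ideal_part I d" using f by (simp add: rank_one_in_ideal_part)
      ultimately have "rank_one f \<in> hspan (L 0) d" by blast
      then have "rank_one f 0 = 0" using \<open>L 0 = []\<close> by (auto simp: hspan_def lincomb_def)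
      then show False using f by (simp add: rank_one_def)
    qed
    then have "fst (hd (L 0)) - int 0 \<in> S" unfolding S by (intro CollectI exI[of _ 0] exI[of _ "fst (hd (L 0))"]) simp
    then show ?thesis by blast
  qed
  ultimately have "Max S \<le> B" using bounds by simp
  then show ?thesis by (simp add: reg_ideal_def regularity_def S_def)
qed

section \<open>Monomials in powers of the edge ideal\<close>

primrec edge_multiple :: "'v set set \<Rightarrow> nat \<Rightarrow> ('v \<Rightarrow>\<^sub>0 nat) \<Rightarrow> bool" where
  "edge_multiple E 0 m \<longleftrightarrow> True"
| "edge_multiple E (Suc s) m \<longleftrightarrow> (\<exists>u v m'. {u, v} \<in> E \<and>
     m = Poly_Mapping.single u 1 + Poly_Mapping.single v 1 + m' \<and> edge_multiple E s m')"

lemma edge_multiple_SucI: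
  assumes "{u, v} \<in> E" "edge_multiple E s m'"
    "m = Poly_Mapping.single u 1 + Poly_Mapping.single v 1 + m'"
  shows "edge_multiple E (Suc s) m"
  unfolding edge_multiple.simps using assms by blast

lemma edge_multiple_add: "edge_multiple E s m \<Longrightarrow> edge_multiple E s (m + c)"
proof (induction s arbitrary: m)
  case (Suc s)
  then obtain u v m' where "{u, v} \<in> E" "m = Poly_Mapping.single u 1 + Poly_Mapping.single v 1 + m'"
    "edge_multiple E s m'" by auto
  then show ?case
    using Suc.IH[of m'] by (intro edge_multiple_SucI[of u v E s "m' + c"]) (simp_all add: add.assoc)
qed simp

lemma edge_ideal_subset: "edge_ideal E \<subseteq> monomial_ideal (Collect (edge_multiple E 1))"
  unfolding edge_ideal_def
proof (rule ideal_gen_minimal)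
  show "is_ideal (monomial_ideal (Collect (edge_multiple E 1)))"
    by (rule is_ideal_monomial_ideal) (metis edge_multiple_add mem_Collect_eq)
  have "edge_multiple E 1 (Poly_Mapping.single u 1 + Poly_Mapping.single v 1)" if "{u, v} \<in> E" for u v
    using edge_multiple_SucI[OF that, of 0 0] by simp
  then show "{Var u * Var v |u v. {u, v} \<in> E} \<subseteq> monomial_ideal (Collect (edge_multiple E 1))"
    by (auto simp: monomial_ideal_def Var_def mult_single)
qed

lemma prod_edge_ideal:
  assumes "set fs \<subseteq> edge_ideal E"
  shows "prod_list fs \<in> (monomial_ideal (Collect (edge_multiple E (length fs))) :: ('v, 'k::field) mpoly set)"
  using assms
proof (induction fs)
  case (Cons f fs)
  have f: "Poly_Mapping.keys f \<subseteq> Collect (edge_multiple E 1)"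
    using Cons.prems edge_ideal_subset[of E] by (auto simp: monomial_ideal_def)
  have fs: "Poly_Mapping.keys (prod_list fs) \<subseteq> Collect (edge_multiple E (length fs))"
    using Cons by (auto simp: monomial_ideal_def)
  have "edge_multiple E (Suc (length fs)) m" if "m \<in> Poly_Mapping.keys (f * prod_list fs)" for m
  proof -
    obtain a b where m: "m = a + b" and a: "edge_multiple E 1 a" and b: "edge_multiple E (length fs) b"
      using keys_mult[of f "prod_list fs"] \<open>m \<in> _\<close> f fs by blast
    obtain u v a' where "{u, v} \<in> E" "a = Poly_Mapping.single u 1 + Poly_Mapping.single v 1 + a'"
      using a by auto
    then show ?thesis
      using edge_multiple_add[OF b, of a'] by (intro edge_multiple_SucI[of u v E _ "b + a'"]) (simp_all add: m ac_simps)
  qed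
  then show ?case by (auto simp: monomial_ideal_def)
qed (simp add: monomial_ideal_def)

text \<open>Products in an ordinary power may repeat edges or let them overlap, as
  \<open>edge_multiple\<close> allows. Any overlap, and also an edge with equal ends, would give an
  exponent of at least 2.\<close>

lemma has_match_squarefree:
  fixes m :: "'v::finite \<Rightarrow>\<^sub>0 nat"
  assumes "edge_multiple E s m" "\<And>v. Poly_Mapping.lookup m v \<le> 1"
  shows "has_match E s (Poly_Mapping.keys m)"
  using assms
proof (induction s arbitrary: m)
  case 0
  then show ?case by (auto simp: has_match_def intro: matchable.empty)
next
  case (Suc s)
  then obtain u v m' where uv: "{u, v} \<in> E" and m: "m = Poly_Mapping.single u 1 + Poly_Mapping.single v 1 + m'"
    and m': "edge_multiple E s m'" by auto
  have look: "Poly_Mapping.lookup m w = (if u = w then 1 else 0) + (if v = w then 1 else 0) + Poly_Mapping.lookup m' w" for w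
    by (simp add: m lookup_add lookup_single when_def)
  have "u \<noteq> v" using Suc.prems(2)[of u] look[of u] by auto
  moreover have n: "u \<notin> Poly_Mapping.keys m'" "v \<notin> Poly_Mapping.keys m'"
    using Suc.prems(2)[of u] look[of u] Suc.prems(2)[of v] look[of v] by (auto simp: in_keys_iff)
  moreover have "Poly_Mapping.lookup m' w \<le> 1" for w
    using Suc.prems(2)[of w] look[of w] by linarith
  then obtain B where B: "B \<subseteq> Poly_Mapping.keys m'" "matchable E B" "card B = 2 * s"
    using Suc.IH[OF m'] unfolding has_match_def by blast
  moreover from B n have "u \<notin> B" "v \<notin> B" by auto
  ultimately have "matchable E (insert u (insert v B))" "card (insert u (insert v B)) = 2 * Suc s"
    using uv by (auto intro: matchable.add_edge)
  moreover have "insert u (insert v B) \<subseteq> Poly_Mapping.keys m"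
    using B(1) by (auto simp: in_keys_iff look subset_iff)
  ultimately show ?case unfolding has_match_def by blast
qed

lemma matchable_monomial:
  fixes B :: "'v::finite set"
  assumes "matchable E B"
  shows "\<exists>fs. 2 * length fs = card B \<and> set fs \<subseteq> edge_ideal E \<and>
    prod_list fs = (Poly_Mapping.single (ind B) 1 :: ('v, 'k::field) mpoly)"
  using assms
proof (induction rule: matchable.induct)
  case empty
  have "ind {} = (0 :: 'v \<Rightarrow>\<^sub>0 nat)" by (rule poly_mapping_eqI) (simp add: lookup_ind)
  then show ?case by (intro exI[of _ "[]"]) simp
next
  case (add_edge B u v)
  then obtain fs where fs: "2 * length fs = card B" "set fs \<subseteq> edge_ideal E"
    "prod_list fs = (Poly_Mapping.single (ind B) 1 :: ('v, 'k) mpoly)" by blast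
  have "Poly_Mapping.single u 1 + Poly_Mapping.single v 1 + ind B = ind (insert u (insert v B))"
    using add_edge by (intro poly_mapping_eqI) (auto simp: lookup_add lookup_ind lookup_single when_def)
  then have "prod_list (Var u * Var v # fs) = (Poly_Mapping.single (ind (insert u (insert v B))) 1 :: ('v, 'k) mpoly)"
    by (simp add: fs Var_def mult_single)
  moreover have "Var u * Var v \<in> (edge_ideal E :: ('v, 'k) mpoly set)"
    unfolding edge_ideal_def using add_edge by (intro ideal_gen_base) auto
  ultimately show ?case using fs add_edge by (intro exI[of _ "Var u * Var v # fs"]) auto
qed

lemma has_match_add:
  "has_match E s (Poly_Mapping.keys a) \<Longrightarrow> has_match E s (Poly_Mapping.keys (a + c :: 'v \<Rightarrow>\<^sub>0 nat))"
  by (rule has_match_mono) (auto simp: in_keys_iff lookup_add)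

text \<open>A squarefree monomial of the ordinary power is divisible by a product of
  \<open>s\<close> edges, necessarily disjoint. Conversely the vertex set of a matching of size
  \<open>s\<close> is itself a squarefree monomial in that power, and it divides every monomial
  whose support contains it.\<close>

theorem squarefree_power_edge_ideal:
  fixes E :: "'v::finite set set"
  shows "(squarefree_power (edge_ideal E) s :: ('v, 'k::field) mpoly set) =
    monomial_ideal {m. has_match E s (Poly_Mapping.keys m)}"
proof (rule antisym)
  have "ideal_power (edge_ideal E) s \<subseteq> (monomial_ideal (Collect (edge_multiple E s)) :: ('v, 'k) mpoly set)"
    unfolding ideal_power_def
  proof (rule ideal_gen_minimal)
    show "is_ideal (monomial_ideal (Collect (edge_multiple E s)) :: ('v, 'k) mpoly set)"
      by (rule is_ideal_monomial_ideal) (metis edge_multiple_add mem_Collect_eq)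
  qed (use prod_edge_ideal in blast)
  then show "squarefree_power (edge_ideal E) s \<subseteq>
      (monomial_ideal {m. has_match E s (Poly_Mapping.keys m)} :: ('v, 'k) mpoly set)"
    unfolding squarefree_power_def
    by (intro ideal_gen_minimal is_ideal_monomial_ideal)
      (auto simp: monomial_ideal_def squarefree_monomial_def has_match_add dest!: subsetD intro!: has_match_squarefree)
  show "monomial_ideal {m. has_match E s (Poly_Mapping.keys m)} \<subseteq>
      (squarefree_power (edge_ideal E) s :: ('v, 'k) mpoly set)"
  proof (rule monomial_ideal_subset)
    show "is_ideal (squarefree_power (edge_ideal E) s :: ('v, 'k) mpoly set)"
      unfolding squarefree_power_def by (rule is_ideal_ideal_gen)
    fix m :: "'v \<Rightarrow>\<^sub>0 nat" assume "m \<in> {m. has_match E s (Poly_Mapping.keys m)}"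
    then obtain B where B: "B \<subseteq> Poly_Mapping.keys m" "matchable E B" "card B = 2 * s"
      unfolding has_match_def by blast
    have "m = (m - ind B) + ind B"
      using B by (intro poly_mapping_eqI) (auto simp: lookup_add lookup_minus lookup_ind in_keys_iff subset_iff)
    moreover obtain fs where "2 * length fs = card B" "set fs \<subseteq> edge_ideal E"
      "prod_list fs = (Poly_Mapping.single (ind B) 1 :: ('v, 'k) mpoly)"
      using matchable_monomial[OF B(2)] by blast
    then have "Poly_Mapping.single (ind B) 1 \<in> (ideal_power (edge_ideal E) s :: ('v, 'k) mpoly set)"
      unfolding ideal_power_def using B by (intro ideal_gen_base) (metis (mono_tags, lifting) mem_Collect_eq mult_left_cancel zero_neq_numeral)
    then have "Poly_Mapping.single (ind B) 1 \<in> (squarefree_power (edge_ideal E) s :: ('v, 'k) mpoly set)"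
      unfolding squarefree_power_def
      by (intro ideal_gen_base) (auto simp: squarefree_monomial_def lookup_ind intro!: exI[of _ "ind B"])
    ultimately show "\<exists>a c. m = c + a \<and>
       Poly_Mapping.single a 1 \<in> (squarefree_power (edge_ideal E) s :: ('v, 'k) mpoly set)" by blast
  qed
qed

lemma koszul_bounded_match_ideal:
  fixes E :: "'v::finite set set"
  defines "N s \<equiv> {m. has_match E s (Poly_Mapping.keys m)}"
  shows "koszul_bounded (ideal_part (monomial_ideal (N s) :: ('v, 'k::field) mpoly set))
    (int (card (UNIV :: 'v set) div 2 + s))"
  unfolding koszul_bounded_def
proof (intro allI impI)
  fix i d and f :: "'v set \<Rightarrow> ('v, 'k) pvec"
  assume d: "int (card (UNIV :: 'v set) div 2 + s) < d"
    and f: "\<forall>T. card T = i \<longrightarrow> f T \<in> ideal_part (monomial_ideal (N s)) d"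
    and cyc: "\<forall>T l. Suc (card T) = i \<longrightarrow> wbd Var (\<lambda>S. f S l) T = 0"
  have f0: "f T = rank_one (f T 0) \<and> homogeneous d (f T 0) \<and> Poly_Mapping.keys (f T 0) \<subseteq> N s" if T: "card T = i" for T
  proof -
    have "f T \<in> ideal_part (monomial_ideal (N s)) d" using f T by blast
    then obtain p where "f T = rank_one p" "p \<in> monomial_ideal (N s)" "homogeneous d p"
      unfolding ideal_part_def by blast
    then show ?thesis by (simp add: rank_one_def monomial_ideal_def)
  qed
  have "\<exists>g. (\<forall>T. card T = Suc i \<longrightarrow> homogeneous (d - 1) (g T) \<and> Poly_Mapping.keys (g T) \<subseteq> N s) \<and>
    (\<forall>T. card T = i \<longrightarrow> wbd Var g T = f T 0)"
  proof (rule koszul_exact_monomial)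
    show "a + c \<in> N s" if "a \<in> N s" for a c using that has_match_add by (auto simp: N_def)
    fix b :: "'v \<Rightarrow>\<^sub>0 nat" assume "int (mon_deg b) = d + int i"
    then have "mon_deg b > card (UNIV :: 'v set) div 2 + s + i" using d by linarith
    then show "acyclic_at TYPE('k) (koszul_cells (N s) b) i \<or>
       (\<forall>T. card T = i \<longrightarrow> Poly_Mapping.lookup (f T 0) (b - ind T) = 0)"
      unfolding N_def by (intro disjI1 acyclic_koszul_cells_match)
  qed (use f0 cyc in auto)
  then obtain g where g: "\<And>T. card T = Suc i \<Longrightarrow> homogeneous (d - 1) (g T) \<and> Poly_Mapping.keys (g T) \<subseteq> N s"
    and gf: "\<And>T. card T = i \<Longrightarrow> wbd Var g T = f T 0" by blast
  have "wbd Var (\<lambda>S. rank_one (g S) l) T = f T l" if "card T = i" for T l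
  proof (cases "l = 0")
    case True
    then show ?thesis using gf[OF that] by (simp add: rank_one_def)
  next
    case False
    have "f T l = rank_one (f T 0) l" using f0[OF that] by metis
    then show ?thesis using False by (simp add: rank_one_def wbd_def)
  qed
  moreover have "rank_one (g T) \<in> ideal_part (monomial_ideal (N s)) (d - 1)" if "card T = Suc i" for T
    using g[OF that] by (simp add: rank_one_in_ideal_part monomial_ideal_def)
  ultimately show "\<exists>g. (\<forall>T. card T = Suc i \<longrightarrow> g T \<in> ideal_part (monomial_ideal (N s)) (d - 1)) \<and>
          (\<forall>T l. card T = i \<longrightarrow> wbd Var (\<lambda>S. g S l) T = f T l)"
    by (intro exI[of _ "\<lambda>T. rank_one (g T)"]) simp
qed

section \<open>Matchings of the graph and Hamiltonian paths\<close>

lemma matching_matchable: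
  fixes E :: "'v::finite set set"
  assumes "simple_graph E" "matching E M"
  shows "matchable E (\<Union>M) \<and> card (\<Union>M) = 2 * card M"
proof -
  have "finite M" by simp
  then show ?thesis using assms(2)
  proof (induction M rule: finite_induct)
    case empty
    then show ?case by (simp add: matchable.empty)
  next
    case (insert e M)
    have "matching E M" using insert.prems by (auto simp: matching_def pairwise_insert)
    then have IH: "matchable E (\<Union>M)" "card (\<Union>M) = 2 * card M" using insert.IH by auto
    have "e \<in> E" using insert.prems by (simp add: matching_def)
    moreover have "card e = 2" using \<open>e \<in> E\<close> assms(1) by (simp add: simple_graph_def)
    ultimately obtain u v where e: "e = {u, v}" "u \<noteq> v" "{u, v} \<in> E" by (auto simp: card_2_iff)
    have "e \<inter> f = {}" if "f \<in> M" for f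
      using insert.prems insert.hyps that unfolding matching_def disjoint_def
      by (metis insert_iff)
    then have n: "u \<notin> \<Union>M" "v \<notin> \<Union>M" using e by auto
    have "\<Union>(insert e M) = insert u (insert v (\<Union>M))" using e by auto
    then show ?case using matchable.add_edge[OF IH(1) e(3,2) n] IH(2) e(2) n insert.hyps by simp
  qed
qed

lemma finite_matching_cards: "finite {card M | M. matching (E :: 'v::finite set set) M}"
proof -
  have "{card M | M. matching E M} = card ` {M. matching E M}" by auto
  then show ?thesis by simp
qed

lemma card_le_matching_number: "matching (E :: 'v::finite set set) M \<Longrightarrow> card M \<le> matching_number E"
  unfolding matching_number_def by (rule Max_ge[OF finite_matching_cards]) auto

text \<open>Take every second edge of the path, beginning with the first one; for an odd number of
  vertices the last vertex stays unmatched.\<close>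

lemma path_matching:
  fixes E :: "'v::finite set set"
  assumes "distinct p" "successively (\<lambda>u v. {u, v} \<in> E) p"
  shows "\<exists>M. matching E M \<and> \<Union>M \<subseteq> set p \<and> card M = length p div 2"
  using assms
proof (induction p rule: induct_list012)
  case 1
  then show ?case by (intro exI[of _ "{}"]) (simp add: matching_def)
next
  case (2 x)
  then show ?case by (intro exI[of _ "{}"]) (simp add: matching_def)
next
  case (3 x y zs)
  have "successively (\<lambda>u v. {u, v} \<in> E) zs" using 3 by (cases zs) auto
  then obtain M where M: "matching E M" "\<Union>M \<subseteq> set zs" "card M = length zs div 2" using 3 by auto
  have new: "{x, y} \<inter> f = {}" if "f \<in> M" for f using M(2) 3(3) that by auto
  then have "{x, y} \<notin> M" by auto
  moreover have "matching E (insert {x, y} M)"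
    using M(1) 3(4) new by (auto simp: matching_def pairwise_insert disjnt_def)
  ultimately show ?case using M by (intro exI[of _ "insert {x, y} M"]) auto
qed

lemma semi_hamiltonian_matching_number:
  fixes E :: "'v::finite set set"
  assumes "semi_hamiltonian E"
  shows "card (UNIV :: 'v set) div 2 \<le> matching_number E"
proof -
  obtain p where p: "distinct p" "set p = UNIV" "successively (\<lambda>u v. {u, v} \<in> E) p"
    using assms unfolding semi_hamiltonian_def hamiltonian_path_def by blast
  obtain M where "matching E M" "card M = length p div 2" using path_matching[OF p(1,3)] by blast
  then show ?thesis using card_le_matching_number[of E M] distinct_card[OF p(1)] p(2) by simp
qed

theorem corollary3p7:
  fixes E :: "'v::finite set set" and s :: nat
  assumes "simple_graph E"
    and "semi_hamiltonian E"
    and "s \<ge> 1"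
    and "s \<le> matching_number E"
  shows "reg_ideal (squarefree_power (edge_ideal E :: ('v, 'k::field) mpoly set) s)
           \<le> int (matching_number E + s)"
proof -
  let ?I = "monomial_ideal {m. has_match E s (Poly_Mapping.keys m)} :: ('v, 'k) mpoly set"
  have "matching_number E \<in> {card M | M. matching E M}"
    unfolding matching_number_def
    by (rule Max_in[OF finite_matching_cards]) (auto simp: matching_def intro: exI[of _ "{}"])
  then obtain M where M: "matching E M" "card M = matching_number E" by auto
  \<comment> \<open>The hypothesis \<open>s \<le> matching_number E\<close> is used here: the
    monomial of \<open>B\<close> shows that the ideal is nonzero, as the regularity bound
    requires.\<close>
  then obtain B where B: "matchable E B" "card B = 2 * s"
    using matching_matchable[OF assms(1) M(1)] matchable_subset[of E "\<Union>M" s] assms(4) by auto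
  have "reg_ideal ?I \<le> int (card (UNIV :: 'v set) div 2 + s)"
  proof (rule reg_ideal_le)
    show "is_ideal ?I" by (rule is_ideal_monomial_ideal) (simp add: has_match_add)
    show "koszul_bounded (ideal_part ?I) (int (card (UNIV :: 'v set) div 2 + s))"
      by (rule koszul_bounded_match_ideal)
    show "Poly_Mapping.single (ind B) 1 \<in> ?I" using B by (auto simp: monomial_ideal_def has_match_def)
    show "homogeneous (int (mon_deg (ind B))) (Poly_Mapping.single (ind B) (1::'k))"
      by (simp add: homogeneous_def)
    show "Poly_Mapping.single (ind B) (1::'k) \<noteq> 0"
      by (metis lookup_single_eq lookup_zero zero_neq_one)
  qed
  then show ?thesis
    using semi_hamiltonian_matching_number[OF assms(2)] by (simp add: squarefree_power_edge_ideal)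
qed

end
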